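(* Fix the data $c>0$, $u_X,u_Y\ge 0$, $0\le a_k\le b_k\le 1$, rectangles $B_k=[x_{1k},x_{2k}]\times[y_{1k},y_{2k}]\subset\mathcal{D}_0$ ($k=1,\dots,n$, endpoints possibly $\infty$), and $S=\{(x,y)\in\mathcal{D}_0:y\ge g(x)\}$ with $g:[x_0,\infty)\to[y_0,\infty]$ measurable. The OU-DRO problem is: maximize $\int_S f$ over nonnegative measurable $f$ on $\mathcal{D}_0$ subject to $\int_{\mathcal{D}_0}f=c$, $\int_{y_0}^\infty f(x_0,y)dy\le u_X$, $\int_{x_0}^\infty f(x,y_0)dx\le u_Y$, $a_kc\le\int_{B_k}f\le b_kc$ ($k=1,\dots,n$), and $f(x',y')\ge f(x,y)$ whenever $x_0\le x'\le x$, $y_0\le y'\le y$. Let (II) denote the moment problem: maximize $c\,E_Q[\lambda(S\cap R_{Z,W})/\lambda(R_{Z,W})]$ over probability distributions $Q$ of $(Z,W)$ on $\Theta=(0,\infty)^N\times((0,\infty)\times[0,\infty)^{N-1})$, $N=12n+3$, subject to $E_Q[\sum_iW_i/\lambda(R_{Z,W})]\le u_X/c$, $E_Q[\sum_iZ_i/\lambda(R_{Z,W})]\le u_Y/c$, $a_k\le E_Q[\lambda(B_k\cap R_{Z,W})/\lambda(R_{Z,W})]\le b_k$; and let (III) be problem (II) restricted to $Q$ supported on at most $n+3$ points of $\Theta$. Then: (1) The OU-DRO problem, (II) and (III) have the same optimal value; and if $Q^*$ is optimal for (II), then the density of $P^*=c\int W_{R_{z,w}}\,dQ^*(z,w)$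 is optimal for the OU-DRO problem. (2) If the constraint $\int_{\mathcal{D}_0}f=c$ is replaced by $l_{\bar F}\le\int_{\mathcal{D}_0}f\le u_{\bar F}$ (with $0<l_{\bar F}\le u_{\bar F}$), the optimal value equals that of (III) with $c$ as an additional decision variable constrained to $[l_{\bar F},u_{\bar F}]$; and if $(c^*,Q^* )$ is optimal for the latter (with $Q^*$ discrete on at most $n+3$ points), the density of $c^*\int W_{R_{z,w}}dQ^*(z,w)$ is optimal for the modified OU-DRO problem.
   Context: $\mathcal{D}_0=[x_0,\infty)\times[y_0,\infty)$; $\lambda$ is Lebesgue measure on $\mathbb{R}^2$; $(t)_+=\max(t,0)$. For $z\in(0,\infty)^N$, $w\in[0,\infty)^N$ with $w_1>0$, define $h^*(x;z,w)=y_0+\sum_{j=1}^{N+1-i}w_j$ for $x_0+\sum_{j<i}z_j<x\le x_0+\sum_{j\le i}z_j$ ($i=1,\dots,N$), $h^*(x_0;z,w)=y_0+\sum_j w_j$, and the closed set $R_{z,w}=\{(x,y)\in\mathcal{D}_0:x\le x_0+\sum_j z_j,\ y_0\le y\le h^*(x;z,w)\}$; $W_{R_{z,w}}$ is the uniform distribution on $R_{z,w}$. Then $\lambda(R_{z,w})=\sum_{i=1}^N\sum_{j=1}^{N+1-i}z_iw_j$ and $\lambda(S\cap R_{z,w})=\int_{x_0}^{x_0+\sum z_j}(h^*(x;z,w)-g(x))_+dx$. *)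

theory Defs
  imports "HOL-Probability.Probability"
begin

definition D0 :: "real \<Rightarrow> real \<Rightarrow> (real \<times> real) set" where
  "D0 x0 y0 = {x0..} \<times> {y0..}"

definition Sg :: "real \<Rightarrow> real \<Rightarrow> (real \<Rightarrow> ereal) \<Rightarrow> (real \<times> real) set" where
  "Sg x0 y0 g = {p \<in> D0 x0 y0. g (fst p) \<le> ereal (snd p)}"

definition Box :: "real \<Rightarrow> real \<Rightarrow> ereal \<Rightarrow> ereal \<Rightarrow> ereal \<Rightarrow> ereal \<Rightarrow> (real \<times> real) set" where
  "Box x0 y0 x1 x2 y1 y2 = {p \<in> D0 x0 y0.
      x1 \<le> ereal (fst p) \<and> ereal (fst p) \<le> x2 \<and> y1 \<le> ereal (snd p) \<and> ereal (snd p) \<le> y2}"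

text \<open>Feasibility for the OU-DRO problem. The mass constraint on the total integral M is
  a parameter massOK (M = c in part (1), l <= M <= u in part (2)); the box constraints are
  a_k M <= int_{B_k} f <= b_k M.\<close>
definition ou_feasible ::
  "real \<Rightarrow> real \<Rightarrow> nat \<Rightarrow> (nat \<Rightarrow> ereal) \<Rightarrow> (nat \<Rightarrow> ereal) \<Rightarrow> (nat \<Rightarrow> ereal) \<Rightarrow> (nat \<Rightarrow> ereal)
   \<Rightarrow> (nat \<Rightarrow> real) \<Rightarrow> (nat \<Rightarrow> real) \<Rightarrow> real \<Rightarrow> real \<Rightarrow> (ennreal \<Rightarrow> bool)
   \<Rightarrow> (real \<times> real \<Rightarrow> ennreal) \<Rightarrow> bool" where
  "ou_feasible x0 y0 n x1 x2 y1 y2 a b uX uY massOK f \<longleftrightarrow>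
     f \<in> borel_measurable (restrict_space lborel (D0 x0 y0)) \<and>
     massOK (\<integral>\<^sup>+ p\<in>D0 x0 y0. f p \<partial>lborel) \<and>
     (\<integral>\<^sup>+ y\<in>{y0..}. f (x0, y) \<partial>lborel) \<le> ennreal uX \<and>
     (\<integral>\<^sup>+ x\<in>{x0..}. f (x, y0) \<partial>lborel) \<le> ennreal uY \<and>
     (\<forall>k\<in>{1..n}.
        ennreal (a k) * (\<integral>\<^sup>+ p\<in>D0 x0 y0. f p \<partial>lborel)
          \<le> (\<integral>\<^sup>+ p\<in>Box x0 y0 (x1 k) (x2 k) (y1 k) (y2 k). f p \<partial>lborel) \<and>
        (\<integral>\<^sup>+ p\<in>Box x0 y0 (x1 k) (x2 k) (y1 k) (y2 k). f p \<partial>lborel)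
          \<le> ennreal (b k) * (\<integral>\<^sup>+ p\<in>D0 x0 y0. f p \<partial>lborel)) \<and>
     (\<forall>x y x' y'. x0 \<le> x' \<and> x' \<le> x \<and> y0 \<le> y' \<and> y' \<le> y \<longrightarrow> f (x, y) \<le> f (x', y'))"

definition ou_value ::
  "real \<Rightarrow> real \<Rightarrow> nat \<Rightarrow> (nat \<Rightarrow> ereal) \<Rightarrow> (nat \<Rightarrow> ereal) \<Rightarrow> (nat \<Rightarrow> ereal) \<Rightarrow> (nat \<Rightarrow> ereal)
   \<Rightarrow> (nat \<Rightarrow> real) \<Rightarrow> (nat \<Rightarrow> real) \<Rightarrow> real \<Rightarrow> real \<Rightarrow> (ennreal \<Rightarrow> bool)
   \<Rightarrow> (real \<Rightarrow> ereal) \<Rightarrow> ereal" where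
  "ou_value x0 y0 n x1 x2 y1 y2 a b uX uY massOK g =
     Sup {enn2ereal (\<integral>\<^sup>+ p\<in>Sg x0 y0 g. f p \<partial>lborel) | f.
            ou_feasible x0 y0 n x1 x2 y1 y2 a b uX uY massOK f}"

definition hstar :: "nat \<Rightarrow> real \<Rightarrow> real \<Rightarrow> (nat \<Rightarrow> real) \<Rightarrow> (nat \<Rightarrow> real) \<Rightarrow> real \<Rightarrow> real" where
  "hstar N x0 y0 z w x =
     (if x = x0 then y0 + sum w {1..N}
      else y0 + (\<Sum>i\<in>{1..N}. if x0 + sum z {1..<i} < x \<and> x \<le> x0 + sum z {1..i}
                              then sum w {1..N+1-i} else 0))"

definition Rzw :: "nat \<Rightarrow> real \<Rightarrow> real \<Rightarrow> (nat \<Rightarrow> real) \<times> (nat \<Rightarrow> real) \<Rightarrow> (real \<times> real) set" where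
  "Rzw N x0 y0 \<theta> = {p \<in> D0 x0 y0. fst p \<le> x0 + sum (fst \<theta>) {1..N}
                        \<and> snd p \<le> hstar N x0 y0 (fst \<theta>) (snd \<theta>) (fst p)}"

definition Theta :: "nat \<Rightarrow> ((nat \<Rightarrow> real) \<times> (nat \<Rightarrow> real)) set" where
  "Theta N = (PiE {1..N} (\<lambda>_. {0<..})) \<times> (PiE {1..N} (\<lambda>i. if i = 1 then {0<..} else {0..}))"

definition ThetaM :: "nat \<Rightarrow> ((nat \<Rightarrow> real) \<times> (nat \<Rightarrow> real)) measure" where
  "ThetaM N = (PiM {1..N} (\<lambda>_. lborel)) \<Otimes>\<^sub>M (PiM {1..N} (\<lambda>_. lborel))"

definition ratio :: "nat \<Rightarrow> real \<Rightarrow> real \<Rightarrow> (real \<times> real) set \<Rightarrow> (nat \<Rightarrow> real) \<times> (nat \<Rightarrow> real) \<Rightarrow> real" where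
  "ratio N x0 y0 A \<theta> = measure lborel (A \<inter> Rzw N x0 y0 \<theta>) / measure lborel (Rzw N x0 y0 \<theta>)"

definition II_feasible ::
  "real \<Rightarrow> real \<Rightarrow> nat \<Rightarrow> (nat \<Rightarrow> ereal) \<Rightarrow> (nat \<Rightarrow> ereal) \<Rightarrow> (nat \<Rightarrow> ereal) \<Rightarrow> (nat \<Rightarrow> ereal)
   \<Rightarrow> (nat \<Rightarrow> real) \<Rightarrow> (nat \<Rightarrow> real) \<Rightarrow> real \<Rightarrow> real \<Rightarrow> real
   \<Rightarrow> ((nat \<Rightarrow> real) \<times> (nat \<Rightarrow> real)) measure \<Rightarrow> bool" where
  "II_feasible x0 y0 n x1 x2 y1 y2 a b uX uY c Q \<longleftrightarrow>
     (let N = 12 * n + 3 in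
       prob_space Q \<and> sets Q = sets (ThetaM N) \<and> emeasure Q (Theta N) = 1 \<and>
       (\<integral>\<^sup>+ \<theta>. ennreal (sum (snd \<theta>) {1..N} / measure lborel (Rzw N x0 y0 \<theta>)) \<partial>Q)
          \<le> ennreal (uX / c) \<and>
       (\<integral>\<^sup>+ \<theta>. ennreal (sum (fst \<theta>) {1..N} / measure lborel (Rzw N x0 y0 \<theta>)) \<partial>Q)
          \<le> ennreal (uY / c) \<and>
       (\<forall>k\<in>{1..n}.
          ennreal (a k) \<le> (\<integral>\<^sup>+ \<theta>. ennreal (ratio N x0 y0 (Box x0 y0 (x1 k) (x2 k) (y1 k) (y2 k)) \<theta>) \<partial>Q) \<and>
          (\<integral>\<^sup>+ \<theta>. ennreal (ratio N x0 y0 (Box x0 y0 (x1 k) (x2 k) (y1 k) (y2 k)) \<theta>) \<partial>Q)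
             \<le> ennreal (b k)))"

definition III_feasible ::
  "real \<Rightarrow> real \<Rightarrow> nat \<Rightarrow> (nat \<Rightarrow> ereal) \<Rightarrow> (nat \<Rightarrow> ereal) \<Rightarrow> (nat \<Rightarrow> ereal) \<Rightarrow> (nat \<Rightarrow> ereal)
   \<Rightarrow> (nat \<Rightarrow> real) \<Rightarrow> (nat \<Rightarrow> real) \<Rightarrow> real \<Rightarrow> real \<Rightarrow> real
   \<Rightarrow> ((nat \<Rightarrow> real) \<times> (nat \<Rightarrow> real)) measure \<Rightarrow> bool" where
  "III_feasible x0 y0 n x1 x2 y1 y2 a b uX uY c Q \<longleftrightarrow>
     II_feasible x0 y0 n x1 x2 y1 y2 a b uX uY c Q \<and>
     (\<exists>A. finite A \<and> card A \<le> n + 3 \<and> A \<subseteq> Theta (12 * n + 3) \<and> emeasure Q A = 1)"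

definition II_obj :: "real \<Rightarrow> real \<Rightarrow> nat \<Rightarrow> (real \<times> real) set \<Rightarrow> real
   \<Rightarrow> ((nat \<Rightarrow> real) \<times> (nat \<Rightarrow> real)) measure \<Rightarrow> ereal" where
  "II_obj x0 y0 n S c Q = ereal c * enn2ereal (\<integral>\<^sup>+ \<theta>. ennreal (ratio (12 * n + 3) x0 y0 S \<theta>) \<partial>Q)"

definition II_value where
  "II_value x0 y0 n x1 x2 y1 y2 a b uX uY g c =
     Sup {II_obj x0 y0 n (Sg x0 y0 g) c Q | Q. II_feasible x0 y0 n x1 x2 y1 y2 a b uX uY c Q}"

definition III_value where
  "III_value x0 y0 n x1 x2 y1 y2 a b uX uY g c =
     Sup {II_obj x0 y0 n (Sg x0 y0 g) c Q | Q. III_feasible x0 y0 n x1 x2 y1 y2 a b uX uY c Q}"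

definition III_var_value where
  "III_var_value x0 y0 n x1 x2 y1 y2 a b uX uY g l u =
     Sup {II_obj x0 y0 n (Sg x0 y0 g) c Q | c Q. l \<le> c \<and> c \<le> u \<and>
            III_feasible x0 y0 n x1 x2 y1 y2 a b uX uY c Q}"

text \<open>Density of the mixture P = c int W_{R_theta} dQ(theta) of uniform distributions.\<close>
definition mix_density :: "real \<Rightarrow> real \<Rightarrow> nat \<Rightarrow> real
   \<Rightarrow> ((nat \<Rightarrow> real) \<times> (nat \<Rightarrow> real)) measure \<Rightarrow> real \<times> real \<Rightarrow> ennreal" where
  "mix_density x0 y0 n c Q p = ennreal c *
     (\<integral>\<^sup>+ \<theta>. ennreal (indicator (Rzw (12 * n + 3) x0 y0 \<theta>) p
                         / measure lborel (Rzw (12 * n + 3) x0 y0 \<theta>)) \<partial>Q)"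

end

theory Submission
  imports Defs
begin

text \<open>
  Every constraint and the objective are integrals of \<open>f\<close> against finitely many measures: Lebesgue
  measure on a region, or length on the two boundary lines of the quadrant.  By Fubini, mixtures of
  uniform distributions on the regions \<open>R\<^sub>z\<^sub>,\<^sub>w\<close> are feasible with the same objective.  Conversely,
  the vector of these integrals is an integral over \<open>t\<close> of the vectors of measures of the level sets
  of \<open>f\<close>, hence a finite conic combination of such vectors, so \<open>f\<close> may be replaced by
  a density of bounded support.  Averaging that density in \<open>y\<close> over the slabs cut out by the
  horizontal box edges keeps it decreasing, preserves the masses of the boxes, and only increases
  the mass of \<open>S\<close>, because \<open>S\<close> is closed upwards.  The level sets of the average are staircases
  with at most \<open>2n + 1\<close> steps, and a linear programming argument cuts a finite mixture of them down
  to \<open>n + 3\<close> atoms.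
\<close>

text \<open>Equality constraints (the mass, and boxes with \<open>a k = b k\<close>) leave no room
  for approximation, so every passage to finitely many pieces has to reproduce the integrals
  exactly. Hence the discretization rests on a cone lemma without closures. The two edge integrals
  live on lines, which are null for area, so they are followed as measures in their own right.
  Replacing a level set by a staircase can lower them, which is harmless because they are only
  bounded from above.

  The number \<open>n + 3\<close> counts the rows to be kept: the mass, \<open>n\<close> boxes and
  two edges. The objective is an extra row in the exact decompositions only; in the final linear
  program it merely must not decrease. The condition that \<open>Q\<close> has total mass 1 is no
  further row: once the weights are multiplied by the areas of the regions and divided by
  \<open>c\<close>, it is the mass row. Part (2) is the same argument with \<open>c\<close> taken to
  be the mass of the given density.\<close>

section \<open>Finite cones and integrals\<close>

text \<open>A supporting hyperplane at the origin for a convex set that misses it. Convexity comes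
  without any topology, so only a weak inequality can be expected. When coordinate \<open>k\<close>
  changes sign on the set, the slice where it vanishes lives in the remaining coordinates, and the
  functional found there is extended by one coefficient as in the Hahn-Banach theorem.\<close>

lemma weak_separation:
  fixes C :: "('i \<Rightarrow> real) set"
  assumes "finite I" and "C \<noteq> {}"
    and "\<And>u v r. u \<in> C \<Longrightarrow> v \<in> C \<Longrightarrow> 0 \<le> r \<Longrightarrow> r \<le> 1 \<Longrightarrow> (\<lambda>i. (1 - r) * u i + r * v i) \<in> C"
    and "\<And>c. c \<in> C \<Longrightarrow> \<exists>i\<in>I. c i \<noteq> 0"
  shows "\<exists>a. (\<exists>i\<in>I. a i \<noteq> 0) \<and> (\<forall>c\<in>C. 0 \<le> (\<Sum>i\<in>I. a i * c i))"
  using assms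
proof (induction I arbitrary: C rule: finite_induct)
  case empty
  then show ?case by blast
next
  case (insert k I)
  have single: "(\<Sum>i\<in>insert k I. (if i = k then e else 0) * c i) = e * c k" for c and e :: real
    using insert.hyps by (simp add: sum.neutral)
  consider "\<forall>c\<in>C. 0 \<le> c k" | "\<forall>c\<in>C. c k \<le> 0"
    | p q where "p \<in> C" "q \<in> C" "p k < 0" "0 < q k"
    by (meson not_le)
  then show ?case
  proof cases
    case 1
    then show ?thesis
      by (intro exI[of _ "\<lambda>i. if i = k then 1 else 0"]) (use single[of 1] in auto)
  next
    case 2
    then show ?thesis
      by (intro exI[of _ "\<lambda>i. if i = k then - 1 else 0"]) (use single[of "-1"] in auto)
  next
    case 3
    define C0 where "C0 = {c \<in> C. c k = 0}"
    \<comment> \<open>The point where the segment from \<open>u\<close> to \<open>v\<close> crosses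
      the hyperplane on which coordinate \<open>k\<close> vanishes.\<close>
    have mix: "(\<lambda>i. (1 - u k / (u k - v k)) * u i + u k / (u k - v k) * v i) \<in> C0"
      if "u \<in> C" "v \<in> C" "u k > 0" "v k < 0" for u v
    proof -
      have "(1 - u k / (u k - v k)) * u k + u k / (u k - v k) * v k = 0"
        using that by (simp add: field_simps)
      moreover have "0 \<le> u k / (u k - v k)" "u k / (u k - v k) \<le> 1"
        using that by (auto simp: field_simps)
      ultimately show ?thesis
        unfolding C0_def using insert.prems(2)[OF that(1,2), of "u k / (u k - v k)"] by blast
    qed
    have "\<exists>a. (\<exists>i\<in>I. a i \<noteq> 0) \<and> (\<forall>c\<in>C0. 0 \<le> (\<Sum>i\<in>I. a i * c i))"
    proof (rule insert.IH)
      show "C0 \<noteq> {}" using mix[OF 3(2,1,4,3)] by blast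
      show "(\<lambda>i. (1 - r) * u i + r * v i) \<in> C0"
        if "u \<in> C0" "v \<in> C0" "0 \<le> r" "r \<le> 1" for u v r
        using that insert.prems(2) by (simp add: C0_def)
      show "\<exists>i\<in>I. c i \<noteq> 0" if "c \<in> C0" for c
        using that insert.prems(3) by (force simp: C0_def)
    qed
    then obtain a where a: "\<exists>i\<in>I. a i \<noteq> 0" and a0: "\<And>c. c \<in> C0 \<Longrightarrow> 0 \<le> (\<Sum>i\<in>I. a i * c i)"
      by blast
    define U where "U c = (\<Sum>i\<in>I. a i * c i)" for c
    have U_lin: "U (\<lambda>i. (1 - r) * u i + r * v i) = (1 - r) * U u + r * U v" for r u v
      unfolding U_def sum_distrib_left sum.distrib[symmetric] by (simp add: algebra_simps)
    \<comment> \<open>Nonnegativity of \<open>U\<close> at the crossing point, cleared of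
      denominators: every lower bound for the new coefficient lies below every upper bound.\<close>
    have cross: "- U u / u k \<le> U v / (- v k)" if "u \<in> C" "v \<in> C" "u k > 0" "v k < 0" for u v
    proof -
      have "0 \<le> U (\<lambda>i. (1 - u k / (u k - v k)) * u i + u k / (u k - v k) * v i)"
        using a0[OF mix[OF that]] by (simp add: U_def)
      also have "\<dots> = (1 - u k / (u k - v k)) * U u + u k / (u k - v k) * U v"
        by (rule U_lin)
      also have "1 - u k / (u k - v k) = - v k / (u k - v k)"
        using that by (simp add: field_simps)
      also have "\<dots> * U u + u k / (u k - v k) * U v = (- v k * U u + u k * U v) / (u k - v k)"
        by (simp add: add_divide_distrib diff_divide_distrib)
      finally have "0 \<le> - v k * U u + u k * U v"
        using that by (simp add: zero_le_divide_iff)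
      then show ?thesis using that by (simp add: field_simps)
    qed
    \<comment> \<open>The lower bounds that elements with positive coordinate \<open>k\<close>
      impose on the new coefficient. Their supremum also respects the upper bounds, by
      \<open>cross\<close>.\<close>
    define B where "B = (\<lambda>u. - U u / u k) ` {u \<in> C. 0 < u k}"
    define \<beta> where "\<beta> = Sup B"
    have bdd: "bdd_above B"
      unfolding B_def by (rule bdd_aboveI2[where M = "U p / (- p k)"]) (use cross[OF _ 3(1) _ 3(3)] in blast)
    have ne: "B \<noteq> {}" using 3 by (auto simp: B_def)
    have up: "- U u / u k \<le> \<beta>" if "u \<in> C" "0 < u k" for u
      unfolding \<beta>_def by (rule cSup_upper[OF _ bdd]) (use that in \<open>auto simp: B_def\<close>)
    have low: "\<beta> \<le> U v / (- v k)" if "v \<in> C" "v k < 0" for v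
      unfolding \<beta>_def by (rule cSup_least[OF ne]) (use that cross in \<open>auto simp: B_def\<close>)
    have "0 \<le> U c + \<beta> * c k" if "c \<in> C" for c
    proof (cases "c k" "0::real" rule: linorder_cases)
      case less
      then show ?thesis using low[OF that less] by (simp add: field_simps)
    next
      case equal
      then show ?thesis using a0[of c] that by (simp add: C0_def U_def)
    next
      case greater
      then show ?thesis using up[OF that greater] by (simp add: field_simps)
    qed
    moreover have "(\<Sum>i\<in>insert k I. (a(k := \<beta>)) i * c i) = U c + \<beta> * c k" for c
    proof -
      have "(\<Sum>i\<in>I. (a(k := \<beta>)) i * c i) = U c"
        unfolding U_def using insert.hyps by (intro sum.cong) auto
      then show ?thesis using insert.hyps by simp
    qed
    ultimately have "\<forall>c\<in>C. 0 \<le> (\<Sum>i\<in>insert k I. (a(k := \<beta>)) i * c i)" by metis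
    moreover have "\<exists>i\<in>insert k I. (a(k := \<beta>)) i \<noteq> 0"
      using a insert.hyps by (metis fun_upd_other insertCI)
    ultimately show ?thesis by blast
  qed
qed

text \<open>The vector of integrals lies in the cone generated by the vectors at points of
  \<open>A\<close>, not just in its closure. Otherwise a functional separates it weakly from the
  cone. The resulting function is nonnegative on \<open>A\<close> with integral zero, so it vanishes
  almost everywhere. This is a linear relation between the rows on a smaller set \<open>A\<close>,
  and one row can be eliminated. A cone appears instead of a convex hull because \<open>M\<close>
  may have infinite mass.\<close>

lemma integral_in_finite_cone:
  fixes \<phi> :: "'i \<Rightarrow> 'a \<Rightarrow> real"
  assumes "finite I" and "\<And>i. i \<in> I \<Longrightarrow> integrable M (\<phi> i)" and "AE x in M. x \<in> A"
  shows "\<exists>F p. finite F \<and> F \<subseteq> A \<and> (\<forall>x. 0 \<le> p x) \<and>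
    (\<forall>i\<in>I. (\<Sum>x\<in>F. p x * \<phi> i x) = (\<integral>x. \<phi> i x \<partial>M))"
  using assms
proof (induction I arbitrary: A rule: finite_psubset_induct)
  case (psubset I)
  define v where "v i = (\<integral>x. \<phi> i x \<partial>M)" for i
  \<comment> \<open>Weights are zero off their finite set, so that two combinations can be mixed on
    the union of their supports.\<close>
  define K where "K = {(F, p). finite F \<and> F \<subseteq> A \<and> (\<forall>x. 0 \<le> p x) \<and> (\<forall>x. x \<notin> F \<longrightarrow> p x = (0::real))}"
  define S where "S = (\<lambda>(F, p) i. (\<Sum>x\<in>F. p x * \<phi> i x) - v i)"
  show ?case
  proof (rule ccontr)
    assume contra: "\<not> ?thesis"
    have "\<exists>a. (\<exists>i\<in>I. a i \<noteq> 0) \<and> (\<forall>c\<in>S ` K. 0 \<le> (\<Sum>i\<in>I. a i * c i))"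
    proof (rule weak_separation)
      show "finite I" by fact
      have "({}, \<lambda>_. 0) \<in> K" by (simp add: K_def)
      then show "S ` K \<noteq> {}" by blast
    next
      fix c assume "c \<in> S ` K"
      then obtain F p where "(F, p) \<in> K" "c = S (F, p)" by auto
      then show "\<exists>i\<in>I. c i \<noteq> 0"
        using contra unfolding K_def S_def v_def by simp blast
    next
      fix c d and r :: real
      assume "c \<in> S ` K" "d \<in> S ` K" and r: "0 \<le> r" "r \<le> 1"
      then obtain F p G q where 1: "(F, p) \<in> K" "c = S (F, p)" "(G, q) \<in> K" "d = S (G, q)" by auto
      define s where "s x = (1 - r) * p x + r * q x" for x
      have "(F \<union> G, s) \<in> K"
        using 1 r by (auto simp: K_def s_def)
      moreover have "S (F \<union> G, s) = (\<lambda>i. (1 - r) * c i + r * d i)"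
      proof
        fix i
        have "(\<Sum>x\<in>F \<union> G. p x * \<phi> i x) = (\<Sum>x\<in>F. p x * \<phi> i x)"
          by (rule sum.mono_neutral_right) (use 1 in \<open>auto simp: K_def\<close>)
        moreover have "(\<Sum>x\<in>F \<union> G. q x * \<phi> i x) = (\<Sum>x\<in>G. q x * \<phi> i x)"
          by (rule sum.mono_neutral_right) (use 1 in \<open>auto simp: K_def\<close>)
        moreover have "(\<Sum>x\<in>F \<union> G. s x * \<phi> i x)
            = (1 - r) * (\<Sum>x\<in>F \<union> G. p x * \<phi> i x) + r * (\<Sum>x\<in>F \<union> G. q x * \<phi> i x)"
          unfolding s_def sum_distrib_left sum.distrib[symmetric] by (simp add: algebra_simps)
        ultimately show "S (F \<union> G, s) i = (1 - r) * c i + r * d i"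
          using 1 by (simp add: S_def algebra_simps)
      qed
      ultimately show "(\<lambda>i. (1 - r) * c i + r * d i) \<in> S ` K" by (metis image_eqI)
    qed
    then obtain a k where k: "k \<in> I" "a k \<noteq> 0"
      and a: "\<And>c. c \<in> S ` K \<Longrightarrow> 0 \<le> (\<Sum>i\<in>I. a i * c i)" by blast
    define \<psi> where "\<psi> x = (\<Sum>i\<in>I. a i * \<phi> i x)" for x
    define av where "av = (\<Sum>i\<in>I. a i * v i)"
    \<comment> \<open>The separating inequality at one point with weight \<open>t\<close>. Letting
      \<open>t\<close> grow rules out a negative value of \<open>\<psi>\<close>.\<close>
    have cone: "av \<le> t * \<psi> x" if "x \<in> A" "0 \<le> t" for x and t :: real
    proof -
      have "({x}, \<lambda>y. if y = x then t else 0) \<in> K" using that by (simp add: K_def)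
      from a[OF imageI, OF this] have "0 \<le> (\<Sum>i\<in>I. a i * (t * \<phi> i x - v i))"
        by (simp add: S_def)
      then show ?thesis
        by (simp add: \<psi>_def av_def sum_distrib_left right_diff_distrib sum_subtractf mult_ac)
    qed
    have nonneg: "0 \<le> \<psi> x" if x: "x \<in> A" for x
    proof (rule ccontr)
      assume neg: "\<not> 0 \<le> \<psi> x"
      have "av \<le> ((\<bar>av\<bar> + 1) / (- \<psi> x)) * \<psi> x"
        by (rule cone[OF x]) (use neg in \<open>intro divide_nonneg_nonneg; simp\<close>)
      also have "\<dots> = - (\<bar>av\<bar> + 1)" using neg by (simp add: field_simps)
      finally show False by linarith
    qed
    have int: "integrable M \<psi>"
      unfolding \<psi>_def using psubset.prems(1) by (intro Bochner_Integration.integrable_sum integrable_mult_right) auto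
    have I\<psi>: "integral\<^sup>L M \<psi> = av"
      unfolding \<psi>_def av_def v_def using psubset.prems(1) by (subst Bochner_Integration.integral_sum) auto
    \<comment> \<open>The empty combination belongs to \<open>K\<close>, and there the separating
      inequality reads \<open>0 \<le> - av\<close>.\<close>
    have "av \<le> 0"
    proof -
      have "({}, \<lambda>_. 0) \<in> K" by (simp add: K_def)
      from a[OF imageI, OF this] show ?thesis by (simp add: S_def av_def sum_negf)
    qed
    moreover have nn: "AE x in M. 0 \<le> \<psi> x" using psubset.prems(2) nonneg by auto
    moreover have "0 \<le> integral\<^sup>L M \<psi>" using nn by (rule integral_nonneg_AE)
    ultimately have "integral\<^sup>L M \<psi> = 0" "av = 0" using I\<psi> by auto
    then have "AE x in M. \<psi> x = 0" using integral_nonneg_eq_0_iff_AE[OF int nn] by simp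
    \<comment> \<open>On the zero set of \<open>\<psi>\<close> the rows satisfy a linear relation
      with nonzero coefficient at \<open>k\<close>. With the points confined to this set, row
      \<open>k\<close> can be left out of the induction and recovered from the relation
      afterwards.\<close>
    then have "AE x in M. x \<in> {x \<in> A. \<psi> x = 0}" using psubset.prems(2) by auto
    moreover have "I - {k} \<subset> I" using k by auto
    ultimately obtain F p where F: "finite F" "F \<subseteq> {x \<in> A. \<psi> x = 0}" "\<forall>x. 0 \<le> p x"
      and eq: "\<forall>i\<in>I - {k}. (\<Sum>x\<in>F. p x * \<phi> i x) = v i"
      using psubset.IH[of "I - {k}" "{x \<in> A. \<psi> x = 0}"] psubset.prems(1) unfolding v_def by auto
    define V where "V i = (\<Sum>x\<in>F. p x * \<phi> i x)" for i
    have "(\<Sum>i\<in>I. a i * V i) = (\<Sum>x\<in>F. p x * \<psi> x)"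
      unfolding V_def \<psi>_def sum_distrib_left by (subst sum.swap) (simp add: mult_ac)
    also have "\<dots> = 0" using F by (intro sum.neutral) auto
    finally have "(\<Sum>i\<in>I. a i * V i) = (\<Sum>i\<in>I. a i * v i)"
      using \<open>av = 0\<close> by (simp add: av_def)
    moreover have "(\<Sum>i\<in>I - {k}. a i * V i) = (\<Sum>i\<in>I - {k}. a i * v i)"
      using eq by (simp add: V_def)
    ultimately have "a k * V k = a k * v k"
      using k psubset.hyps by (simp add: sum.remove[of I k])
    then have "V k = v k" using k by simp
    with eq have "\<forall>i\<in>I. (\<Sum>x\<in>F. p x * \<phi> i x) = v i" by (auto simp: V_def)
    with F contra show False unfolding v_def by blast
  qed
qed

text \<open>Gaussian elimination: one equation is solved for a pivot unknown, which lowers the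
  number of equations and of unknowns by one each.\<close>

lemma nontrivial_null_combination:
  fixes \<phi> :: "'i \<Rightarrow> 'a \<Rightarrow> real"
  assumes "finite I" and "finite F" and "card I < card F"
  shows "\<exists>d. (\<exists>x\<in>F. d x \<noteq> 0) \<and> (\<forall>i\<in>I. (\<Sum>x\<in>F. d x * \<phi> i x) = 0)"
  using assms
proof (induction I arbitrary: F \<phi> rule: finite_induct)
  case empty
  then have "F \<noteq> {}" by auto
  then show ?case by (intro exI[of _ "\<lambda>_. 1"]) auto
next
  case (insert k I)
  show ?case
  proof (cases "\<forall>x\<in>F. \<phi> k x = 0")
    case True
    have "card I < card F" using insert by simp
    from insert.IH[OF insert.prems(1) this, of \<phi>] show ?thesis using True by auto
  next
    case False
    then obtain y where y: "y \<in> F" "\<phi> k y \<noteq> 0" by blast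
    \<comment> \<open>Row \<open>i\<close> after the pivot unknown at \<open>y\<close> is eliminated
      with the help of row \<open>k\<close>; row \<open>k\<close> itself becomes zero.\<close>
    define \<psi> where "\<psi> i x = \<phi> i x - \<phi> i y * \<phi> k x / \<phi> k y" for i x
    have "card I < card (F - {y})" using insert y by simp
    from insert.IH[OF _ this, of \<psi>] insert.prems obtain d x where
      x: "x \<in> F - {y}" "d x \<noteq> 0" and d: "\<forall>i\<in>I. (\<Sum>x\<in>F - {y}. d x * \<psi> i x) = 0"
      by auto
    define e where "e = - (\<Sum>x\<in>F - {y}. d x * \<phi> k x) / \<phi> k y"
    have sum: "(\<Sum>x\<in>F. (d(y := e)) x * \<phi> i x) = e * \<phi> i y + (\<Sum>x\<in>F - {y}. d x * \<phi> i x)" for i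
      using y insert.prems by (simp add: sum.remove[of F y])
    have "e * \<phi> i y + (\<Sum>x\<in>F - {y}. d x * \<phi> i x) = (\<Sum>x\<in>F - {y}. d x * \<psi> i x)" for i
    proof -
      have "(\<Sum>x\<in>F - {y}. d x * \<psi> i x)
        = (\<Sum>x\<in>F - {y}. d x * \<phi> i x) - (\<Sum>x\<in>F - {y}. d x * \<phi> k x) * (\<phi> i y / \<phi> k y)"
        unfolding \<psi>_def sum_distrib_right sum_subtractf[symmetric]
        by (intro sum.cong) (auto simp: algebra_simps)
      then show ?thesis by (simp add: e_def)
    qed
    moreover have "(\<Sum>x\<in>F - {y}. d x * \<psi> k x) = 0" using y by (simp add: \<psi>_def)
    ultimately have "\<forall>i\<in>insert k I. (\<Sum>x\<in>F. (d(y := e)) x * \<phi> i x) = 0"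
      using sum d by auto
    then show ?thesis using x by (intro exI[of _ "d(y := e)"]) auto
  qed
qed

text \<open>The strictly positive row \<open>e\<close> bounds the polytope of admissible weights, so that moving
  along a null direction always hits a face.\<close>
lemma conic_support_reduction:
  fixes \<phi> :: "'i \<Rightarrow> 'a \<Rightarrow> real" and h :: "'a \<Rightarrow> real"
  assumes "finite I" and "e \<in> I" and "finite F" and "\<And>x. x \<in> F \<Longrightarrow> 0 < \<phi> e x"
    and "\<And>x. x \<in> F \<Longrightarrow> 0 \<le> p x"
  shows "\<exists>F' q. F' \<subseteq> F \<and> card F' \<le> card I \<and> (\<forall>x\<in>F'. 0 \<le> q x) \<and>
    (\<forall>i\<in>I. (\<Sum>x\<in>F'. q x * \<phi> i x) = (\<Sum>x\<in>F. p x * \<phi> i x)) \<and>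
    (\<Sum>x\<in>F. p x * h x) \<le> (\<Sum>x\<in>F'. q x * h x)"
  using assms(3-)
proof (induction F arbitrary: p rule: finite_psubset_induct)
  case (psubset F)
  show ?case
  proof (cases "card F \<le> card I")
    case True
    then show ?thesis using psubset.prems by blast
  next
    case False
    then obtain d0 where d0: "\<exists>x\<in>F. d0 x \<noteq> 0" "\<forall>i\<in>I. (\<Sum>x\<in>F. d0 x * \<phi> i x) = 0"
      using nontrivial_null_combination[OF assms(1) psubset.hyps, of \<phi>] by auto
    \<comment> \<open>The negative of a null direction is one too. The sign is chosen so that moving
      along \<open>d\<close> does not lower the objective.\<close>
    define \<sigma> :: real where "\<sigma> = (if 0 \<le> (\<Sum>x\<in>F. d0 x * h x) then 1 else - 1)"
    define d where "d x = \<sigma> * d0 x" for x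
    have sum_d: "(\<Sum>x\<in>F. d x * \<xi> x) = \<sigma> * (\<Sum>x\<in>F. d0 x * \<xi> x)" for \<xi>
      by (simp add: d_def sum_distrib_left mult_ac)
    have "\<sigma> \<noteq> 0" by (simp add: \<sigma>_def)
    have d: "\<exists>x\<in>F. d x \<noteq> 0" "\<And>i. i \<in> I \<Longrightarrow> (\<Sum>x\<in>F. d x * \<phi> i x) = 0" "0 \<le> (\<Sum>x\<in>F. d x * h x)"
      using d0 \<open>\<sigma> \<noteq> 0\<close> by (auto simp: sum_d) (auto simp: d_def \<sigma>_def)
    define D where "D = {x \<in> F. d x < 0}"
    \<comment> \<open>Without a negative entry, row \<open>e\<close> would be a vanishing sum of
      nonnegative terms with positive factors, forcing \<open>d\<close> to vanish on
      \<open>F\<close>.\<close>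
    have "D \<noteq> {}"
    proof
      assume "D = {}"
      then have "\<forall>x\<in>F. 0 \<le> d x * \<phi> e x"
        using psubset.prems(1) by (fastforce simp: D_def intro: mult_nonneg_nonneg less_imp_le)
      then have "\<forall>x\<in>F. d x * \<phi> e x = 0"
        using d(2)[OF assms(2)] sum_nonneg_eq_0_iff[of F "\<lambda>x. d x * \<phi> e x"] psubset.hyps by auto
      then show False using d(1) psubset.prems(1) by fastforce
    qed
    have finD: "finite D" using psubset.hyps by (simp add: D_def)
    \<comment> \<open>The ratio test of the simplex method: the largest step that keeps all weights
      nonnegative. The weight at the minimizing point becomes zero.\<close>
    define t where "t = Min ((\<lambda>x. p x / - d x) ` D)"
    have "t \<in> (\<lambda>x. p x / - d x) ` D"
      unfolding t_def using \<open>D \<noteq> {}\<close> finD by (intro Min_in) auto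
    then obtain y where y: "y \<in> D" "t = p y / - d y" by blast
    have t0: "0 \<le> t" using y psubset.prems(2)[of y] by (auto simp: D_def divide_nonneg_neg)
    have tle: "t \<le> p x / - d x" if "x \<in> D" for x
      unfolding t_def using that finD by (intro Min_le) auto
    define q where "q x = p x + t * d x" for x
    have q0: "0 \<le> q x" if "x \<in> F" for x
    proof (cases "x \<in> D")
      case True
      then show ?thesis using tle[OF True] by (simp add: q_def D_def field_simps)
    next
      case False
      then show ?thesis using that t0 psubset.prems(2)[OF that] by (auto simp: q_def D_def)
    qed
    have qy: "q y = 0" using y by (simp add: q_def D_def)
    have yF: "y \<in> F" using y by (simp add: D_def)
    have sum: "(\<Sum>x\<in>F - {y}. q x * \<xi> x) = (\<Sum>x\<in>F. p x * \<xi> x) + t * (\<Sum>x\<in>F. d x * \<xi> x)" for \<xi>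
    proof -
      have "(\<Sum>x\<in>F - {y}. q x * \<xi> x) = (\<Sum>x\<in>F. q x * \<xi> x)"
        using qy yF psubset.hyps by (simp add: sum.remove[of F y])
      then show ?thesis by (simp add: q_def algebra_simps sum.distrib sum_distrib_left)
    qed
    have "F - {y} \<subset> F" using yF by auto
    from psubset.IH[OF this, of q] psubset.prems(1) q0 obtain F' r where
      "F' \<subseteq> F - {y}" "card F' \<le> card I" "\<forall>x\<in>F'. 0 \<le> r x"
      "\<forall>i\<in>I. (\<Sum>x\<in>F'. r x * \<phi> i x) = (\<Sum>x\<in>F - {y}. q x * \<phi> i x)"
      "(\<Sum>x\<in>F - {y}. q x * h x) \<le> (\<Sum>x\<in>F'. r x * h x)"
      by auto
    moreover have "(\<Sum>x\<in>F. p x * h x) \<le> (\<Sum>x\<in>F - {y}. q x * h x)"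
      using sum[of h] d(3) t0 by simp
    moreover have "\<forall>i\<in>I. (\<Sum>x\<in>F - {y}. q x * \<phi> i x) = (\<Sum>x\<in>F. p x * \<phi> i x)"
      using sum d(2) by simp
    ultimately show ?thesis by (intro exI[of _ F'] exI[of _ r]) auto
  qed
qed

section \<open>Layer cake decomposition\<close>

text \<open>The value infinity is included, since a density may take it. As \<open>ennreal\<close>
  sends negative reals to 0, the condition \<open>0 < t\<close> is what keeps the negative half-line
  out.\<close>

lemma nn_integral_below_ennreal:
  fixes c :: ennreal
  shows "(\<integral>\<^sup>+ t. indicator {t. 0 < t \<and> ennreal t < c} t \<partial>lborel) = c"
proof (cases c rule: ennreal_cases)
  case (real r)
  then have "{t. 0 < t \<and> ennreal t < c} = {0<..<r}" by (auto simp: ennreal_less_iff)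
  then show ?thesis using real by simp
next
  case top
  then have "{t. 0 < t \<and> ennreal t < c} = {0<..}" by (auto simp: less_top[symmetric])
  moreover have "emeasure lborel {0::real<..} = \<top>"
  proof (rule ccontr)
    assume "emeasure lborel {0::real<..} \<noteq> \<top>"
    then obtain r where r: "0 \<le> r" "emeasure lborel {0::real<..} = ennreal r"
      by (cases "emeasure lborel {0::real<..}" rule: ennreal_cases) auto
    have "emeasure lborel {0<..<r + 1} \<le> emeasure lborel {0::real<..}"
      by (intro emeasure_mono) auto
    then show False using r by simp
  qed
  ultimately show ?thesis using top by simp
qed

lemma layer_measurable:
  assumes "sigma_finite_measure M" and [measurable]: "f \<in> borel_measurable M"
  shows "(\<lambda>t. indicator {0<..} t * emeasure M {p \<in> space M. ennreal t < f p}) \<in> borel_measurable lborel"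
proof -
  interpret sigma_finite_measure M by fact
  have "{(t, p). p \<in> space M \<and> ennreal t < f p} \<in> sets (lborel \<Otimes>\<^sub>M M)" (is "?S \<in> _")
  proof -
    have eq: "?S = {x \<in> space (lborel \<Otimes>\<^sub>M M). ennreal (fst x) < f (snd x)}"
      by (auto simp: space_pair_measure)
    show ?thesis unfolding eq by measurable
  qed
  from measurable_emeasure_Pair[OF this]
  have "(\<lambda>t. emeasure M {p \<in> space M. ennreal t < f p}) \<in> borel_measurable lborel"
    by (simp add: vimage_def)
  then show ?thesis by measurable
qed

text \<open>Tonelli's theorem for the region under the graph of \<open>f\<close>, with
  \<open>t\<close> as the vertical variable.\<close>

lemma layer_cake:
  assumes "sigma_finite_measure M" and [measurable]: "f \<in> borel_measurable M"
  shows "(\<integral>\<^sup>+ p. f p \<partial>M)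
    = (\<integral>\<^sup>+ t. indicator {0<..} t * emeasure M {p \<in> space M. ennreal t < f p} \<partial>lborel)"
proof -
  interpret sigma_finite_measure M by fact
  interpret P: pair_sigma_finite lborel M ..
  have "(\<integral>\<^sup>+ p. f p \<partial>M) = (\<integral>\<^sup>+ p. \<integral>\<^sup>+ t. indicator {t. 0 < t \<and> ennreal t < f p} t \<partial>lborel \<partial>M)"
    by (simp add: nn_integral_below_ennreal)
  also have "\<dots> = (\<integral>\<^sup>+ t. \<integral>\<^sup>+ p. indicator {t. 0 < t \<and> ennreal t < f p} t \<partial>M \<partial>lborel)"
    by (rule P.Fubini') (simp add: indicator_def case_prod_beta)
  also have "\<dots> = (\<integral>\<^sup>+ t. indicator {0<..} t * emeasure M {p \<in> space M. ennreal t < f p} \<partial>lborel)"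
  proof (rule nn_integral_cong)
    fix t :: real
    have "(\<integral>\<^sup>+ p. indicator {t. 0 < t \<and> ennreal t < f p} t \<partial>M)
      = (\<integral>\<^sup>+ p. indicator {0<..} t * indicator {p \<in> space M. ennreal t < f p} p \<partial>M)"
      by (intro nn_integral_cong) (auto simp: indicator_def)
    then show "(\<integral>\<^sup>+ p. indicator {t. 0 < t \<and> ennreal t < f p} t \<partial>M)
      = indicator {0<..} t * emeasure M {p \<in> space M. ennreal t < f p}"
      by (simp add: nn_integral_cmult)
  qed
  finally show ?thesis .
qed

text \<open>Markov's inequality. Besides the finiteness of layers it later bounds their extent along
  the two edges of the quadrant.\<close>

lemma emeasure_layer_le:
  assumes "f \<in> borel_measurable M"
  shows "ennreal t * emeasure M {p \<in> space M. ennreal t < f p} \<le> (\<integral>\<^sup>+ p. f p \<partial>M)"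
proof -
  have [measurable]: "f \<in> borel_measurable M" by fact
  have "ennreal t * emeasure M {p \<in> space M. ennreal t < f p}
      = (\<integral>\<^sup>+ p. ennreal t * indicator {p \<in> space M. ennreal t < f p} p \<partial>M)"
    by (simp add: nn_integral_cmult)
  also have "\<dots> \<le> (\<integral>\<^sup>+ p. f p \<partial>M)"
    by (intro nn_integral_mono) (auto simp: indicator_def)
  finally show ?thesis .
qed

lemma emeasure_layer_finite:
  assumes "f \<in> borel_measurable M" and "(\<integral>\<^sup>+ p. f p \<partial>M) < \<infinity>" and "0 < t"
  shows "emeasure M {p \<in> space M. ennreal t < f p} < \<infinity>"
proof (rule ccontr)
  assume "\<not> ?thesis"
  then have "emeasure M {p \<in> space M. ennreal t < f p} = \<top>" by (simp add: less_top[symmetric])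
  then have "(\<integral>\<^sup>+ p. f p \<partial>M) = \<top>"
    using emeasure_layer_le[OF assms(1), of t] assms(3) by (simp add: ennreal_mult_top top_unique)
  then show False using assms(2) by simp
qed

text \<open>The cone lemma on the line of heights, with one row for each measure: by the layer cake
  formula its integral is the integral of \<open>f\<close>. The point is that the same heights and
  weights serve all measures at once, and exactly.\<close>

lemma finite_layers:
  fixes \<nu> :: "'i \<Rightarrow> 'a measure"
  assumes "finite I" and "\<And>i. i \<in> I \<Longrightarrow> sigma_finite_measure (\<nu> i)"
    and "\<And>i. i \<in> I \<Longrightarrow> f \<in> borel_measurable (\<nu> i)"
    and "\<And>i. i \<in> I \<Longrightarrow> (\<integral>\<^sup>+ p. f p \<partial>\<nu> i) < \<infinity>"
  shows "\<exists>J m. finite J \<and> J \<subseteq> {0<..} \<and> (\<forall>t. 0 \<le> m t) \<and>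
    (\<forall>i\<in>I. (\<Sum>t\<in>J. ennreal (m t) * emeasure (\<nu> i) {p \<in> space (\<nu> i). ennreal t < f p})
       = (\<integral>\<^sup>+ p. f p \<partial>\<nu> i))"
proof -
  \<comment> \<open>The cone lemma speaks of real values. Layers at positive heights are finite by
    Markov's inequality, and the indicator sends all other heights to 0, so passing from
    \<open>emeasure\<close> to \<open>measure\<close> loses nothing.\<close>
  define \<phi> where "\<phi> i t = indicator {0<..} t * measure (\<nu> i) {p \<in> space (\<nu> i). ennreal t < f p}" for i t
  have fin: "emeasure (\<nu> i) {p \<in> space (\<nu> i). ennreal t < f p} < \<infinity>" if "i \<in> I" "0 < t" for i t
    using emeasure_layer_finite assms(3,4) that by blast
  have \<phi>_eq: "ennreal (\<phi> i t) = indicator {0<..} t * emeasure (\<nu> i) {p \<in> space (\<nu> i). ennreal t < f p}"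
    if "i \<in> I" for i t
    using fin[OF that, of t]
    by (auto simp: \<phi>_def indicator_def emeasure_eq_ennreal_measure less_top)
  have nonneg: "0 \<le> \<phi> i t" for i t by (simp add: \<phi>_def)
  have meas: "\<phi> i \<in> borel_measurable lborel" if "i \<in> I" for i
  proof -
    have "(\<lambda>t. enn2real (ennreal (\<phi> i t))) \<in> borel_measurable lborel"
      unfolding \<phi>_eq[OF that] using layer_measurable[OF assms(2,3)] that by measurable
    then show ?thesis using nonneg by simp
  qed
  have nn: "(\<integral>\<^sup>+ t. ennreal (\<phi> i t) \<partial>lborel) = (\<integral>\<^sup>+ p. f p \<partial>\<nu> i)" if "i \<in> I" for i
    using layer_cake[OF assms(2,3)] \<phi>_eq that by simp
  have int: "integrable lborel (\<phi> i)" if "i \<in> I" for i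
    by (rule integrableI_nonneg) (use that meas nonneg nn assms(4) in auto)
  obtain F p where F: "finite F" "\<forall>t. 0 \<le> p t"
    and eq: "\<forall>i\<in>I. (\<Sum>t\<in>F. p t * \<phi> i t) = (\<integral>t. \<phi> i t \<partial>lborel)"
    using integral_in_finite_cone[OF assms(1), of lborel \<phi> UNIV] int by auto
  have "(\<Sum>t\<in>F \<inter> {0<..}. ennreal (p t) * emeasure (\<nu> i) {q \<in> space (\<nu> i). ennreal t < f q})
      = (\<integral>\<^sup>+ q. f q \<partial>\<nu> i)" if "i \<in> I" for i
  proof -
    have "(\<Sum>t\<in>F \<inter> {0<..}. ennreal (p t) * emeasure (\<nu> i) {q \<in> space (\<nu> i). ennreal t < f q})
        = (\<Sum>t\<in>F \<inter> {0<..}. ennreal (p t * \<phi> i t))"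
      using F that by (intro sum.cong) (auto simp: ennreal_mult nonneg \<phi>_eq)
    also have "\<dots> = (\<Sum>t\<in>F. ennreal (p t * \<phi> i t))"
      by (rule sum.mono_neutral_left) (use F in \<open>auto simp: \<phi>_def\<close>)
    also have "\<dots> = ennreal (\<Sum>t\<in>F. p t * \<phi> i t)"
      using F nonneg by (intro sum_ennreal) auto
    also have "\<dots> = ennreal (\<integral>t. \<phi> i t \<partial>lborel)" using eq that by simp
    also have "\<dots> = (\<integral>\<^sup>+ t. ennreal (\<phi> i t) \<partial>lborel)"
      using nn_integral_eq_integral[OF int[OF that]] nonneg by simp
    also have "\<dots> = (\<integral>\<^sup>+ q. f q \<partial>\<nu> i)" by (rule nn[OF that])
    finally show ?thesis .
  qed
  then show ?thesis using F by (intro exI[of _ "F \<inter> {0<..}"] exI[of _ p]) auto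
qed

section \<open>Staircase regions\<close>

text \<open>The staircase as a union of \<open>N\<close> rectangles anchored at
  \<open>(x0, y0)\<close>, one for each step. In this form closedness towards the corner and joint
  measurability in \<open>\<theta>\<close> and \<open>p\<close> are read off directly, and the
  column \<open>x = x0\<close> is no special case.\<close>

definition quadrant_union where
  "quadrant_union N x0 y0 \<theta> = {p \<in> D0 x0 y0. \<exists>i\<in>{1..N::nat}.
     fst p \<le> x0 + sum (fst \<theta>) {1..i} \<and> snd p \<le> y0 + sum (snd \<theta>) {1..N+1-i}}"

lemma Theta_pos:
  assumes "(z, w) \<in> Theta N"
  shows "\<And>i. i \<in> {1..N} \<Longrightarrow> 0 < z i" "\<And>i. i \<in> {1..N} \<Longrightarrow> 0 \<le> w i" "1 \<le> N \<Longrightarrow> 0 < w 1"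
proof -
  have z: "\<forall>i\<in>{1..N}. z i \<in> {0<..}"
    and w: "\<forall>i\<in>{1..N}. w i \<in> (if i = 1 then {0<..} else {0..})"
    using assms unfolding Theta_def PiE_iff mem_Times_iff by auto
  show "0 < z i" if "i \<in> {1..N}" for i using z that by auto
  show "0 \<le> w i" if "i \<in> {1..N}" for i using w that by (cases "i = 1") fastforce+
  show "0 < w 1" if "1 \<le> N" using w[rule_format, of 1] that by simp
qed

lemma partial_sum_interval:
  fixes z :: "nat \<Rightarrow> real"
  assumes "0 < t" and "t \<le> sum z {1..N}"
  shows "\<exists>i\<in>{1..N}. sum z {1..<i} < t \<and> t \<le> sum z {1..i}"
proof -
  define i where "i = (LEAST i. t \<le> sum z {1..i})"
  have le: "t \<le> sum z {1..i}" unfolding i_def by (rule LeastI[of _ N]) fact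
  have "i \<le> N" unfolding i_def by (rule Least_le) fact
  have "i \<noteq> 0" using le assms(1) by (cases "i = 0") auto
  then obtain k where k: "i = Suc k" by (cases i) auto
  then have "\<not> t \<le> sum z {1..k}" using not_less_Least[of k "\<lambda>i. t \<le> sum z {1..i}"] by (simp add: i_def)
  moreover have "{1..<i} = {1..k}" using k by auto
  ultimately show ?thesis using le \<open>i \<le> N\<close> \<open>i \<noteq> 0\<close> by (intro bexI[of _ i]) auto
qed

lemma hstar_on_step:
  assumes "(z, w) \<in> Theta N" and i: "i \<in> {1..N}" and x: "x0 + sum z {1..<i} < x" "x \<le> x0 + sum z {1..i}"
  shows "hstar N x0 y0 z w x = y0 + sum w {1..N+1-i}"
proof -
  note pos = Theta_pos(1)[OF assms(1)]
  have "0 \<le> sum z {1..<i}" using i pos by (intro sum_nonneg) (auto intro: less_imp_le)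
  then have "x \<noteq> x0" using x by auto
  have mono: "sum z {1..j} \<le> sum z {1..<k}" if "j < k" "k \<le> N" for j k
    using that pos by (intro sum_mono2) (auto intro: less_imp_le)
  have "(if x0 + sum z {1..<k} < x \<and> x \<le> x0 + sum z {1..k} then sum w {1..N+1-k} else 0)
      = (if k = i then sum w {1..N+1-i} else 0)" if "k \<in> {1..N}" for k
    using x mono[of k i] mono[of i k] i that by (cases k i rule: linorder_cases) auto
  then have "(\<Sum>k\<in>{1..N}. if x0 + sum z {1..<k} < x \<and> x \<le> x0 + sum z {1..k} then sum w {1..N+1-k} else 0)
      = (\<Sum>k\<in>{1..N}. if k = i then sum w {1..N+1-i} else 0)"
    by (rule sum.cong[OF refl])
  then show ?thesis using \<open>x \<noteq> x0\<close> i by (simp add: hstar_def)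
qed

text \<open>Heights decrease along the steps, so among the rectangles reaching as far as
  \<open>x\<close> the tallest belongs to the step that contains \<open>x\<close>. The steps are
  open on the left, so \<open>x0\<close> lies in none of them; there the first rectangle, of full
  height, matches the special value of \<open>hstar\<close>.\<close>

lemma Rzw_eq_quadrant_union:
  assumes "\<theta> \<in> Theta N" and "1 \<le> N"
  shows "Rzw N x0 y0 \<theta> = quadrant_union N x0 y0 \<theta>"
proof -
  obtain z w where \<theta>: "\<theta> = (z, w)" by (cases \<theta>)
  have th: "(z, w) \<in> Theta N" using assms \<theta> by simp
  note pos = Theta_pos[OF th]
  have zmono: "sum z {1..i} \<le> sum z {1..j}" if "i \<le> j" "j \<le> N" for i j
    using that pos by (intro sum_mono2) (auto intro: less_imp_le)
  have wmono: "sum w {1..i} \<le> sum w {1..j}" if "i \<le> j" "j \<le> N" for i j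
    using that pos by (intro sum_mono2) (auto intro: less_imp_le)
  have "p \<in> Rzw N x0 y0 \<theta> \<longleftrightarrow> p \<in> quadrant_union N x0 y0 \<theta>" for p
  proof (cases "p \<in> D0 x0 y0")
    case False
    then show ?thesis by (simp add: Rzw_def quadrant_union_def)
  next
    case True
    obtain x y where p: "p = (x, y)" by (cases p)
    have x: "x0 \<le> x" and y: "y0 \<le> y" using True p by (auto simp: D0_def)
    show ?thesis
    proof (cases "x = x0")
      case True
      have "0 \<le> sum z {1..i}" if "i \<le> N" for i
        using that pos by (intro sum_nonneg) (auto intro: less_imp_le)
      then have zN: "0 \<le> sum z {1..N}" "0 \<le> sum z {1..1}" using assms(2) by blast+
      have "p \<in> Rzw N x0 y0 \<theta> \<longleftrightarrow> y \<le> y0 + sum w {1..N}"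
        using zN(1) \<open>p \<in> D0 x0 y0\<close> True p \<theta> by (simp add: Rzw_def hstar_def)
      also have "\<dots> \<longleftrightarrow> p \<in> quadrant_union N x0 y0 \<theta>"
      proof
        assume "y \<le> y0 + sum w {1..N}"
        then show "p \<in> quadrant_union N x0 y0 \<theta>"
          using zN(2) \<open>p \<in> D0 x0 y0\<close> True p \<theta> assms(2)
          by (auto simp: quadrant_union_def intro!: bexI[of _ 1])
      next
        assume "p \<in> quadrant_union N x0 y0 \<theta>"
        then obtain i where "i \<in> {1..N}" "y \<le> y0 + sum w {1..N+1-i}"
          using p \<theta> by (auto simp: quadrant_union_def)
        moreover from this have "sum w {1..N+1-i} \<le> sum w {1..N}" by (intro wmono) auto
        ultimately show "y \<le> y0 + sum w {1..N}" by linarith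
      qed
      finally show ?thesis .
    next
      case False
      then have xx: "x0 < x" using x by simp
      show ?thesis
      proof (cases "x \<le> x0 + sum z {1..N}")
        case False
        then have "\<not> x \<le> x0 + sum z {1..i}" if "i \<le> N" for i using zmono[OF that] by auto
        then show ?thesis using False p \<theta> by (auto simp: Rzw_def quadrant_union_def)
      next
        case le: True
        obtain i where i: "i \<in> {1..N}" "sum z {1..<i} < x - x0" "x - x0 \<le> sum z {1..i}"
          using partial_sum_interval[of "x - x0" z N] xx le by auto
        have h: "hstar N x0 y0 z w x = y0 + sum w {1..N+1-i}"
          by (rule hstar_on_step[OF th i(1)]) (use i in auto)
        have "p \<in> Rzw N x0 y0 \<theta> \<longleftrightarrow> y \<le> y0 + sum w {1..N+1-i}"
          using True le h p \<theta> by (simp add: Rzw_def)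
        also have "\<dots> \<longleftrightarrow> p \<in> quadrant_union N x0 y0 \<theta>"
        proof
          assume "y \<le> y0 + sum w {1..N+1-i}"
          then show "p \<in> quadrant_union N x0 y0 \<theta>"
            using True i p \<theta> by (auto simp: quadrant_union_def intro!: bexI[of _ i])
        next
          assume "p \<in> quadrant_union N x0 y0 \<theta>"
          then obtain j where j: "j \<in> {1..N}" "x \<le> x0 + sum z {1..j}" "y \<le> y0 + sum w {1..N+1-j}"
            using p \<theta> by (auto simp: quadrant_union_def)
          have "i \<le> j"
          proof (rule ccontr)
            assume "\<not> i \<le> j"
            then have "sum z {1..j} \<le> sum z {1..<i}"
              using pos i(1) by (intro sum_mono2) (auto intro: less_imp_le)
            then show False using i j by auto
          qed
          then have "sum w {1..N+1-j} \<le> sum w {1..N+1-i}" using i by (intro wmono) auto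
          then show "y \<le> y0 + sum w {1..N+1-i}" using j by auto
        qed
        finally show ?thesis .
      qed
    qed
  qed
  then show ?thesis by blast
qed

text \<open>A parameter in \<open>Theta N\<close> has exactly \<open>N\<close> positive widths.
  Padding with breakpoints below the maximum provides them without extending the region.\<close>

lemma finite_superset_below_Max:
  fixes D :: "real set"
  assumes "finite D" and "D \<noteq> {}" and "D \<subseteq> {0<..}" and "card D \<le> N"
  shows "\<exists>E. finite E \<and> D \<subseteq> E \<and> card E = N \<and> E \<subseteq> {0<..Max D}"
proof -
  have "0 < Max D" using assms Max_in by blast
  then have "infinite ({0<..<Max D} - D)" using assms(1) by (simp add: infinite_Ioo)
  then obtain G where G: "finite G" "card G = N - card D" "G \<subseteq> {0<..<Max D} - D"
    using infinite_arbitrarily_large by blast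
  have "card (D \<union> G) = N" using G assms by (subst card_Un_disjoint) auto
  moreover have "D \<union> G \<subseteq> {0<..Max D}" using G assms by (auto intro: Max_ge)
  ultimately show ?thesis using G assms by (intro exI[of _ "D \<union> G"]) auto
qed

text \<open>Breakpoints are the widths of the given rectangles, padded to \<open>N\<close>. The
  height over a step is that of the tallest rectangle reaching its right end, and the entries of
  \<open>w\<close> are the drops between consecutive heights, read from right to left.\<close>

lemma Rzw_surj:
  assumes "finite K" and "K \<noteq> {}" and K: "K \<subseteq> {0<..} \<times> {0<..}" and "card K \<le> N"
  shows "\<exists>\<theta>\<in>Theta N. Rzw N x0 y0 \<theta> = {p \<in> D0 x0 y0. \<exists>(d, e)\<in>K. fst p \<le> x0 + d \<and> snd p \<le> y0 + e}"
proof -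
  have "card (fst ` K) \<le> N" using card_image_le[OF assms(1), of fst] assms(4) by simp
  then obtain E where E: "finite E" "fst ` K \<subseteq> E" "card E = N" "E \<subseteq> {0<..Max (fst ` K)}"
    using finite_superset_below_Max[of "fst ` K" N] assms(1,2) K by force
  have "1 \<le> N" using assms by (metis One_nat_def Suc_leI card_gt_0_iff le_trans)
  \<comment> \<open>\<open>d 0 = 0\<close> stands for the left edge; the sorted list counts from 0,
    hence the shift by one.\<close>
  define d where "d i = (if i = 0 then 0 else sorted_list_of_set E ! (i - 1))" for i
  have len: "length (sorted_list_of_set E) = N" using E by simp
  have d_in: "d i \<in> E" if "i \<in> {1..N}" for i
    using that len nth_mem[of "i - 1" "sorted_list_of_set E"] E by (auto simp: d_def)
  have d_less: "d i < d j" if "i < j" "j \<le> N" for i j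
  proof (cases "i = 0")
    case True
    then show ?thesis using d_in[of j] that E by (auto simp: d_def)
  next
    case False
    then show ?thesis using that len
      sorted_wrt_nth_less[OF strict_sorted_list_of_set[of E], of "i - 1" "j - 1"]
      by (auto simp: d_def)
  qed
  have d_surj: "\<exists>i\<in>{1..N}. d i = v" if "v \<in> E" for v
  proof -
    have "v \<in> set (sorted_list_of_set E)" using that E by simp
    then obtain k where "k < N" "sorted_list_of_set E ! k = v"
      unfolding in_set_conv_nth len by blast
    then show ?thesis by (intro bexI[of _ "Suc k"]) (auto simp: d_def)
  qed
  \<comment> \<open>The value 0 past \<open>N\<close> makes the last drop \<open>w 1\<close> equal
    to \<open>H N\<close>, which is positive as \<open>Theta\<close> requires.\<close>
  define H where "H i = (if i \<le> N then Max {e. \<exists>d'. (d', e) \<in> K \<and> d i \<le> d'} else 0)" for i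
  define Hs where "Hs i = {e. \<exists>d'. (d', e) \<in> K \<and> d i \<le> d'}" for i
  have Hs_fin: "finite (Hs i)" for i
  proof (rule finite_subset)
    show "Hs i \<subseteq> snd ` K" by (auto simp: Hs_def intro: rev_image_eqI)
    show "finite (snd ` K)" using assms(1) by simp
  qed
  \<comment> \<open>No breakpoint exceeds the largest width, so the widest rectangle reaches every
    one of them.\<close>
  have Hs_ne: "Hs i \<noteq> {}" if "i \<in> {1..N}" for i
  proof -
    have "Max (fst ` K) \<in> fst ` K" using assms(1,2) by (intro Max_in) auto
    then obtain q where "q \<in> K" "fst q = Max (fst ` K)" by auto
    then have "d i \<le> fst q" using d_in[OF that] E(4) by auto
    moreover have "(fst q, snd q) \<in> K" using \<open>q \<in> K\<close> by simp
    ultimately show ?thesis unfolding Hs_def by blast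
  qed
  have H: "H i = Max (Hs i)" if "i \<in> {1..N}" for i using that by (simp add: H_def Hs_def)
  have Hpos: "0 < H i" if "i \<in> {1..N}" for i
    unfolding H[OF that] using Max_in[OF Hs_fin Hs_ne[OF that]] K by (auto simp: Hs_def)
  have Hmono: "H (Suc i) \<le> H i" if "i \<in> {1..N}" for i
  proof (cases "Suc i \<le> N")
    case True
    then have i': "Suc i \<in> {1..N}" by auto
    have "Hs (Suc i) \<subseteq> Hs i" using d_less[of i "Suc i"] True by (fastforce simp: Hs_def)
    then show ?thesis unfolding H[OF that] H[OF i'] by (rule Max_mono[OF _ Hs_ne[OF i'] Hs_fin])
  next
    case False
    then show ?thesis using Hpos[OF that] by (simp add: H_def)
  qed
  define z where "z = restrict (\<lambda>i. d i - d (i - 1)) {1..N}"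
  define w where "w = restrict (\<lambda>j. H (N + 1 - j) - H (N + 2 - j)) {1..N}"
  have zsum: "sum z {1..i} = d i" if "i \<le> N" for i
    using that by (induction i) (auto simp: z_def d_def sum.cl_ivl_Suc)
  have wsum: "sum w {1..k} = H (N + 1 - k)" if "k \<le> N" for k
    using that by (induction k) (auto simp: w_def H_def Suc_diff_le)
  have th: "(z, w) \<in> Theta N"
  proof -
    have "0 < z i" if "i \<in> {1..N}" for i using that d_less[of "i - 1" i] by (auto simp: z_def)
    moreover have "0 \<le> w j" if "j \<in> {1..N}" for j
      using that Hmono[of "N + 1 - j"] by (auto simp: w_def Suc_diff_le)
    moreover have "0 < w 1" using Hpos[of N] \<open>1 \<le> N\<close> by (auto simp: w_def H_def)
    ultimately show ?thesis by (auto simp: Theta_def PiE_iff z_def w_def)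
  qed
  have quad: "quadrant_union N x0 y0 (z, w)
      = {p \<in> D0 x0 y0. \<exists>i\<in>{1..N}. fst p \<le> x0 + d i \<and> snd p \<le> y0 + H i}"
  proof -
    have "(\<exists>i\<in>{1..N}. fst p \<le> x0 + sum z {1..i} \<and> snd p \<le> y0 + sum w {1..N+1-i})
        \<longleftrightarrow> (\<exists>i\<in>{1..N}. fst p \<le> x0 + d i \<and> snd p \<le> y0 + H i)" for p
    proof (rule bex_cong[OF refl])
      fix i assume "i \<in> {1..N}"
      then have "sum z {1..i} = d i" "sum w {1..N+1-i} = H i"
        using zsum[of i] wsum[of "N + 1 - i"] by auto
      then show "fst p \<le> x0 + sum z {1..i} \<and> snd p \<le> y0 + sum w {1..N+1-i}
          \<longleftrightarrow> fst p \<le> x0 + d i \<and> snd p \<le> y0 + H i" by simp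
    qed
    then show ?thesis unfolding quadrant_union_def fst_conv snd_conv by blast
  qed
  have "quadrant_union N x0 y0 (z, w) = {p \<in> D0 x0 y0. \<exists>(d, e)\<in>K. fst p \<le> x0 + d \<and> snd p \<le> y0 + e}"
    (is "?L = ?R")
  proof (intro subset_antisym subsetI)
    fix p assume "p \<in> ?L"
    then obtain i where i: "i \<in> {1..N}" and p: "p \<in> D0 x0 y0" "fst p \<le> x0 + d i" "snd p \<le> y0 + H i"
      by (auto simp: quad)
    have "H i \<in> Hs i" unfolding H[OF i] by (rule Max_in[OF Hs_fin Hs_ne[OF i]])
    then obtain d' where "(d', H i) \<in> K" "d i \<le> d'" by (auto simp: Hs_def)
    then show "p \<in> ?R" using p by (intro CollectI conjI bexI[of _ "(d', H i)"]) auto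
  next
    fix p assume "p \<in> ?R"
    then obtain d' e where p: "p \<in> D0 x0 y0" "(d', e) \<in> K" "fst p \<le> x0 + d'" "snd p \<le> y0 + e" by auto
    obtain i where i: "i \<in> {1..N}" "d i = d'" using d_surj[of d'] p E by force
    have "e \<le> H i" unfolding H[OF i(1)] using p i by (intro Max_ge Hs_fin) (auto simp: Hs_def)
    then show "p \<in> ?L" using p i by (auto simp: quad intro!: bexI[of _ i])
  qed
  then show ?thesis using th Rzw_eq_quadrant_union[OF th \<open>1 \<le> N\<close>] by blast
qed

section \<open>The constraint measures\<close>

text \<open>All constraint integrals and the objective become integrals against measures on the
  whole plane, so that a single decomposition applies to all of them.\<close>

definition area_on :: "(real \<times> real) set \<Rightarrow> (real \<times> real) measure" where
  "area_on T = density lborel (indicator T)"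

text \<open>Length along the left edge, transported to the plane. It is singular to area, so a
  change on a set of area zero may affect it.\<close>

definition col_length :: "real \<Rightarrow> real \<Rightarrow> (real \<times> real) measure" where
  "col_length x0 y0 = distr (density lborel (indicator {y0..})) borel (Pair x0)"

definition row_length :: "real \<Rightarrow> real \<Rightarrow> (real \<times> real) measure" where
  "row_length x0 y0 = distr (density lborel (indicator {x0..})) borel (\<lambda>x. (x, y0))"

lemma Pair_borel [measurable]: "Pair (x::real) \<in> borel \<rightarrow>\<^sub>M (borel :: (real \<times> real) measure)"
  "(\<lambda>x. (x, y::real)) \<in> borel \<rightarrow>\<^sub>M (borel :: (real \<times> real) measure)"
  by (auto intro!: borel_measurable_continuous_onI continuous_intros)

lemma sets_problem_measures [simp, measurable_cong]:
  "sets (area_on T) = sets borel" "sets (col_length x0 y0) = sets borel" "sets (row_length x0 y0) = sets borel"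
  by (auto simp: area_on_def col_length_def row_length_def)

lemma space_problem_measures [simp]:
  "space (area_on T) = UNIV" "space (col_length x0 y0) = UNIV" "space (row_length x0 y0) = UNIV"
  by (auto simp: area_on_def col_length_def row_length_def)

lemma nn_integral_area_on:
  assumes "T \<in> sets borel" "f \<in> borel_measurable borel"
  shows "(\<integral>\<^sup>+ p. f p \<partial>area_on T) = (\<integral>\<^sup>+ p\<in>T. f p \<partial>lborel)"
  using assms by (simp add: area_on_def nn_integral_density mult.commute)

lemma nn_integral_col_length:
  assumes "f \<in> borel_measurable borel"
  shows "(\<integral>\<^sup>+ p. f p \<partial>col_length x0 y0) = (\<integral>\<^sup>+ y\<in>{y0..}. f (x0, y) \<partial>lborel)"
proof -
  have "(\<lambda>y. f (x0, y)) \<in> borel_measurable borel"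
    using assms Pair_borel(1) by (rule measurable_compose_rev)
  then show ?thesis
    using assms by (simp add: col_length_def nn_integral_density nn_integral_distr mult.commute)
qed

lemma nn_integral_row_length:
  assumes "f \<in> borel_measurable borel"
  shows "(\<integral>\<^sup>+ p. f p \<partial>row_length x0 y0) = (\<integral>\<^sup>+ x\<in>{x0..}. f (x, y0) \<partial>lborel)"
proof -
  have "(\<lambda>x. f (x, y0)) \<in> borel_measurable borel"
    using assms Pair_borel(2) by (rule measurable_compose_rev)
  then show ?thesis
    using assms by (simp add: row_length_def nn_integral_density nn_integral_distr mult.commute)
qed

lemma emeasure_area_on:
  assumes "T \<in> sets borel" "A \<in> sets borel"
  shows "emeasure (area_on T) A = emeasure lborel (T \<inter> A)"
  using assms by (simp add: area_on_def emeasure_density indicator_inter_arith[symmetric])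

lemma emeasure_col_length:
  assumes "A \<in> sets borel"
  shows "emeasure (col_length x0 y0) A = emeasure lborel {y. y0 \<le> y \<and> (x0, y) \<in> A}"
proof -
  have "emeasure (col_length x0 y0) A = (\<integral>\<^sup>+ y\<in>{y0..}. indicator A (x0, y) \<partial>lborel)"
    using assms nn_integral_col_length[of "indicator A" x0 y0] by simp
  also have "\<dots> = (\<integral>\<^sup>+ y. indicator {y. y0 \<le> y \<and> (x0, y) \<in> A} y \<partial>lborel)"
    by (intro nn_integral_cong) (auto simp: indicator_def)
  also have "{y. y0 \<le> y \<and> (x0, y) \<in> A} = {y0..} \<inter> (Pair x0 -` A \<inter> space borel)" by auto
  then have "{y. y0 \<le> y \<and> (x0, y) \<in> A} \<in> sets borel"
    using measurable_sets[OF Pair_borel(1) assms, of x0] by auto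
  then have "(\<integral>\<^sup>+ y. indicator {y. y0 \<le> y \<and> (x0, y) \<in> A} y \<partial>lborel)
      = emeasure lborel {y. y0 \<le> y \<and> (x0, y) \<in> A}" by simp
  finally show ?thesis .
qed

lemma emeasure_row_length:
  assumes "A \<in> sets borel"
  shows "emeasure (row_length x0 y0) A = emeasure lborel {x. x0 \<le> x \<and> (x, y0) \<in> A}"
proof -
  have "emeasure (row_length x0 y0) A = (\<integral>\<^sup>+ x\<in>{x0..}. indicator A (x, y0) \<partial>lborel)"
    using assms nn_integral_row_length[of "indicator A" x0 y0] by simp
  also have "\<dots> = (\<integral>\<^sup>+ x. indicator {x. x0 \<le> x \<and> (x, y0) \<in> A} x \<partial>lborel)"
    by (intro nn_integral_cong) (auto simp: indicator_def)
  also have "{x. x0 \<le> x \<and> (x, y0) \<in> A} = {x0..} \<inter> ((\<lambda>x. (x, y0)) -` A \<inter> space borel)" by auto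
  then have "{x. x0 \<le> x \<and> (x, y0) \<in> A} \<in> sets borel"
    using measurable_sets[OF Pair_borel(2) assms, of y0] by auto
  then have "(\<integral>\<^sup>+ x. indicator {x. x0 \<le> x \<and> (x, y0) \<in> A} x \<partial>lborel)
      = emeasure lborel {x. x0 \<le> x \<and> (x, y0) \<in> A}" by simp
  finally show ?thesis .
qed

lemma sigma_finite_area_on:
  assumes "T \<in> sets borel"
  shows "sigma_finite_measure (area_on T)"
proof
  show "\<exists>A. countable A \<and> A \<subseteq> sets (area_on T) \<and> \<Union> A = space (area_on T) \<and>
      (\<forall>a\<in>A. emeasure (area_on T) a \<noteq> \<infinity>)"
  proof (intro exI[of _ "range (\<lambda>k::nat. cball 0 (real k))"] conjI ballI)
    show "\<Union> (range (\<lambda>k::nat. cball 0 (real k))) = space (area_on T)"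
      using real_arch_simple by (auto simp: dist_norm)
    fix a assume "a \<in> range (\<lambda>k::nat. cball (0::real \<times> real) (real k))"
    then obtain k where a: "a = cball 0 (real k)" by blast
    have "emeasure (area_on T) a \<le> emeasure lborel a"
      using assms a by (auto simp: emeasure_area_on intro!: emeasure_mono)
    also have "\<dots> < \<infinity>" using a emeasure_lborel_cball_finite by blast
    finally show "emeasure (area_on T) a \<noteq> \<infinity>" by simp
  qed auto
qed

lemma sigma_finite_col_length: "sigma_finite_measure (col_length x0 y0)"
proof
  show "\<exists>A. countable A \<and> A \<subseteq> sets (col_length x0 y0) \<and> \<Union> A = space (col_length x0 y0) \<and>
      (\<forall>a\<in>A. emeasure (col_length x0 y0) a \<noteq> \<infinity>)"
  proof (intro exI[of _ "range (\<lambda>k::nat. {p :: real \<times> real. snd p \<le> real k})"] conjI ballI)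
    have "{p :: real \<times> real. snd p \<le> real k} \<in> sets borel" for k
      by (intro borel_closed closed_Collect_le continuous_intros)
    then show "range (\<lambda>k::nat. {p :: real \<times> real. snd p \<le> real k}) \<subseteq> sets (col_length x0 y0)" by auto
    show "\<Union> (range (\<lambda>k::nat. {p :: real \<times> real. snd p \<le> real k})) = space (col_length x0 y0)"
      using real_arch_simple by auto
    fix a assume "a \<in> range (\<lambda>k::nat. {p :: real \<times> real. snd p \<le> real k})"
    then obtain k :: nat where a: "a = {p. snd p \<le> real k}" by blast
    have "{y. y0 \<le> y \<and> (x0, y) \<in> a} = {y0..real k}" using a by auto
    moreover have "a \<in> sets borel" unfolding a by (intro borel_closed closed_Collect_le continuous_intros)
    ultimately show "emeasure (col_length x0 y0) a \<noteq> \<infinity>"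
      by (simp add: emeasure_col_length emeasure_lborel_Icc_eq)
  qed auto
qed

lemma sigma_finite_row_length: "sigma_finite_measure (row_length x0 y0)"
proof
  show "\<exists>A. countable A \<and> A \<subseteq> sets (row_length x0 y0) \<and> \<Union> A = space (row_length x0 y0) \<and>
      (\<forall>a\<in>A. emeasure (row_length x0 y0) a \<noteq> \<infinity>)"
  proof (intro exI[of _ "range (\<lambda>k::nat. {p :: real \<times> real. fst p \<le> real k})"] conjI ballI)
    have "{p :: real \<times> real. fst p \<le> real k} \<in> sets borel" for k
      by (intro borel_closed closed_Collect_le continuous_intros)
    then show "range (\<lambda>k::nat. {p :: real \<times> real. fst p \<le> real k}) \<subseteq> sets (row_length x0 y0)" by auto
    show "\<Union> (range (\<lambda>k::nat. {p :: real \<times> real. fst p \<le> real k})) = space (row_length x0 y0)"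
      using real_arch_simple by auto
    fix a assume "a \<in> range (\<lambda>k::nat. {p :: real \<times> real. fst p \<le> real k})"
    then obtain k :: nat where a: "a = {p. fst p \<le> real k}" by blast
    have "{x. x0 \<le> x \<and> (x, y0) \<in> a} = {x0..real k}" using a by auto
    moreover have "a \<in> sets borel" unfolding a by (intro borel_closed closed_Collect_le continuous_intros)
    ultimately show "emeasure (row_length x0 y0) a \<noteq> \<infinity>"
      by (simp add: emeasure_row_length emeasure_lborel_Icc_eq)
  qed auto
qed

lemma D0_borel [measurable]: "D0 x0 y0 \<in> sets borel"
proof -
  have "D0 x0 y0 = {p. x0 \<le> fst p} \<inter> {p. y0 \<le> snd p}" by (auto simp: D0_def)
  also have "\<dots> \<in> sets borel"
    by (intro sets.Int borel_closed closed_Collect_le continuous_intros)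
  finally show ?thesis .
qed

lemma Box_borel [measurable]: "Box x0 y0 a b c d \<in> sets borel"
proof -
  have "Box x0 y0 a b c d = D0 x0 y0 \<inter> {p. a \<le> ereal (fst p) \<and> ereal (fst p) \<le> b \<and> c \<le> ereal (snd p) \<and> ereal (snd p) \<le> d}"
    by (auto simp: Box_def)
  moreover have "{p::real \<times> real. a \<le> ereal (fst p) \<and> ereal (fst p) \<le> b \<and> c \<le> ereal (snd p) \<and> ereal (snd p) \<le> d} \<in> sets borel"
    by (intro borel_closed closed_Collect_conj closed_Collect_le continuous_intros continuous_on_ereal)
  ultimately show ?thesis by auto
qed

lemma Sg_borel:
  assumes "g \<in> borel_measurable (restrict_space borel {x0..})"
  shows "Sg x0 y0 g \<in> sets borel"
proof -
  \<comment> \<open>\<open>g\<close> is only known to be measurable on \<open>{x0..}\<close>;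
    \<open>h\<close> continues it by 0, and the intersection with \<open>D0\<close> hides the
    continuation.\<close>
  define h where "h x = (if x \<in> {x0..} then g x else 0)" for x
  have h: "h \<in> borel_measurable borel"
    unfolding h_def
    by (rule measurable_restrict_space_iff[THEN iffD1, of "{x0..}" borel 0 borel g]) (use assms in auto)
  have "(\<lambda>p::real \<times> real. h (fst p)) \<in> borel_measurable (borel \<Otimes>\<^sub>M borel)"
    using h by (rule measurable_compose[OF measurable_fst])
  then have [measurable]: "(\<lambda>p::real \<times> real. h (fst p)) \<in> borel_measurable borel"
    by (simp add: borel_prod)
  have [measurable]: "(\<lambda>p::real \<times> real. ereal (snd p)) \<in> borel_measurable borel"
    by (intro borel_measurable_continuous_onI continuous_on_ereal continuous_intros)
  have "Sg x0 y0 g = D0 x0 y0 \<inter> {p \<in> space borel. h (fst p) \<le> ereal (snd p)}"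
    by (auto simp: Sg_def h_def D0_def)
  also have "\<dots> \<in> sets borel" by measurable
  finally show ?thesis .
qed

text \<open>Joint measurability in the parameter and the point, as needed to exchange the mixing
  integral with the integral over the plane.\<close>

lemma quadrant_union_measurable:
  "{(\<theta>, p). \<theta> \<in> space (ThetaM N) \<and> p \<in> quadrant_union N x0 y0 \<theta>} \<in> sets (ThetaM N \<Otimes>\<^sub>M borel)"
proof -
  have c [measurable]: "(\<lambda>x. fst (fst x) j) \<in> borel_measurable (ThetaM N \<Otimes>\<^sub>M borel)"
    "(\<lambda>x. snd (fst x) j) \<in> borel_measurable (ThetaM N \<Otimes>\<^sub>M borel)" if "j \<in> {1..N}" for j
  proof -
    have "(\<lambda>f. f j) \<in> PiM {1..N} (\<lambda>_. lborel :: real measure) \<rightarrow>\<^sub>M borel"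
      using measurable_component_singleton[OF that, of "\<lambda>_. lborel :: real measure"] by simp
    then show "(\<lambda>x. fst (fst x) j) \<in> borel_measurable (ThetaM N \<Otimes>\<^sub>M borel)"
      "(\<lambda>x. snd (fst x) j) \<in> borel_measurable (ThetaM N \<Otimes>\<^sub>M borel)"
      unfolding ThetaM_def
      by (auto intro: measurable_compose[OF measurable_fst] measurable_compose[OF measurable_snd])
  qed
  have z: "(\<lambda>x. sum (fst (fst x)) {1..i}) \<in> borel_measurable (ThetaM N \<Otimes>\<^sub>M borel)" if "i \<le> N" for i
    using that by (intro borel_measurable_sum c) auto
  have w: "(\<lambda>x. sum (snd (fst x)) {1..i}) \<in> borel_measurable (ThetaM N \<Otimes>\<^sub>M borel)" if "i \<le> N" for i
    using that by (intro borel_measurable_sum c) auto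
  have p: "(\<lambda>x. fst (snd x)) \<in> borel_measurable (ThetaM N \<Otimes>\<^sub>M (borel :: (real \<times> real) measure))"
    "(\<lambda>x. snd (snd x)) \<in> borel_measurable (ThetaM N \<Otimes>\<^sub>M (borel :: (real \<times> real) measure))"
    by (rule measurable_compose[OF measurable_snd], simp add: borel_prod[symmetric])+
  have "{(\<theta>, p). \<theta> \<in> space (ThetaM N) \<and> p \<in> quadrant_union N x0 y0 \<theta>} =
    (\<Union>i\<in>{1..N}. {x \<in> space (ThetaM N \<Otimes>\<^sub>M borel). snd x \<in> D0 x0 y0 \<and>
       fst (snd x) \<le> x0 + sum (fst (fst x)) {1..i} \<and> snd (snd x) \<le> y0 + sum (snd (fst x)) {1..N+1-i}})"
    by (auto simp: quadrant_union_def space_pair_measure)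
  also have "\<dots> \<in> sets (ThetaM N \<Otimes>\<^sub>M borel)"
  proof (rule sets.finite_UN)
    fix i assume "i \<in> {1..N}"
    then have iN: "i \<le> N" "N + 1 - i \<le> N" unfolding atLeastAtMost_iff by arith+
    note z[OF iN(1), measurable] w[OF iN(2), measurable]
    note p [measurable]
    show "{x \<in> space (ThetaM N \<Otimes>\<^sub>M borel). snd x \<in> D0 x0 y0 \<and>
       fst (snd x) \<le> x0 + sum (fst (fst x)) {1..i} \<and> snd (snd x) \<le> y0 + sum (snd (fst x)) {1..N+1-i}}
       \<in> sets (ThetaM N \<Otimes>\<^sub>M borel)"
      by measurable
  qed simp
  finally show ?thesis .
qed

lemma quadrant_union_borel [measurable]: "quadrant_union N x0 y0 \<theta> \<in> sets borel"
proof -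
  have "quadrant_union N x0 y0 \<theta> = (\<Union>i\<in>{1..N}. D0 x0 y0 \<inter>
      {p. fst p \<le> x0 + sum (fst \<theta>) {1..i}} \<inter> {p. snd p \<le> y0 + sum (snd \<theta>) {1..N+1-i}})"
    by (auto simp: quadrant_union_def)
  also have "\<dots> \<in> sets borel"
    by (intro sets.finite_UN sets.Int D0_borel borel_closed closed_Collect_le continuous_intros) auto
  finally show ?thesis .
qed

section \<open>Mixtures of uniform distributions\<close>

lemma emeasure_lborel_Times:
  fixes a b c d :: real
  assumes "A \<in> sets borel" "B \<in> sets borel"
  shows "emeasure lborel (A \<times> B) = emeasure lborel (A :: real set) * emeasure lborel (B :: real set)"
  using assms by (simp add: lborel_prod[symmetric] lborel.emeasure_pair_measure_Times)

context
  fixes N :: nat and x0 y0 :: real and \<theta> :: "(nat \<Rightarrow> real) \<times> (nat \<Rightarrow> real)"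
  assumes \<theta>: "\<theta> \<in> Theta N" and N: "1 \<le> N"
begin

lemma Rzw_borel: "Rzw N x0 y0 \<theta> \<in> sets borel"
  by (simp add: Rzw_eq_quadrant_union[OF \<theta> N])

lemma Theta_sums_pos:
  "\<And>i. i \<in> {1..N} \<Longrightarrow> 0 < sum (fst \<theta>) {1..i}" "\<And>i. i \<in> {1..N} \<Longrightarrow> 0 < sum (snd \<theta>) {1..i}"
proof -
  have *: "(fst \<theta>, snd \<theta>) \<in> Theta N" using \<theta> by simp
  note pos = Theta_pos[OF *]
  fix i assume i: "i \<in> {1..N}"
  show "0 < sum (fst \<theta>) {1..i}" using pos i by (intro sum_pos) auto
  show "0 < sum (snd \<theta>) {1..i}" using pos i N by (intro sum_pos2[of _ 1]) auto
qed

lemma Theta_sums_mono: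
  assumes "i \<le> N"
  shows "sum (fst \<theta>) {1..i} \<le> sum (fst \<theta>) {1..N}" "sum (snd \<theta>) {1..i} \<le> sum (snd \<theta>) {1..N}"
proof -
  have *: "(fst \<theta>, snd \<theta>) \<in> Theta N" using \<theta> by simp
  show "sum (fst \<theta>) {1..i} \<le> sum (fst \<theta>) {1..N}" "sum (snd \<theta>) {1..i} \<le> sum (snd \<theta>) {1..N}"
    using Theta_pos[OF *] assms by (intro sum_mono2; force intro: less_imp_le)+
qed

lemma Rzw_lower:
  assumes "(x, y) \<in> Rzw N x0 y0 \<theta>" "x0 \<le> x'" "x' \<le> x" "y0 \<le> y'" "y' \<le> y"
  shows "(x', y') \<in> Rzw N x0 y0 \<theta>"
  using assms unfolding Rzw_eq_quadrant_union[OF \<theta> N]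
  by (force simp: quadrant_union_def D0_def)

text \<open>Over \<open>x0\<close> the first rectangle is the highest one. Along the row
  \<open>y0\<close> it is the last one that reaches farthest. This is how the sums of
  \<open>W\<close> and \<open>Z\<close> enter the edge constraints of problem (II).\<close>

lemma Rzw_column: "{y. y0 \<le> y \<and> (x0, y) \<in> Rzw N x0 y0 \<theta>} = {y0..y0 + sum (snd \<theta>) {1..N}}"
  unfolding Rzw_eq_quadrant_union[OF \<theta> N]
proof (intro subset_antisym subsetI)
  fix y assume "y \<in> {y. y0 \<le> y \<and> (x0, y) \<in> quadrant_union N x0 y0 \<theta>}"
  then obtain i where i: "i \<in> {1..N}" "y0 \<le> y" "y \<le> y0 + sum (snd \<theta>) {1..N+1-i}"
    by (auto simp: quadrant_union_def)
  moreover have "N + 1 - i \<le> N" using i by auto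
  ultimately show "y \<in> {y0..y0 + sum (snd \<theta>) {1..N}}"
    using Theta_sums_mono(2)[of "N + 1 - i"] by auto
next
  fix y assume "y \<in> {y0..y0 + sum (snd \<theta>) {1..N}}"
  then show "y \<in> {y. y0 \<le> y \<and> (x0, y) \<in> quadrant_union N x0 y0 \<theta>}"
    using N less_imp_le[OF Theta_sums_pos(1)[of 1]] by (auto simp: quadrant_union_def D0_def intro!: bexI[of _ 1])
qed

lemma Rzw_row: "{x. x0 \<le> x \<and> (x, y0) \<in> Rzw N x0 y0 \<theta>} = {x0..x0 + sum (fst \<theta>) {1..N}}"
  unfolding Rzw_eq_quadrant_union[OF \<theta> N]
proof (intro subset_antisym subsetI)
  fix x assume "x \<in> {x. x0 \<le> x \<and> (x, y0) \<in> quadrant_union N x0 y0 \<theta>}"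
  then obtain i where i: "i \<in> {1..N}" "x0 \<le> x" "x \<le> x0 + sum (fst \<theta>) {1..i}"
    by (auto simp: quadrant_union_def)
  then show "x \<in> {x0..x0 + sum (fst \<theta>) {1..N}}"
    using Theta_sums_mono(1)[of i] by auto
next
  fix x assume "x \<in> {x0..x0 + sum (fst \<theta>) {1..N}}"
  then show "x \<in> {x. x0 \<le> x \<and> (x, y0) \<in> quadrant_union N x0 y0 \<theta>}"
    using N less_imp_le[OF Theta_sums_pos(2)[of 1]] by (auto simp: quadrant_union_def D0_def intro!: bexI[of _ N])
qed

lemma emeasure_col_length_Rzw:
  "emeasure (col_length x0 y0) (Rzw N x0 y0 \<theta>) = ennreal (sum (snd \<theta>) {1..N})"
  unfolding emeasure_col_length[OF Rzw_borel] Rzw_column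
  using Theta_sums_pos(2)[of N] N by simp

lemma emeasure_row_length_Rzw:
  "emeasure (row_length x0 y0) (Rzw N x0 y0 \<theta>) = ennreal (sum (fst \<theta>) {1..N})"
  unfolding emeasure_row_length[OF Rzw_borel] Rzw_row
  using Theta_sums_pos(1)[of N] N by simp

lemma emeasure_Rzw_finite: "emeasure lborel (Rzw N x0 y0 \<theta>) < \<infinity>"
proof -
  have "Rzw N x0 y0 \<theta> \<subseteq> {x0..x0 + sum (fst \<theta>) {1..N}} \<times> {y0..y0 + sum (snd \<theta>) {1..N}}"
  proof
    fix p assume p: "p \<in> Rzw N x0 y0 \<theta>"
    obtain x y where xy: "p = (x, y)" by (cases p)
    have "x0 \<le> x" "y0 \<le> y" using p xy by (auto simp: Rzw_def D0_def)
    then have "x \<in> {x0..x0 + sum (fst \<theta>) {1..N}}" "y \<in> {y0..y0 + sum (snd \<theta>) {1..N}}"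
      using Rzw_lower[of x y x y0] Rzw_lower[of x y x0 y] p xy
      unfolding Rzw_row[symmetric] Rzw_column[symmetric] by auto
    then show "p \<in> {x0..x0 + sum (fst \<theta>) {1..N}} \<times> {y0..y0 + sum (snd \<theta>) {1..N}}"
      unfolding xy by blast
  qed
  then have "emeasure lborel (Rzw N x0 y0 \<theta>)
      \<le> emeasure lborel ({x0..x0 + sum (fst \<theta>) {1..N}} \<times> {y0..y0 + sum (snd \<theta>) {1..N}})"
    by (intro emeasure_mono) (auto simp: borel_Times)
  also have "\<dots> < \<infinity>"
    by (simp add: emeasure_lborel_Times emeasure_lborel_Icc_eq ennreal_mult_less_top)
  finally show ?thesis .
qed

text \<open>The first rectangle lies inside: its width is the first entry of \<open>z\<close>, its
  height the sum of all entries of \<open>w\<close>, which is at least the positive first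
  one.\<close>

lemma emeasure_Rzw_pos: "0 < emeasure lborel (Rzw N x0 y0 \<theta>)"
proof -
  define d e where "d = sum (fst \<theta>) {1..1::nat}" and "e = sum (snd \<theta>) {1..N}"
  have de: "0 < d" "0 < e" using Theta_sums_pos(1)[of 1] Theta_sums_pos(2)[of N] N by (auto simp: d_def e_def)
  have "{x0..x0 + d} \<times> {y0..y0 + e} \<subseteq> Rzw N x0 y0 \<theta>"
    unfolding Rzw_eq_quadrant_union[OF \<theta> N] using N
    by (auto simp: quadrant_union_def D0_def d_def e_def intro!: bexI[of _ 1])
  then have "emeasure lborel ({x0..x0 + d} \<times> {y0..y0 + e}) \<le> emeasure lborel (Rzw N x0 y0 \<theta>)"
    using Rzw_borel by (intro emeasure_mono) auto
  moreover have "0 < emeasure lborel ({x0..x0 + d} \<times> {y0..y0 + e})"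
    using de by (simp add: emeasure_lborel_Times ennreal_zero_less_mult_iff)
  ultimately show ?thesis by order
qed

lemma measure_Rzw_pos: "0 < measure lborel (Rzw N x0 y0 \<theta>)"
  using emeasure_Rzw_pos emeasure_Rzw_finite by (simp add: measure_def enn2real_positive_iff)

lemma ennreal_ratio:
  assumes "T \<in> sets borel"
  shows "ennreal (ratio N x0 y0 T \<theta>)
    = emeasure (area_on T) (Rzw N x0 y0 \<theta>) * ennreal (1 / measure lborel (Rzw N x0 y0 \<theta>))"
proof -
  have "emeasure lborel (T \<inter> Rzw N x0 y0 \<theta>) \<le> emeasure lborel (Rzw N x0 y0 \<theta>)"
    using Rzw_borel by (intro emeasure_mono) auto
  then have "emeasure lborel (T \<inter> Rzw N x0 y0 \<theta>) \<noteq> \<top>" using emeasure_Rzw_finite by (auto simp: top_unique)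
  then have "emeasure (area_on T) (Rzw N x0 y0 \<theta>) = ennreal (measure lborel (T \<inter> Rzw N x0 y0 \<theta>))"
    unfolding emeasure_area_on[OF assms Rzw_borel] by (rule emeasure_eq_ennreal_measure)
  then show ?thesis
    using measure_Rzw_pos by (simp add: ratio_def ennreal_mult[symmetric])
qed

end

lemma Theta_measurable: "Theta N \<in> sets (ThetaM N)"
  unfolding Theta_def ThetaM_def by (intro pair_measureI sets_PiM_I_finite) auto

locale mixture =
  fixes N :: nat and x0 y0 :: real and Q :: "((nat \<Rightarrow> real) \<times> (nat \<Rightarrow> real)) measure"
  assumes N: "1 \<le> N" and prob: "prob_space Q" and sets_Q: "sets Q = sets (ThetaM N)"
    and supp: "emeasure Q (Theta N) = 1"
begin

interpretation prob_space Q by (rule prob)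

lemma AE_Theta: "AE \<theta> in Q. \<theta> \<in> Theta N"
  using supp by (intro AE_prob_1) (simp add: measure_def)

text \<open>The uniform density on the region, written with \<open>quadrant_union\<close> because
  that set is jointly measurable for all parameters. It agrees with the density on
  \<open>Rzw\<close> for almost every parameter, since \<open>Q\<close> is carried by
  \<open>Theta\<close>.\<close>

definition kernel :: "(nat \<Rightarrow> real) \<times> (nat \<Rightarrow> real) \<Rightarrow> real \<times> real \<Rightarrow> ennreal" where
  "kernel \<theta> p = ennreal (indicator (quadrant_union N x0 y0 \<theta>) p / measure lborel (quadrant_union N x0 y0 \<theta>))"

lemma kernel_measurable: "(\<lambda>(\<theta>, p). kernel \<theta> p) \<in> borel_measurable (Q \<Otimes>\<^sub>M borel)"
proof -
  have spQ: "space Q = space (ThetaM N)" using sets_Q by (rule sets_eq_imp_space_eq)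
  have "sets (Q \<Otimes>\<^sub>M (borel :: (real \<times> real) measure)) = sets (ThetaM N \<Otimes>\<^sub>M borel)"
    using sets_Q by (intro sets_pair_measure_cong) auto
  then have S: "{(\<theta>, p). \<theta> \<in> space Q \<and> p \<in> quadrant_union N x0 y0 \<theta>} \<in> sets (Q \<Otimes>\<^sub>M (borel :: (real \<times> real) measure))"
    (is "?S \<in> _") using quadrant_union_measurable[of N x0 y0] spQ by simp
  have "sets (Q \<Otimes>\<^sub>M (lborel :: (real \<times> real) measure)) = sets (Q \<Otimes>\<^sub>M borel)"
    by (intro sets_pair_measure_cong) auto
  with S have "?S \<in> sets (Q \<Otimes>\<^sub>M (lborel :: (real \<times> real) measure))" by simp
  from lborel.measurable_emeasure_Pair[OF this]
  have "(\<lambda>\<theta>. emeasure lborel (Pair \<theta> -` ?S)) \<in> borel_measurable Q" .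
  then have "(\<lambda>\<theta>. emeasure lborel (quadrant_union N x0 y0 \<theta>)) \<in> borel_measurable Q"
    by (rule measurable_cong[THEN iffD1, rotated]) (auto intro!: arg_cong[where f = "emeasure lborel"])
  then have [measurable]: "(\<lambda>\<theta>. measure lborel (quadrant_union N x0 y0 \<theta>)) \<in> borel_measurable Q"
    unfolding measure_def by measurable
  note S[measurable]
  have "(\<lambda>x. ennreal (indicator ?S x / measure lborel (quadrant_union N x0 y0 (fst x))))
      \<in> borel_measurable (Q \<Otimes>\<^sub>M (borel :: (real \<times> real) measure))"
    by measurable
  then show ?thesis
    by (rule measurable_cong[THEN iffD1, rotated])
      (auto simp: kernel_def space_pair_measure indicator_def)
qed

lemma mix_eq_kernel:
  "(\<integral>\<^sup>+ \<theta>. ennreal (indicator (Rzw N x0 y0 \<theta>) p / measure lborel (Rzw N x0 y0 \<theta>)) \<partial>Q)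
    = (\<integral>\<^sup>+ \<theta>. kernel \<theta> p \<partial>Q)"
  by (intro nn_integral_cong_AE eventually_mono[OF AE_Theta])
    (simp add: kernel_def Rzw_eq_quadrant_union[OF _ N])

lemma mix_measurable:
  "(\<lambda>p. \<integral>\<^sup>+ \<theta>. ennreal (indicator (Rzw N x0 y0 \<theta>) p / measure lborel (Rzw N x0 y0 \<theta>)) \<partial>Q) \<in> borel_measurable borel"
proof -
  have "(\<lambda>(p, \<theta>). kernel \<theta> p) \<in> borel_measurable (borel \<Otimes>\<^sub>M Q)"
    using measurable_compose[OF measurable_pair_swap' kernel_measurable] by (simp add: case_prod_beta)
  then show ?thesis unfolding mix_eq_kernel by (rule borel_measurable_nn_integral)
qed

text \<open>Tonelli's theorem for an arbitrary measure \<open>\<nu>\<close>; inserting the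
  constraint measures turns each integral of the mixture into an expectation of problem
  (II).\<close>

lemma mix_integral:
  assumes "sigma_finite_measure \<nu>" "sets \<nu> = sets borel"
  shows "(\<integral>\<^sup>+ p. \<integral>\<^sup>+ \<theta>. ennreal (indicator (Rzw N x0 y0 \<theta>) p / measure lborel (Rzw N x0 y0 \<theta>)) \<partial>Q \<partial>\<nu>)
    = (\<integral>\<^sup>+ \<theta>. emeasure \<nu> (Rzw N x0 y0 \<theta>) * ennreal (1 / measure lborel (Rzw N x0 y0 \<theta>)) \<partial>Q)"
proof -
  interpret V: sigma_finite_measure \<nu> by fact
  interpret P: pair_sigma_finite Q \<nu> ..
  have "sets (Q \<Otimes>\<^sub>M \<nu>) = sets (Q \<Otimes>\<^sub>M borel)"
    using assms by (intro sets_pair_measure_cong) auto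
  then have meas: "(\<lambda>(\<theta>, p). kernel \<theta> p) \<in> borel_measurable (Q \<Otimes>\<^sub>M \<nu>)"
    using kernel_measurable by (simp cong: measurable_cong_sets)
  have "(\<integral>\<^sup>+ p. \<integral>\<^sup>+ \<theta>. ennreal (indicator (Rzw N x0 y0 \<theta>) p / measure lborel (Rzw N x0 y0 \<theta>)) \<partial>Q \<partial>\<nu>)
      = (\<integral>\<^sup>+ \<theta>. \<integral>\<^sup>+ p. kernel \<theta> p \<partial>\<nu> \<partial>Q)"
    unfolding mix_eq_kernel by (rule P.Fubini'[OF meas])
  also have "\<dots> = (\<integral>\<^sup>+ \<theta>. emeasure \<nu> (Rzw N x0 y0 \<theta>) * ennreal (1 / measure lborel (Rzw N x0 y0 \<theta>)) \<partial>Q)"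
    using AE_Theta
  proof (intro nn_integral_cong_AE, eventually_elim)
    fix \<theta> assume th: "\<theta> \<in> Theta N"
    have "(\<integral>\<^sup>+ p. kernel \<theta> p \<partial>\<nu>)
        = (\<integral>\<^sup>+ p. indicator (Rzw N x0 y0 \<theta>) p * ennreal (1 / measure lborel (Rzw N x0 y0 \<theta>)) \<partial>\<nu>)"
      by (intro nn_integral_cong)
        (auto simp: kernel_def Rzw_eq_quadrant_union[OF th N] indicator_def)
    then show "(\<integral>\<^sup>+ p. kernel \<theta> p \<partial>\<nu>)
        = emeasure \<nu> (Rzw N x0 y0 \<theta>) * ennreal (1 / measure lborel (Rzw N x0 y0 \<theta>))"
      using Rzw_borel[OF th N] assms(2) by (simp add: nn_integral_multc)
  qed
  finally show ?thesis .
qed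

end

text \<open>The direction from (II) to the density problem. The mass condition is an arbitrary
  predicate that holds at \<open>c\<close>, so both parts of the theorem can use it.\<close>

lemma ou_feasible_mix_density:
  assumes c: "0 < c" and II: "II_feasible x0 y0 n x1 x2 y1 y2 a b uX uY c Q"
    and massOK: "massOK (ennreal c)"
  shows "ou_feasible x0 y0 n x1 x2 y1 y2 a b uX uY massOK (mix_density x0 y0 n c Q)"
    and "g \<in> borel_measurable (restrict_space borel {x0..}) \<Longrightarrow>
      enn2ereal (\<integral>\<^sup>+ p\<in>Sg x0 y0 g. mix_density x0 y0 n c Q p \<partial>lborel)
      = II_obj x0 y0 n (Sg x0 y0 g) c Q"
proof -
  define N where "N = 12 * n + 3"
  note feas = II[unfolded II_feasible_def Let_def, folded N_def]
  interpret mixture N x0 y0 Q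
    by (rule mixture.intro) (use feas in \<open>simp_all add: N_def\<close>)
  have N1: "1 \<le> N" by (simp add: N_def)
  interpret prob_space Q by (rule prob)
  define h where "h p = (\<integral>\<^sup>+ \<theta>. ennreal (indicator (Rzw N x0 y0 \<theta>) p / measure lborel (Rzw N x0 y0 \<theta>)) \<partial>Q)" for p
  have h [measurable]: "h \<in> borel_measurable borel" unfolding h_def by (rule mix_measurable)
  have mix: "mix_density x0 y0 n c Q = (\<lambda>p. ennreal c * h p)"
    by (simp add: mix_density_def h_def N_def fun_eq_iff)
  then have mix_meas [measurable]: "mix_density x0 y0 n c Q \<in> borel_measurable borel" by simp
  have int: "(\<integral>\<^sup>+ p. mix_density x0 y0 n c Q p \<partial>\<nu>)
      = ennreal c * (\<integral>\<^sup>+ \<theta>. emeasure \<nu> (Rzw N x0 y0 \<theta>) * ennreal (1 / measure lborel (Rzw N x0 y0 \<theta>)) \<partial>Q)"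
    if "sigma_finite_measure \<nu>" and s: "sets \<nu> = sets borel" for \<nu>
    using mix_integral[OF that] h unfolding mix h_def[symmetric]
    by (simp add: nn_integral_cmult measurable_cong_sets[OF s refl])
  have area: "(\<integral>\<^sup>+ p\<in>T. mix_density x0 y0 n c Q p \<partial>lborel)
      = ennreal c * (\<integral>\<^sup>+ \<theta>. ennreal (ratio N x0 y0 T \<theta>) \<partial>Q)" if T: "T \<in> sets borel" for T
  proof -
    have "(\<integral>\<^sup>+ p\<in>T. mix_density x0 y0 n c Q p \<partial>lborel) = (\<integral>\<^sup>+ p. mix_density x0 y0 n c Q p \<partial>area_on T)"
      using nn_integral_area_on[OF T mix_meas] by simp
    also have "\<dots> = ennreal c * (\<integral>\<^sup>+ \<theta>. ennreal (ratio N x0 y0 T \<theta>) \<partial>Q)"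
      unfolding int[OF sigma_finite_area_on[OF T] sets_problem_measures(1)]
      by (intro arg_cong2[where f = times] refl nn_integral_cong_AE eventually_mono[OF AE_Theta])
        (simp add: ennreal_ratio[OF _ N1 T])
    finally show ?thesis .
  qed
  have mass: "(\<integral>\<^sup>+ p\<in>D0 x0 y0. mix_density x0 y0 n c Q p \<partial>lborel) = ennreal c"
  proof -
    have "(\<integral>\<^sup>+ \<theta>. ennreal (ratio N x0 y0 (D0 x0 y0) \<theta>) \<partial>Q) = (\<integral>\<^sup>+ \<theta>. 1 \<partial>Q)"
    proof (intro nn_integral_cong_AE eventually_mono[OF AE_Theta])
      fix \<theta> assume th: "\<theta> \<in> Theta N"
      have "D0 x0 y0 \<inter> Rzw N x0 y0 \<theta> = Rzw N x0 y0 \<theta>" by (auto simp: Rzw_def)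
      then show "ennreal (ratio N x0 y0 (D0 x0 y0) \<theta>) = 1"
        using measure_Rzw_pos[OF th N1, of x0 y0] by (simp add: ratio_def)
    qed
    then show ?thesis using area[OF D0_borel, of x0 y0] by (simp add: emeasure_space_1)
  qed
  have scale: "ennreal c * v \<le> ennreal u" if v: "v \<le> ennreal (u / c)" for u v
  proof -
    have "ennreal c * v \<le> ennreal c * ennreal (u / c)" using v by (rule mult_left_mono) simp
    also have "\<dots> = ennreal u" using c by (simp add: ennreal_mult'[symmetric])
    finally show ?thesis .
  qed
  have "(\<integral>\<^sup>+ y\<in>{y0..}. mix_density x0 y0 n c Q (x0, y) \<partial>lborel)
      = ennreal c * (\<integral>\<^sup>+ \<theta>. ennreal (sum (snd \<theta>) {1..N} / measure lborel (Rzw N x0 y0 \<theta>)) \<partial>Q)"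
    unfolding nn_integral_col_length[OF mix_meas, symmetric] int[OF sigma_finite_col_length sets_problem_measures(2)]
  proof (intro arg_cong2[where f = times] refl nn_integral_cong_AE eventually_mono[OF AE_Theta])
    fix \<theta> assume th: "\<theta> \<in> Theta N"
    show "emeasure (col_length x0 y0) (Rzw N x0 y0 \<theta>) * ennreal (1 / measure lborel (Rzw N x0 y0 \<theta>))
        = ennreal (sum (snd \<theta>) {1..N} / measure lborel (Rzw N x0 y0 \<theta>))"
      using Theta_sums_pos(2)[OF th N1, of N] N1
      by (simp add: emeasure_col_length_Rzw[OF th N1] ennreal_mult[symmetric])
  qed
  then have col: "(\<integral>\<^sup>+ y\<in>{y0..}. mix_density x0 y0 n c Q (x0, y) \<partial>lborel) \<le> ennreal uX"
    using feas scale by simp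
  have "(\<integral>\<^sup>+ x\<in>{x0..}. mix_density x0 y0 n c Q (x, y0) \<partial>lborel)
      = ennreal c * (\<integral>\<^sup>+ \<theta>. ennreal (sum (fst \<theta>) {1..N} / measure lborel (Rzw N x0 y0 \<theta>)) \<partial>Q)"
    unfolding nn_integral_row_length[OF mix_meas, symmetric] int[OF sigma_finite_row_length sets_problem_measures(3)]
  proof (intro arg_cong2[where f = times] refl nn_integral_cong_AE eventually_mono[OF AE_Theta])
    fix \<theta> assume th: "\<theta> \<in> Theta N"
    show "emeasure (row_length x0 y0) (Rzw N x0 y0 \<theta>) * ennreal (1 / measure lborel (Rzw N x0 y0 \<theta>))
        = ennreal (sum (fst \<theta>) {1..N} / measure lborel (Rzw N x0 y0 \<theta>))"
      using Theta_sums_pos(1)[OF th N1, of N] N1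
      by (simp add: emeasure_row_length_Rzw[OF th N1] ennreal_mult[symmetric])
  qed
  then have row: "(\<integral>\<^sup>+ x\<in>{x0..}. mix_density x0 y0 n c Q (x, y0) \<partial>lborel) \<le> ennreal uY"
    using feas scale by simp
  \<comment> \<open>Each region is closed towards the corner, so its uniform density decreases at
    every pair of points, and the mixture inherits this pointwise and not merely almost
    everywhere.\<close>
  have mono: "mix_density x0 y0 n c Q (x, y) \<le> mix_density x0 y0 n c Q (x', y')"
    if "x0 \<le> x'" "x' \<le> x" "y0 \<le> y'" "y' \<le> y" for x y x' y'
    unfolding mix h_def
  proof (intro mult_left_mono nn_integral_mono_AE eventually_mono[OF AE_Theta])
    fix \<theta> assume th: "\<theta> \<in> Theta N"
    have "indicat_real (Rzw N x0 y0 \<theta>) (x, y) \<le> indicator (Rzw N x0 y0 \<theta>) (x', y')"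
      using Rzw_lower[OF th N1 _ that] by (auto simp: indicator_def)
    then show "ennreal (indicator (Rzw N x0 y0 \<theta>) (x, y) / measure lborel (Rzw N x0 y0 \<theta>))
        \<le> ennreal (indicator (Rzw N x0 y0 \<theta>) (x', y') / measure lborel (Rzw N x0 y0 \<theta>))"
      by (intro ennreal_leI divide_right_mono) auto
  qed simp
  have boxes: "ennreal (a k) * ennreal c
        \<le> (\<integral>\<^sup>+ p\<in>Box x0 y0 (x1 k) (x2 k) (y1 k) (y2 k). mix_density x0 y0 n c Q p \<partial>lborel) \<and>
      (\<integral>\<^sup>+ p\<in>Box x0 y0 (x1 k) (x2 k) (y1 k) (y2 k). mix_density x0 y0 n c Q p \<partial>lborel)
        \<le> ennreal (b k) * ennreal c" if "k \<in> {1..n}" for k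
    using feas that unfolding area[OF Box_borel] mult.commute[of _ "ennreal c"]
    by (intro conjI mult_left_mono) simp_all
  show "ou_feasible x0 y0 n x1 x2 y1 y2 a b uX uY massOK (mix_density x0 y0 n c Q)"
    unfolding ou_feasible_def mass using mix_meas massOK col row mono boxes
    by (auto intro!: measurable_restrict_space1)
  show "enn2ereal (\<integral>\<^sup>+ p\<in>Sg x0 y0 g. mix_density x0 y0 n c Q p \<partial>lborel)
      = II_obj x0 y0 n (Sg x0 y0 g) c Q"
    if "g \<in> borel_measurable (restrict_space borel {x0..})"
    unfolding area[OF Sg_borel[OF that]] II_obj_def N_def
    using c by (simp add: times_ennreal.rep_eq enn2ereal_ennreal)
qed

lemma singleton_ThetaM:
  assumes "\<theta> \<in> Theta N"
  shows "{\<theta>} \<in> sets (ThetaM N)"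
proof -
  obtain z w where \<theta>: "\<theta> = (z, w)" by (cases \<theta>)
  have "{\<theta>} = (\<Pi>\<^sub>E i\<in>{1..N}. {z i}) \<times> (\<Pi>\<^sub>E i\<in>{1..N}. {w i})"
  proof -
    have "z \<in> extensional {1..N}" "w \<in> extensional {1..N}" using assms \<theta> by (auto simp: Theta_def PiE_def)
    then show ?thesis using \<theta> by (simp add: PiE_singleton)
  qed
  also have "\<dots> \<in> sets (ThetaM N)"
    unfolding ThetaM_def by (intro pair_measureI sets_PiM_I_finite) auto
  finally show ?thesis .
qed

text \<open>The integral formula holds for arbitrary \<open>f\<close>, since \<open>f\<close> agrees
  almost everywhere with a finite combination of indicators of points, and points of
  \<open>Theta\<close> are measurable sets.\<close>

lemma discrete_mixing_measure:
  assumes "finite A" "A \<subseteq> Theta N" "\<forall>\<theta>\<in>A. 0 \<le> q \<theta>" "sum q A = 1"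
  shows "\<exists>Q. prob_space Q \<and> sets Q = sets (ThetaM N) \<and> emeasure Q A = 1 \<and> emeasure Q (Theta N) = 1 \<and>
    (\<forall>f. (\<integral>\<^sup>+ \<theta>. f \<theta> \<partial>Q) = (\<Sum>\<theta>\<in>A. ennreal (q \<theta>) * f \<theta>))"
proof -
  define P where "P = point_measure A (\<lambda>\<theta>. ennreal (q \<theta>))"
  \<comment> \<open>A point measure lives on the power set of \<open>A\<close>; pushing it forward
    gives it the sigma-algebra that (II) prescribes.\<close>
  define Q where "Q = distr P (ThetaM N) (\<lambda>\<theta>. \<theta>)"
  have "A \<subseteq> space (ThetaM N)"
    using assms(2) sets.sets_into_space[OF Theta_measurable[of N]] by auto
  then have meas: "(\<lambda>\<theta>. \<theta>) \<in> P \<rightarrow>\<^sub>M ThetaM N"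
    by (auto simp: P_def measurable_def space_point_measure sets_point_measure)
  have sQ [simp]: "sets Q = sets (ThetaM N)" by (simp add: Q_def)
  have sing: "{\<theta>} \<in> sets (ThetaM N)" if "\<theta> \<in> A" for \<theta> using singleton_ThetaM that assms(2) by blast
  have Asets: "A \<in> sets (ThetaM N)"
    using sets.finite_UN[OF assms(1), of "\<lambda>\<theta>. {\<theta>}"] sing by simp
  have em: "emeasure Q B = (\<Sum>\<theta>\<in>A \<inter> B. ennreal (q \<theta>))" if "B \<in> sets (ThetaM N)" for B
  proof -
    have "emeasure Q B = emeasure P (A \<inter> B)"
      unfolding Q_def emeasure_distr[OF meas that] by (simp add: P_def space_point_measure Int_commute)
    then show ?thesis using assms(1) by (simp add: P_def emeasure_point_measure_finite)
  qed
  have one: "(\<Sum>\<theta>\<in>A. ennreal (q \<theta>)) = 1"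
    using assms(3,4) by (subst sum_ennreal) auto
  have "emeasure Q A = 1" using em[OF Asets] one by simp
  moreover have "emeasure Q (Theta N) = 1"
    using em[OF Theta_measurable] one assms(2) by (simp add: Int_absorb2)
  moreover have "prob_space Q"
  proof
    have "space Q = space (ThetaM N)" by (simp add: Q_def)
    then show "emeasure Q (space Q) = 1"
      using em[OF sets.top] one \<open>A \<subseteq> space (ThetaM N)\<close> by (simp add: Int_absorb2)
  qed
  moreover have "(\<integral>\<^sup>+ \<theta>. f \<theta> \<partial>Q) = (\<Sum>\<theta>\<in>A. ennreal (q \<theta>) * f \<theta>)" for f
  proof -
    interpret prob_space Q by fact
    have "AE \<theta> in Q. \<theta> \<in> A" using \<open>emeasure Q A = 1\<close> by (intro AE_prob_1) (simp add: measure_def)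
    then have "(\<integral>\<^sup>+ \<theta>. f \<theta> \<partial>Q) = (\<integral>\<^sup>+ \<theta>. (\<Sum>\<eta>\<in>A. f \<eta> * indicator {\<eta>} \<theta>) \<partial>Q)"
      using assms(1) by (intro nn_integral_cong_AE)
        (auto elim!: eventually_mono simp: indicator_def sum.If_cases if_distrib cong: if_cong)
    also have "\<dots> = (\<Sum>\<eta>\<in>A. f \<eta> * emeasure Q {\<eta>})"
    proof (subst nn_integral_sum)
      fix \<eta> assume "\<eta> \<in> A"
      then have [measurable]: "{\<eta>} \<in> sets Q" using sing by simp
      show "(\<lambda>\<theta>. f \<eta> * indicator {\<eta>} \<theta>) \<in> borel_measurable Q" by measurable
    next
      show "(\<Sum>\<eta>\<in>A. \<integral>\<^sup>+ \<theta>. f \<eta> * indicator {\<eta>} \<theta> \<partial>Q) = (\<Sum>\<eta>\<in>A. f \<eta> * emeasure Q {\<eta>})"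
        using sing by (intro sum.cong) (simp_all add: nn_integral_cmult)
    qed
    also have "\<dots> = (\<Sum>\<eta>\<in>A. ennreal (q \<eta>) * f \<eta>)"
      using em sing by (intro sum.cong) (auto simp: mult.commute)
    finally show ?thesis .
  qed
  ultimately show ?thesis using sQ by (intro exI[of _ Q] conjI allI)
qed

section \<open>Averaging over slabs\<close>

text \<open>A decreasing function has its smaller values on the upper part \<open>U\<close>, so
  replacing it by its mean over the whole interval can only raise the integral over
  \<open>U\<close>. This is what makes averaging favorable to the objective.\<close>

lemma upper_part_average:
  fixes \<phi> :: "real \<Rightarrow> ennreal"
  assumes ab: "a < b" and [measurable]: "\<phi> \<in> borel_measurable borel" "U \<in> sets borel"
    and U: "U \<subseteq> {a..<b}" "\<And>y y'. y \<in> U \<Longrightarrow> y \<le> y' \<Longrightarrow> y' < b \<Longrightarrow> y' \<in> U"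
    and anti: "\<And>y y'. a \<le> y \<Longrightarrow> y \<le> y' \<Longrightarrow> y' < b \<Longrightarrow> \<phi> y' \<le> \<phi> y"
  shows "(\<integral>\<^sup>+ y\<in>U. \<phi> y \<partial>lborel)
    \<le> emeasure lborel U * ((\<integral>\<^sup>+ y\<in>{a..<b}. \<phi> y \<partial>lborel) / ennreal (b - a))"
proof -
  define V where "V = {a..<b} - U"
  have [measurable]: "V \<in> sets borel" by (simp add: V_def)
  define I where "I A = (\<integral>\<^sup>+ y\<in>A. \<phi> y \<partial>lborel)" for A
  \<comment> \<open>The threshold between the parts: an upper bound of \<open>\<phi>\<close> on
    \<open>U\<close> and, by monotonicity, a lower bound on the complement \<open>V\<close>.\<close>
  define \<kappa> where "\<kappa> = (SUP y\<in>U. \<phi> y)"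
  have len: "ennreal (b - a) = emeasure lborel U + emeasure lborel V"
  proof -
    have "emeasure lborel U + emeasure lborel V = emeasure lborel (U \<union> V)"
      by (rule plus_emeasure) (auto simp: V_def)
    also have "U \<union> V = {a..<b}" using U(1) by (auto simp: V_def)
    finally show ?thesis using ab by simp
  qed
  have I: "I {a..<b} = I U + I V"
  proof -
    have "I {a..<b} = (\<integral>\<^sup>+ y. \<phi> y * indicator U y + \<phi> y * indicator V y \<partial>lborel)"
      unfolding I_def using U(1) by (intro nn_integral_cong) (auto simp: V_def indicator_def)
    then show ?thesis by (simp add: I_def nn_integral_add)
  qed
  have IU: "I U \<le> \<kappa> * emeasure lborel U"
  proof -
    have "I U \<le> (\<integral>\<^sup>+ y. \<kappa> * indicator U y \<partial>lborel)"
      unfolding I_def \<kappa>_def by (intro nn_integral_mono) (auto simp: indicator_def intro: SUP_upper)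
    then show ?thesis by (simp add: nn_integral_cmult)
  qed
  have IV: "\<kappa> * emeasure lborel V \<le> I V"
  proof -
    have "\<kappa> \<le> \<phi> y" if "y \<in> V" for y
      unfolding \<kappa>_def
    proof (rule SUP_least)
      fix u assume "u \<in> U"
      then have "y \<le> u" using U(2)[of u y] that by (force simp: V_def)
      then show "\<phi> u \<le> \<phi> y" using that \<open>u \<in> U\<close> U(1) by (intro anti) (auto simp: V_def)
    qed
    then have "(\<integral>\<^sup>+ y. \<kappa> * indicator V y \<partial>lborel) \<le> I V"
      unfolding I_def by (intro nn_integral_mono) (auto simp: indicator_def)
    then show ?thesis by (simp add: nn_integral_cmult)
  qed
  have "I U * emeasure lborel V \<le> \<kappa> * emeasure lborel U * emeasure lborel V"
    using IU by (rule mult_right_mono) simp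
  also have "\<dots> = emeasure lborel U * (\<kappa> * emeasure lborel V)" by (simp add: mult_ac)
  also have "\<dots> \<le> emeasure lborel U * I V" using IV by (rule mult_left_mono) simp
  \<comment> \<open>The comparison is kept in product form, with
    \<open>I U * emeasure lborel U\<close> added on both sides; \<open>U\<close> or \<open>V\<close>
    may be null, so only the positive length \<open>b - a\<close> is divided by.\<close>
  finally have "I U * ennreal (b - a) \<le> emeasure lborel U * I {a..<b}"
    unfolding len I by (simp add: distrib_left mult.commute add_mono)
  then have "I U * ennreal (b - a) / ennreal (b - a) \<le> emeasure lborel U * I {a..<b} / ennreal (b - a)"
    by (rule divide_right_mono_ennreal)
  also have "I U * ennreal (b - a) / ennreal (b - a) = I U"
    using ab by (intro ennreal_mult_divide_eq) auto
  finally show ?thesis by (simp add: I_def ennreal_times_divide)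
qed

locale slabs =
  fixes Y :: "nat \<Rightarrow> real" and m :: nat
  assumes Y_less: "\<And>i j. i < j \<Longrightarrow> j \<le> m \<Longrightarrow> Y i < Y j"
begin

text \<open>Half-open intervals, so that the slabs with \<open>j < m\<close> partition
  \<open>{Y 0..<Y m}\<close> without overlap.\<close>

definition slab :: "nat \<Rightarrow> real set" where "slab j = {Y j..<Y (Suc j)}"

definition slab_mean :: "(real \<Rightarrow> ennreal) \<Rightarrow> nat \<Rightarrow> ennreal" where
  "slab_mean \<phi> j = (\<integral>\<^sup>+ t\<in>slab j. \<phi> t \<partial>lborel) / ennreal (Y (Suc j) - Y j)"

text \<open>The conditional expectation given the partition into slabs, continued by 0
  outside.\<close>

definition slab_avg :: "(real \<Rightarrow> ennreal) \<Rightarrow> real \<Rightarrow> ennreal" where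
  "slab_avg \<phi> y = (\<Sum>j<m. slab_mean \<phi> j * indicator (slab j) y)"

lemma Y_mono: "i \<le> j \<Longrightarrow> j \<le> m \<Longrightarrow> Y i \<le> Y j"
  using Y_less[of i j] by (cases "i = j") (auto intro: less_imp_le)

lemma slab_borel [measurable]: "slab j \<in> sets borel" by (simp add: slab_def)

lemma slab_unique: "y \<in> slab i \<Longrightarrow> y \<in> slab j \<Longrightarrow> i < m \<Longrightarrow> j < m \<Longrightarrow> i = j"
  using Y_mono[of "Suc i" j] Y_mono[of "Suc j" i]
  by (cases i j rule: linorder_cases) (auto simp: slab_def)

lemma slab_cover:
  assumes "Y 0 \<le> y" "y < Y m"
  shows "\<exists>j<m. y \<in> slab j"
proof -
  define j where "j = (LEAST j. y < Y j)"
  have "y < Y j" unfolding j_def by (rule LeastI[of _ m]) fact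
  have "j \<le> m" unfolding j_def by (rule Least_le) fact
  have "j \<noteq> 0" using \<open>y < Y j\<close> assms(1) by (cases "j = 0") auto
  then obtain k where k: "j = Suc k" by (cases j) auto
  then have "\<not> y < Y k" using not_less_Least[of k "\<lambda>j. y < Y j"] by (simp add: j_def)
  then show ?thesis using k \<open>y < Y j\<close> \<open>j \<le> m\<close> by (intro exI[of _ k]) (auto simp: slab_def)
qed

lemma indicator_slabs: "(\<Sum>j<m. indicator (slab j) y) = (indicator {Y 0..<Y m} y :: ennreal)"
proof (cases "y \<in> {Y 0..<Y m}")
  case True
  then obtain j where j: "j < m" "y \<in> slab j" using slab_cover by auto
  then have "(\<Sum>i<m. indicator (slab i) y) = (\<Sum>i<m. if i = j then 1 else (0::ennreal))"
    using slab_unique by (intro sum.cong) (auto simp: indicator_def)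
  then show ?thesis using True j by simp
next
  case False
  have "y \<notin> slab j" if "j < m" for j
    using that False Y_mono[of 0 j] Y_mono[of "Suc j" m] by (auto simp: slab_def)
  then show ?thesis using False by simp
qed

lemma slab_avg_on: "j < m \<Longrightarrow> y \<in> slab j \<Longrightarrow> slab_avg \<phi> y = slab_mean \<phi> j"
proof -
  assume j: "j < m" "y \<in> slab j"
  then have "slab_avg \<phi> y = (\<Sum>i<m. if i = j then slab_mean \<phi> j else 0)"
    unfolding slab_avg_def using slab_unique by (intro sum.cong) (auto simp: indicator_def)
  then show ?thesis using j by simp
qed

lemma slab_avg_outside: "y \<notin> {Y 0..<Y m} \<Longrightarrow> slab_avg \<phi> y = 0"
  unfolding slab_avg_def
proof (rule sum.neutral, rule ballI)
  fix j assume "y \<notin> {Y 0..<Y m}" "j \<in> {..<m}"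
  then have "y \<notin> slab j" using Y_mono[of 0 j] Y_mono[of "Suc j" m] by (auto simp: slab_def)
  then show "slab_mean \<phi> j * indicator (slab j) y = 0" by simp
qed

lemma emeasure_slab: "j < m \<Longrightarrow> emeasure lborel (slab j) = ennreal (Y (Suc j) - Y j)"
  using Y_less[of j "Suc j"] by (simp add: slab_def)

lemma slab_length: "j < m \<Longrightarrow> 0 < Y (Suc j) - Y j" using Y_less[of j "Suc j"] by simp

lemma slab_mean_const:
  assumes "j < m"
  shows "slab_mean (\<lambda>_. k) j = k"
proof -
  have "slab_mean (\<lambda>_. k) j = k * ennreal (Y (Suc j) - Y j) / ennreal (Y (Suc j) - Y j)"
    unfolding slab_mean_def using assms by (simp add: nn_integral_cmult emeasure_slab)
  also have "\<dots> = k" using slab_length[OF assms] by (intro ennreal_mult_divide_eq) auto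
  finally show ?thesis .
qed

lemma slab_mean_le:
  assumes "j < m" "\<And>t. t \<in> slab j \<Longrightarrow> \<phi> t \<le> k"
  shows "slab_mean \<phi> j \<le> k"
proof -
  have "slab_mean \<phi> j \<le> slab_mean (\<lambda>_. k) j"
    unfolding slab_mean_def using assms
    by (intro divide_right_mono_ennreal nn_integral_mono) (auto simp: indicator_def)
  then show ?thesis using slab_mean_const[OF assms(1)] by simp
qed

lemma slab_mean_ge:
  assumes "j < m" "\<And>t. t \<in> slab j \<Longrightarrow> k \<le> \<phi> t"
  shows "k \<le> slab_mean \<phi> j"
proof -
  have "slab_mean (\<lambda>_. k) j \<le> slab_mean \<phi> j"
    unfolding slab_mean_def using assms
    by (intro divide_right_mono_ennreal nn_integral_mono) (auto simp: indicator_def)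
  then show ?thesis using slab_mean_const[OF assms(1)] by simp
qed

text \<open>The value of \<open>\<phi>\<close> at the lower end of the higher slab separates the two
  means.\<close>

lemma slab_mean_antimono:
  assumes anti: "\<And>y y'. Y 0 \<le> y \<Longrightarrow> y \<le> y' \<Longrightarrow> \<phi> y' \<le> \<phi> y" and "i \<le> j" "j < m"
  shows "slab_mean \<phi> j \<le> slab_mean \<phi> i"
proof (cases "i = j")
  case False
  have ij: "Suc i \<le> j" "i < m" using False assms by auto
  have "slab_mean \<phi> j \<le> \<phi> (Y j)"
    using assms Y_mono[of 0 j] by (intro slab_mean_le anti) (auto simp: slab_def)
  also have "\<phi> (Y j) \<le> slab_mean \<phi> i"
    using ij assms(3) Y_mono[of "Suc i" j] Y_mono[of 0 i] by (intro slab_mean_ge anti) (auto simp: slab_def)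
  finally show ?thesis .
qed simp

lemma nn_integral_by_slabs:
  assumes [measurable]: "\<phi> \<in> borel_measurable borel" "T \<in> sets borel"
    and "\<And>y. y \<notin> {Y 0..<Y m} \<Longrightarrow> \<phi> y = 0"
  shows "(\<integral>\<^sup>+ y\<in>T. \<phi> y \<partial>lborel) = (\<Sum>j<m. \<integral>\<^sup>+ y\<in>T \<inter> slab j. \<phi> y \<partial>lborel)"
proof -
  have "\<phi> y * indicator T y = (\<Sum>j<m. \<phi> y * indicator (T \<inter> slab j) y)" for y
  proof -
    have "(\<Sum>j<m. \<phi> y * indicator (T \<inter> slab j) y) = \<phi> y * indicator T y * (\<Sum>j<m. indicator (slab j) y)"
      by (simp add: sum_distrib_left indicator_inter_arith mult_ac)
    then show ?thesis using assms(3)[of y] by (cases "y \<in> {Y 0..<Y m}") (simp_all add: indicator_slabs)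
  qed
  then show ?thesis by (simp only:) (rule nn_integral_sum, measurable)
qed

lemma slab_avg_measurable [measurable]: "slab_avg \<phi> \<in> borel_measurable borel"
  unfolding slab_avg_def by measurable

lemma nn_integral_slab_avg:
  assumes [measurable]: "T \<in> sets borel"
  shows "(\<integral>\<^sup>+ y\<in>T. slab_avg \<phi> y \<partial>lborel) = (\<Sum>j<m. emeasure lborel (T \<inter> slab j) * slab_mean \<phi> j)"
proof -
  have "(\<integral>\<^sup>+ y\<in>T \<inter> slab j. slab_avg \<phi> y \<partial>lborel) = emeasure lborel (T \<inter> slab j) * slab_mean \<phi> j"
    if "j < m" for j
  proof -
    have "(\<integral>\<^sup>+ y\<in>T \<inter> slab j. slab_avg \<phi> y \<partial>lborel) = (\<integral>\<^sup>+ y. slab_mean \<phi> j * indicator (T \<inter> slab j) y \<partial>lborel)"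
      using that by (intro nn_integral_cong) (auto simp: indicator_def slab_avg_on)
    then show ?thesis by (simp add: nn_integral_cmult mult.commute)
  qed
  then show ?thesis using nn_integral_by_slabs[of "slab_avg \<phi>" T] slab_avg_outside by simp
qed

text \<open>Averaging preserves the integral over every whole slab. The alternative with the single
  point \<open>Y j\<close> arises because boxes are closed while slabs are half-open: a box whose
  top edge is at \<open>Y j\<close> still touches slab \<open>j\<close>, but only in a null
  set.\<close>

lemma nn_integral_slab_avg_eq:
  assumes [measurable]: "\<phi> \<in> borel_measurable borel" "T \<in> sets borel"
    and "\<And>y. y \<notin> {Y 0..<Y m} \<Longrightarrow> \<phi> y = 0"
    and T: "\<And>j. j < m \<Longrightarrow> slab j \<subseteq> T \<or> T \<inter> slab j \<subseteq> {Y j}"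
  shows "(\<integral>\<^sup>+ y\<in>T. slab_avg \<phi> y \<partial>lborel) = (\<integral>\<^sup>+ y\<in>T. \<phi> y \<partial>lborel)"
proof -
  have "emeasure lborel (T \<inter> slab j) * slab_mean \<phi> j = (\<integral>\<^sup>+ y\<in>T \<inter> slab j. \<phi> y \<partial>lborel)" if j: "j < m" for j
    using T[OF j]
  proof
    assume "slab j \<subseteq> T"
    then have "T \<inter> slab j = slab j" by auto
    moreover have "ennreal (Y (Suc j) - Y j) * slab_mean \<phi> j = (\<integral>\<^sup>+ y\<in>slab j. \<phi> y \<partial>lborel)"
      unfolding slab_mean_def ennreal_times_divide
      using slab_length[OF j] by (subst mult.commute, intro ennreal_mult_divide_eq) auto
    ultimately show ?thesis using j by (simp add: emeasure_slab)
  next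
    assume sub: "T \<inter> slab j \<subseteq> {Y j}"
    then have "emeasure lborel (T \<inter> slab j) \<le> emeasure lborel {Y j}" by (intro emeasure_mono) auto
    then have zero: "emeasure lborel (T \<inter> slab j) = 0" by simp
    then have "(\<integral>\<^sup>+ y\<in>T \<inter> slab j. \<phi> y \<partial>lborel) = 0" by (intro nn_integral_null_set) auto
    with zero show ?thesis by simp
  qed
  then show ?thesis using assms(3) nn_integral_by_slabs[OF assms(1-3)] by (simp add: nn_integral_slab_avg)
qed

lemma nn_integral_slab_avg_upper:
  assumes [measurable]: "\<phi> \<in> borel_measurable borel" "T \<in> sets borel"
    and "\<And>y. y \<notin> {Y 0..<Y m} \<Longrightarrow> \<phi> y = 0"
    and anti: "\<And>y y'. Y 0 \<le> y \<Longrightarrow> y \<le> y' \<Longrightarrow> \<phi> y' \<le> \<phi> y"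
    and T: "\<And>y y'. y \<in> T \<Longrightarrow> y \<le> y' \<Longrightarrow> y' \<in> T"
  shows "(\<integral>\<^sup>+ y\<in>T. \<phi> y \<partial>lborel) \<le> (\<integral>\<^sup>+ y\<in>T. slab_avg \<phi> y \<partial>lborel)"
proof -
  have "(\<integral>\<^sup>+ y\<in>T \<inter> slab j. \<phi> y \<partial>lborel) \<le> emeasure lborel (T \<inter> slab j) * slab_mean \<phi> j" if j: "j < m" for j
    unfolding slab_mean_def slab_def
  proof (rule upper_part_average)
    show "Y j < Y (Suc j)" using slab_length[OF j] by simp
    show "\<phi> y' \<le> \<phi> y" if "Y j \<le> y" "y \<le> y'" "y' < Y (Suc j)" for y y'
      using that Y_mono[of 0 j] j by (intro anti) auto
  qed (use T in auto)
  then show ?thesis using assms(3) nn_integral_by_slabs[OF assms(1-3)] by (auto simp: nn_integral_slab_avg intro!: sum_mono)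
qed

end

text \<open>Finite edges within the range become breakpoints; edges outside it and infinite edges
  have every slab on one side anyway. Together with the two ends this gives at most
  \<open>card E + 2\<close> points, hence \<open>card E + 1\<close> slabs.\<close>

lemma grid_exists:
  fixes E :: "ereal set" and y0 Yt :: real
  assumes "finite E" and "y0 < Yt"
  shows "\<exists>Y m. slabs Y m \<and> Y 0 = y0 \<and> Y m = Yt \<and> m \<le> card E + 1 \<and>
    (\<forall>e\<in>E. \<forall>j<m. e \<le> ereal (Y j) \<or> ereal (Y (Suc j)) \<le> e)"
proof -
  \<comment> \<open>\<open>real_of_ereal\<close> sends infinite edges to 0, which may add a
    breakpoint that is already counted in \<open>card E\<close>.\<close>
  define G where "G = insert y0 (insert Yt (real_of_ereal ` E \<inter> {y0..Yt}))"
  have fin: "finite G" using assms(1) by (simp add: G_def)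
  define L where "L = sorted_list_of_set G"
  define m where "m = card G - 1"
  have len: "length L = card G" by (simp add: L_def)
  have set: "set L = G" using fin by (simp add: L_def)
  have "0 < card G" using fin by (auto simp: card_gt_0_iff G_def)
  then have len': "length L = Suc m" using len by (simp add: m_def)
  have less: "L ! i < L ! j" if "i < j" "j \<le> m" for i j
    using sorted_wrt_nth_less[OF strict_sorted_list_of_set[of G], of i j] that len' by (simp add: L_def)
  interpret slabs "\<lambda>j. L ! j" m by unfold_locales (rule less)
  have idx: "\<exists>k\<le>m. L ! k = v" if "v \<in> G" for v
    using that len' unfolding set[symmetric] in_set_conv_nth by (metis less_Suc_eq_le)
  have range: "y0 \<le> L ! k" "L ! k \<le> Yt" if "k \<le> m" for k
    using nth_mem[of k L] that len' set assms(2) by (auto simp: G_def)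
  have "L ! 0 = y0"
    using idx[of y0] Y_mono[of 0] range[of 0] by (force simp: G_def)
  moreover have "L ! m = Yt"
    using idx[of Yt] Y_mono[of _ m] range[of m] by (force simp: G_def)
  moreover have "m \<le> card E + 1"
  proof -
    have "card (real_of_ereal ` E \<inter> {y0..Yt}) \<le> card (real_of_ereal ` E)"
      using assms(1) by (intro card_mono) auto
    also have "\<dots> \<le> card E" using assms(1) by (rule card_image_le)
    finally have "card G \<le> Suc (Suc (card E))"
      using assms(1) by (simp add: G_def card_insert_if)
    then show ?thesis by (simp add: m_def)
  qed
  moreover have "e \<le> ereal (L ! j) \<or> ereal (L ! Suc j) \<le> e" if e: "e \<in> E" and j: "j < m" for e j
  proof (cases e)
    case (real r)
    consider "r < y0" | "Yt < r" | "r \<in> G"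
      using e real by (force simp: G_def)
    then show ?thesis
    proof cases
      case 1
      then show ?thesis using real range[of j] j by auto
    next
      case 2
      then show ?thesis using real range[of "Suc j"] j by auto
    next
      case 3
      then obtain k where "k \<le> m" "L ! k = r" using idx by blast
      then show ?thesis using real j Y_mono[of k j] Y_mono[of "Suc j" k] by (cases "k \<le> j") auto
    qed
  qed auto
  ultimately show ?thesis
    using slabs_axioms by (intro exI[of _ "\<lambda>j. L ! j"] exI[of _ m]) auto
qed

lemma nn_integral_area_iterated:
  fixes F :: "real \<times> real \<Rightarrow> ennreal"
  assumes [measurable]: "F \<in> borel_measurable borel" "T \<in> sets borel"
  shows "(\<integral>\<^sup>+ p\<in>T. F p \<partial>lborel) = (\<integral>\<^sup>+ x. (\<integral>\<^sup>+ y\<in>(Pair x -` T). F (x, y) \<partial>lborel) \<partial>lborel)"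
proof -
  have "(\<lambda>p. F p * indicator T p) \<in> borel_measurable (lborel \<Otimes>\<^sub>M lborel)"
    unfolding lborel_prod by measurable
  from lborel.nn_integral_fst[OF this] show ?thesis
    unfolding lborel_prod by (simp add: indicator_vimage[symmetric] indicator_def vimage_def)
qed

lemma Pair_vimage_borel:
  assumes "T \<in> sets (borel :: (real \<times> real) measure)"
  shows "Pair x -` T \<in> sets borel"
  using measurable_sets[OF Pair_borel(1) assms] by simp

lemma null_vertical_line: "emeasure lborel {p :: real \<times> real. fst p = c} = 0"
proof -
  have "{p :: real \<times> real. fst p = c} = {c} \<times> UNIV" by auto
  then show ?thesis by (simp add: emeasure_lborel_Times)
qed

lemma null_horizontal_line: "emeasure lborel {p :: real \<times> real. snd p = c} = 0"
proof -
  have "{p :: real \<times> real. snd p = c} = UNIV \<times> {c}" by auto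
  then show ?thesis by (simp add: emeasure_lborel_Times)
qed

text \<open>Vanishing above \<open>Y m\<close> confines each vertical section to slabs of finite
  length, so that means make sense; vanishing beyond \<open>x_max\<close> keeps the level sets
  bounded in \<open>x\<close>.\<close>

locale slab_averaging = slabs +
  fixes F :: "real \<times> real \<Rightarrow> ennreal" and x0 y0 x_max :: real
  assumes F_meas [measurable]: "F \<in> borel_measurable borel"
    and Y0: "Y 0 = y0"
    and F_left: "\<And>x y. x < x0 \<Longrightarrow> F (x, y) = 0"
    and F_right: "\<And>x y. x_max < x \<Longrightarrow> F (x, y) = 0"
    and F_vert: "\<And>x y. y \<notin> {Y 0..<Y m} \<Longrightarrow> F (x, y) = 0"
    and F_anti: "\<And>x y x' y'. x0 \<le> x' \<Longrightarrow> x' \<le> x \<Longrightarrow> y0 \<le> y' \<Longrightarrow> y' \<le> y \<Longrightarrow> F (x, y) \<le> F (x', y')"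
begin

definition Favg :: "real \<times> real \<Rightarrow> ennreal" where
  "Favg p = slab_avg (\<lambda>t. F (fst p, t)) (snd p)"

lemma section_measurable [measurable]: "(\<lambda>t. F (x, t)) \<in> borel_measurable borel"
  using F_meas Pair_borel(1) by (rule measurable_compose_rev)

lemma F_section_anti: "Y 0 \<le> y \<Longrightarrow> y \<le> y' \<Longrightarrow> F (x, y') \<le> F (x, y)"
  using F_anti[of x x y y'] F_left[of x y'] Y0 by (cases "x0 \<le> x") auto

lemma slab_mean_measurable [measurable]: "(\<lambda>x. slab_mean (\<lambda>t. F (x, t)) j) \<in> borel_measurable borel"
proof -
  have "(\<lambda>(x, t). F (x, t) * indicator (slab j) t) \<in> borel_measurable (borel \<Otimes>\<^sub>M lborel)"
  proof -
    have "F \<in> borel_measurable (borel \<Otimes>\<^sub>M borel)" by (simp add: borel_prod)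
    then have [measurable]: "F \<in> borel_measurable (borel \<Otimes>\<^sub>M lborel)" by simp
    have "(\<lambda>p. F p * indicator (slab j) (snd p)) \<in> borel_measurable (borel \<Otimes>\<^sub>M lborel)" by measurable
    then show ?thesis by (simp add: case_prod_beta)
  qed
  from lborel.borel_measurable_nn_integral[OF this] show ?thesis
    unfolding slab_mean_def by measurable
qed

lemma Favg_measurable [measurable]: "Favg \<in> borel_measurable borel"
proof -
  have "Favg \<in> borel_measurable (borel \<Otimes>\<^sub>M borel)"
    unfolding Favg_def slab_avg_def by measurable
  then show ?thesis by (simp add: borel_prod)
qed

lemma Favg_left: "x < x0 \<Longrightarrow> Favg (x, y) = 0"
  by (simp add: Favg_def F_left slab_avg_def slab_mean_def)

lemma area_Favg_eq:
  assumes [measurable]: "T \<in> sets borel"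
    and T: "\<And>x j. x0 \<le> x \<Longrightarrow> j < m \<Longrightarrow> slab j \<subseteq> Pair x -` T \<or> Pair x -` T \<inter> slab j \<subseteq> {Y j}"
  shows "(\<integral>\<^sup>+ p\<in>T. Favg p \<partial>lborel) = (\<integral>\<^sup>+ p\<in>T. F p \<partial>lborel)"
proof -
  have "(\<integral>\<^sup>+ y\<in>(Pair x -` T). Favg (x, y) \<partial>lborel) = (\<integral>\<^sup>+ y\<in>(Pair x -` T). F (x, y) \<partial>lborel)" for x
  proof (cases "x0 \<le> x")
    case True
    show ?thesis
      unfolding Favg_def fst_conv snd_conv
      by (rule nn_integral_slab_avg_eq) (use T[OF True] F_vert Pair_vimage_borel in auto)
  qed (simp add: Favg_left F_left)
  then show ?thesis by (simp add: nn_integral_area_iterated)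
qed

lemma area_Favg_upper:
  assumes [measurable]: "T \<in> sets borel"
    and T: "\<And>x y y'. (x, y) \<in> T \<Longrightarrow> y \<le> y' \<Longrightarrow> (x, y') \<in> T"
  shows "(\<integral>\<^sup>+ p\<in>T. F p \<partial>lborel) \<le> (\<integral>\<^sup>+ p\<in>T. Favg p \<partial>lborel)"
proof -
  have "(\<integral>\<^sup>+ y\<in>(Pair x -` T). F (x, y) \<partial>lborel) \<le> (\<integral>\<^sup>+ y\<in>(Pair x -` T). Favg (x, y) \<partial>lborel)" for x
    unfolding Favg_def fst_conv snd_conv
    by (rule nn_integral_slab_avg_upper) (use T F_vert F_section_anti Pair_vimage_borel in auto)
  then show ?thesis by (simp add: nn_integral_area_iterated nn_integral_mono)
qed

text \<open>The left edge is a vertical section that the slabs exhaust, so its integral is kept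
  exactly.\<close>

lemma col_Favg: "(\<integral>\<^sup>+ p. Favg p \<partial>col_length x0 y0) = (\<integral>\<^sup>+ p. F p \<partial>col_length x0 y0)"
  unfolding nn_integral_col_length[OF F_meas] nn_integral_col_length[OF Favg_measurable]
  unfolding Favg_def fst_conv snd_conv
proof (rule nn_integral_slab_avg_eq)
  show "slab j \<subseteq> {y0..} \<or> {y0..} \<inter> slab j \<subseteq> {Y j}" if "j < m" for j
    using Y_mono[of 0 j] that Y0 by (auto simp: slab_def)
qed (use F_vert in auto)

text \<open>Along the bottom edge the value of \<open>F\<close> is replaced by a mean over the
  lowest slab, and sections are largest at \<open>y0\<close>. An inequality results, in the
  direction that the constraint allows.\<close>

lemma row_Favg: "(\<integral>\<^sup>+ p. Favg p \<partial>row_length x0 y0) \<le> (\<integral>\<^sup>+ p. F p \<partial>row_length x0 y0)"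
proof -
  have "Favg (x, y0) \<le> F (x, y0)" for x
  proof (cases "0 < m")
    case True
    then have "y0 \<in> slab 0" using slab_length[of 0] Y0 by (auto simp: slab_def)
    then have "Favg (x, y0) = slab_mean (\<lambda>t. F (x, t)) 0" using True by (simp add: Favg_def slab_avg_on)
    also have "\<dots> \<le> F (x, y0)"
      using True F_section_anti Y0 by (intro slab_mean_le) (auto simp: slab_def)
    finally show ?thesis .
  next
    case False
    then show ?thesis unfolding Favg_def slab_avg_def by simp
  qed
  then show ?thesis
    unfolding nn_integral_row_length[OF F_meas] nn_integral_row_length[OF Favg_measurable]
    by (intro nn_integral_mono mult_right_mono) auto
qed

definition level :: "real \<Rightarrow> (real \<times> real) set" where "level t = {p. ennreal t < Favg p}"

lemma level_borel [measurable]: "level t \<in> sets borel"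
  using Favg_measurable unfolding level_def by measurable

text \<open>Up to finitely many lines, a level set of the averaged density is the union over the slabs
  of rectangles anchored at \<open>(x0, y0)\<close>.\<close>
lemma level_staircase:
  assumes t: "0 < t" and mN: "m \<le> N"
  shows "emeasure lborel (level t) = 0 \<or> (\<exists>\<theta>\<in>Theta N.
    (\<forall>T\<in>sets borel. emeasure (area_on T) (Rzw N x0 y0 \<theta>) = emeasure (area_on T) (level t)) \<and>
    emeasure (col_length x0 y0) (Rzw N x0 y0 \<theta>) \<le> emeasure (col_length x0 y0) (level t) \<and>
    emeasure (row_length x0 y0) (Rzw N x0 y0 \<theta>) \<le> emeasure (row_length x0 y0) (level t))"
proof -
  \<comment> \<open>The common horizontal cross-section of the level set over slab \<open>j\<close>.
    It is a bounded interval starting at \<open>x0\<close> when nonempty, and it shrinks as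
    \<open>j\<close> grows.\<close>
  define A where "A j = {x. ennreal t < slab_mean (\<lambda>s. F (x, s)) j}" for j
  have level_on: "(x, y) \<in> level t \<longleftrightarrow> x \<in> A j" if "j < m" "y \<in> slab j" for x y j
    using that by (simp add: level_def Favg_def A_def slab_avg_on)
  have A_ge: "x0 \<le> x" if "x \<in> A j" for x j
    using that F_left[of x] by (force simp: A_def slab_mean_def not_le[symmetric])
  have A_le: "x \<le> x_max" if "x \<in> A j" for x j
    using that F_right[of x] by (force simp: A_def slab_mean_def not_le[symmetric])
  have A_down: "x' \<in> A j" if "x \<in> A j" "x0 \<le> x'" "x' \<le> x" "j < m" for x x' j
  proof -
    have "slab_mean (\<lambda>s. F (x, s)) j \<le> slab_mean (\<lambda>s. F (x', s)) j"
      unfolding slab_mean_def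
    proof (intro divide_right_mono_ennreal nn_integral_mono)
      fix s
      show "F (x, s) * indicator (slab j) s \<le> F (x', s) * indicator (slab j) s"
        using F_anti[of x' x s s] that Y0 Y_mono[of 0 j] by (auto simp: indicator_def slab_def)
    qed
    then show ?thesis using that by (auto simp: A_def)
  qed
  have A_mono: "x \<in> A i" if "x \<in> A j" "i \<le> j" "j < m" for x i j
  proof -
    have "slab_mean (\<lambda>s. F (x, s)) j \<le> slab_mean (\<lambda>s. F (x, s)) i"
      by (rule slab_mean_antimono) (use F_section_anti that in auto)
    then show ?thesis using that by (auto simp: A_def)
  qed
  \<comment> \<open>The length of that interval; whether the right end belongs to it is left open,
    which is the source of the exceptional vertical lines below.\<close>
  define d where "d j = (if A j = {} then 0 else Sup (A j) - x0)" for j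
  have bdd: "bdd_above (A j)" for j by (rule bdd_aboveI[of _ x_max]) (rule A_le)
  have d_ge: "x \<le> x0 + d j" if "x \<in> A j" for x j
    using cSup_upper[OF that bdd] that by (auto simp: d_def)
  have d_less: "x \<in> A j" if x: "x0 \<le> x" "x < x0 + d j" and j: "j < m" for x j
  proof -
    have ne: "A j \<noteq> {}" using x by (auto simp: d_def)
    then have "x < Sup (A j)" using x by (simp add: d_def)
    then obtain x' where "x' \<in> A j" "x < x'" using less_cSup_iff[OF ne bdd] by blast
    then show ?thesis using A_down[of x' j x] x j by auto
  qed
  \<comment> \<open>One corner for each slab of positive length, at the top of the slab. As the
    cross-sections shrink upwards, the rectangle from the corner down to \<open>y0\<close> is filled
    up to lines.\<close>
  define K where "K = (\<lambda>j. (d j, Y (Suc j) - y0)) ` {j \<in> {..<m}. 0 < d j}"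
  show ?thesis
  proof (cases "K = {}")
    case True
    then have d0: "d j \<le> 0" if "j < m" for j using that by (auto simp: K_def not_less[symmetric])
    have "level t \<subseteq> {p. fst p = x0}"
    proof
      fix p assume p: "p \<in> level t"
      obtain x y where xy: "p = (x, y)" by (cases p)
      have "y \<in> {Y 0..<Y m}" using p slab_avg_outside by (force simp: level_def Favg_def xy)
      then obtain j where j: "j < m" "y \<in> slab j" using slab_cover by auto
      then have "x \<in> A j" using level_on p xy by blast
      then show "p \<in> {p. fst p = x0}" using A_ge d_ge[of x j] d0[OF j(1)] xy by force
    qed
    then have "emeasure lborel (level t) \<le> emeasure lborel {p :: real \<times> real. fst p = x0}"
      by (intro emeasure_mono) (auto intro!: borel_closed closed_Collect_eq continuous_intros)
    then show ?thesis by (simp add: null_vertical_line)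
  next
    case False
    have "card K \<le> card {j \<in> {..<m}. 0 < d j}" unfolding K_def by (intro card_image_le) auto
    also have "\<dots> \<le> card {..<m}" by (intro card_mono) auto
    finally have "card K \<le> N" using mN by simp
    moreover have "K \<subseteq> {0<..} \<times> {0<..}"
      using Y_less[of 0 "Suc _"] Y0 by (auto simp: K_def)
    moreover have "finite K" by (simp add: K_def)
    ultimately obtain \<theta> where th: "\<theta> \<in> Theta N" and R_eq: "Rzw N x0 y0 \<theta>
        = {p \<in> D0 x0 y0. \<exists>(d, e)\<in>K. fst p \<le> x0 + d \<and> snd p \<le> y0 + e}"
      using Rzw_surj[of K N x0 y0] False by blast
    have N: "1 \<le> N" using \<open>card K \<le> N\<close> False \<open>finite K\<close> by (metis One_nat_def Suc_leI card_gt_0_iff le_trans)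
    define R where "R = Rzw N x0 y0 \<theta>"
    have R_borel [measurable]: "R \<in> sets borel" unfolding R_def by (rule Rzw_borel[OF th N])
    have R: "(x, y) \<in> R \<longleftrightarrow> x0 \<le> x \<and> y0 \<le> y \<and> (\<exists>j<m. 0 < d j \<and> x \<le> x0 + d j \<and> y \<le> Y (Suc j))" for x y
      unfolding R_def R_eq by (auto simp: K_def D0_def)
    have R_level: "(x, y) \<in> level t" if xy: "(x, y) \<in> R" and x: "\<forall>j<m. x \<noteq> x0 + d j" and y: "\<forall>j<m. y \<noteq> Y (Suc j)" for x y
    proof -
      obtain j where j: "j < m" "x < x0 + d j" "y < Y (Suc j)" "x0 \<le> x" "y0 \<le> y"
        using xy x y unfolding R by (metis order_le_imp_less_or_eq)
      have "y < Y m" using j Y_mono[of "Suc j" m] by auto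
      then obtain i where i: "i < m" "y \<in> slab i" using slab_cover[of y] j Y0 by auto
      have "i \<le> j" using i j Y_mono[of "Suc j" i] by (force simp: slab_def not_le[symmetric] Suc_le_eq)
      then show ?thesis using d_less[OF j(4,2,1)] A_mono[of x j i] j(1) level_on[OF i] by blast
    qed
    \<comment> \<open>The line \<open>x = x0\<close> is excluded because a cross-section may consist
      of \<open>x0\<close> alone; such a slab has length 0 and no corner in
      \<open>K\<close>.\<close>
    have level_R: "(x, y) \<in> R" if "(x, y) \<in> level t" and "x \<noteq> x0" for x y
    proof -
      have "y \<in> {Y 0..<Y m}" using that slab_avg_outside by (force simp: level_def Favg_def)
      then obtain j where j: "j < m" "y \<in> slab j" using slab_cover by auto
      then have "x \<in> A j" using level_on that by blast
      then have "x0 < x" "x \<le> x0 + d j" using A_ge d_ge that by force+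
      then show ?thesis unfolding R using j \<open>y \<in> {Y 0..<Y m}\<close> Y0 by (auto simp: slab_def intro!: exI[of _ j])
    qed
    have AE_fst: "AE p in (lborel :: (real \<times> real) measure). fst p \<noteq> v" for v :: real
      by (rule AE_I[of _ _ "{p. fst p = v}"])
        (auto simp: null_vertical_line intro!: borel_closed closed_Collect_eq continuous_intros)
    have AE_snd: "AE p in (lborel :: (real \<times> real) measure). snd p \<noteq> v" for v :: real
      by (rule AE_I[of _ _ "{p. snd p = v}"])
        (auto simp: null_horizontal_line intro!: borel_closed closed_Collect_eq continuous_intros)
    have AE_ne: "AE x in lborel. x \<noteq> v" for v :: real
      by (rule AE_lborel_singleton)
    have AE_fin: "AE x in M. \<forall>j<m. P j x" if "\<And>j. AE x in M. P j x" for P and M :: "'z measure"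
      using that by (simp add: AE_all_countable)
    have "AE p in (lborel :: (real \<times> real) measure). \<forall>j<m. fst p \<noteq> x0 + d j" by (rule AE_fin) (rule AE_fst)
    moreover have "AE p in (lborel :: (real \<times> real) measure). \<forall>j<m. snd p \<noteq> Y (Suc j)" by (rule AE_fin) (rule AE_snd)
    ultimately have "AE p in lborel. p \<in> R \<longleftrightarrow> p \<in> level t"
      using AE_fst[of x0]
    proof eventually_elim
      case (elim p)
      then show ?case using R_level[of "fst p" "snd p"] level_R[of "fst p" "snd p"] by auto
    qed
    then have "emeasure (area_on T) R = emeasure (area_on T) (level t)" if "T \<in> sets borel" for T
      unfolding emeasure_area_on[OF that R_borel] emeasure_area_on[OF that level_borel]
      using that by (intro emeasure_eq_AE) auto
    \<comment> \<open>Here only an inequality holds: slabs whose cross-section is just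
      \<open>x0\<close> count for the left edge of the level set, but not for the staircase.\<close>
    moreover have "emeasure (col_length x0 y0) R \<le> emeasure (col_length x0 y0) (level t)"
      unfolding emeasure_col_length[OF R_borel] emeasure_col_length[OF level_borel]
    proof (rule emeasure_mono_AE)
      show "AE y in lborel. y \<in> {y. y0 \<le> y \<and> (x0, y) \<in> R} \<longrightarrow> y \<in> {y. y0 \<le> y \<and> (x0, y) \<in> level t}"
      proof -
        have "AE y in lborel. \<forall>j<m. y \<noteq> Y (Suc j)" by (rule AE_fin) (rule AE_ne)
        then show ?thesis
        proof eventually_elim
          case (elim y)
          show ?case
          proof
            assume y: "y \<in> {y. y0 \<le> y \<and> (x0, y) \<in> R}"
            then obtain j where j: "j < m" "0 < d j" "y < Y (Suc j)"
              using elim unfolding R mem_Collect_eq by (metis order_le_imp_less_or_eq)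
            have "y < Y m" using j Y_mono[of "Suc j" m] by auto
            then obtain i where i: "i < m" "y \<in> slab i" using slab_cover[of y] y Y0 by auto
            have "i \<le> j" using i j Y_mono[of "Suc j" i] by (force simp: slab_def not_le[symmetric] Suc_le_eq)
            then show "y \<in> {y. y0 \<le> y \<and> (x0, y) \<in> level t}"
              using d_less[of x0 j] A_mono[of x0 j i] j level_on[OF i] y by auto
          qed
        qed
      qed
      show "{y. y0 \<le> y \<and> (x0, y) \<in> level t} \<in> sets lborel"
        using Pair_vimage_borel[OF level_borel, of x0 t] by (simp add: vimage_def Collect_conj_eq)
    qed
    moreover have "emeasure (row_length x0 y0) R \<le> emeasure (row_length x0 y0) (level t)"
      unfolding emeasure_row_length[OF R_borel] emeasure_row_length[OF level_borel]
    proof (rule emeasure_mono_AE)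
      show "AE x in lborel. x \<in> {x. x0 \<le> x \<and> (x, y0) \<in> R} \<longrightarrow> x \<in> {x. x0 \<le> x \<and> (x, y0) \<in> level t}"
      proof -
        have "AE x in lborel. \<forall>j<m. x \<noteq> x0 + d j" by (rule AE_fin) (rule AE_ne)
        then show ?thesis
        proof eventually_elim
          case (elim x)
          show ?case
          proof
            assume x: "x \<in> {x. x0 \<le> x \<and> (x, y0) \<in> R}"
            then obtain j where j: "j < m" "x < x0 + d j"
              using elim unfolding R mem_Collect_eq by (metis order_le_imp_less_or_eq)
            have "x \<in> A 0" using d_less[of x j] A_mono[of x j 0] j x by auto
            moreover have "y0 \<in> slab 0" "0 < m" using j slab_length[of 0] Y0 by (auto simp: slab_def)
            ultimately show "x \<in> {x. x0 \<le> x \<and> (x, y0) \<in> level t}" using level_on[of 0 y0 x] x by auto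
          qed
        qed
      qed
      show "{x. x0 \<le> x \<and> (x, y0) \<in> level t} \<in> sets lborel"
        using measurable_sets[OF Pair_borel(2) level_borel, of y0 t] by (simp add: vimage_def Collect_conj_eq)
    qed
    ultimately show ?thesis using th unfolding R_def by blast
  qed
qed

end

section \<open>Discretization\<close>

text \<open>Different heights may lead to the same staircase. Their weights are merged so that later
  sums run over a set of parameters.\<close>

lemma sum_collapse:
  fixes h :: "'b \<Rightarrow> ennreal" and p :: "'a \<Rightarrow> real"
  assumes "finite J" "\<And>t. 0 \<le> p t"
  shows "(\<Sum>t\<in>J. ennreal (p t) * h (\<theta> t))
    = (\<Sum>\<eta>\<in>\<theta> ` J. ennreal (\<Sum>t\<in>{t \<in> J. \<theta> t = \<eta>}. p t) * h \<eta>)"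
proof -
  have "(\<Sum>t\<in>J. ennreal (p t) * h (\<theta> t))
      = (\<Sum>\<eta>\<in>\<theta> ` J. \<Sum>t\<in>{t \<in> J. \<theta> t = \<eta>}. ennreal (p t) * h (\<theta> t))"
    by (rule sum.image_gen) fact
  also have "\<dots> = (\<Sum>\<eta>\<in>\<theta> ` J. (\<Sum>t\<in>{t \<in> J. \<theta> t = \<eta>}. ennreal (p t)) * h \<eta>)"
    unfolding sum_distrib_right by (intro sum.cong) auto
  finally show ?thesis using assms(2) by (simp add: sum_ennreal)
qed

context slab_averaging
begin

text \<open>The slab means still depend on \<open>x\<close>, so the averaged density may take
  infinitely many values and has to be cut into finitely many layers again. Staircases then replace
  the layers: area integrals survive exactly, the two edge integrals can only drop.\<close>

lemma Favg_staircase_combination: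
  assumes "finite I" and \<nu>: "\<And>i. i \<in> I \<Longrightarrow>
      (\<exists>T\<in>sets borel. \<nu> i = area_on T) \<or> \<nu> i = col_length x0 y0 \<or> \<nu> i = row_length x0 y0"
    and fin: "\<And>i. i \<in> I \<Longrightarrow> (\<integral>\<^sup>+ p. Favg p \<partial>\<nu> i) < \<infinity>" and mN: "m \<le> N"
  shows "\<exists>A p. finite A \<and> A \<subseteq> Theta N \<and> (\<forall>\<eta>. 0 \<le> p \<eta>) \<and> (\<forall>i\<in>I.
    (\<Sum>\<eta>\<in>A. ennreal (p \<eta>) * emeasure (\<nu> i) (Rzw N x0 y0 \<eta>)) \<le> (\<integral>\<^sup>+ p. Favg p \<partial>\<nu> i) \<and>
    ((\<exists>T\<in>sets borel. \<nu> i = area_on T) \<longrightarrow>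
      (\<Sum>\<eta>\<in>A. ennreal (p \<eta>) * emeasure (\<nu> i) (Rzw N x0 y0 \<eta>)) = (\<integral>\<^sup>+ p. Favg p \<partial>\<nu> i)))"
proof -
  have sets: "sets (\<nu> i) = sets borel" and space: "space (\<nu> i) = UNIV"
    and sf: "sigma_finite_measure (\<nu> i)" if "i \<in> I" for i
    using \<nu>[OF that] sigma_finite_area_on sigma_finite_col_length sigma_finite_row_length by auto
  have meas: "Favg \<in> borel_measurable (\<nu> i)" if "i \<in> I" for i
    using Favg_measurable measurable_cong_sets[OF sets[OF that] refl] by blast
  have "\<exists>J w. finite J \<and> J \<subseteq> {0<..} \<and> (\<forall>t. 0 \<le> w t) \<and>
    (\<forall>i\<in>I. (\<Sum>t\<in>J. ennreal (w t) * emeasure (\<nu> i) {p \<in> space (\<nu> i). ennreal t < Favg p})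
       = (\<integral>\<^sup>+ p. Favg p \<partial>\<nu> i))"
    by (rule finite_layers[OF assms(1) sf meas fin])
  then obtain J w where J: "finite J" "J \<subseteq> {0<..}" "\<forall>t. 0 \<le> w t" and layers:
    "\<forall>i\<in>I. (\<Sum>t\<in>J. ennreal (w t) * emeasure (\<nu> i) {p \<in> space (\<nu> i). ennreal t < Favg p})
       = (\<integral>\<^sup>+ p. Favg p \<partial>\<nu> i)"
    by (elim exE conjE)
  then have layers: "(\<Sum>t\<in>J. ennreal (w t) * emeasure (\<nu> i) (level t)) = (\<integral>\<^sup>+ p. Favg p \<partial>\<nu> i)"
    if "i \<in> I" for i
    using that space by (simp add: level_def)
  \<comment> \<open>Layers of area zero have no staircase. Omitting them changes no area integral
    and can only lower the edge integrals.\<close>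
  define J' where "J' = {t \<in> J. emeasure lborel (level t) \<noteq> 0}"
  have "\<forall>t\<in>J'. \<exists>\<theta>. \<theta> \<in> Theta N \<and>
    (\<forall>T\<in>sets borel. emeasure (area_on T) (Rzw N x0 y0 \<theta>) = emeasure (area_on T) (level t)) \<and>
    emeasure (col_length x0 y0) (Rzw N x0 y0 \<theta>) \<le> emeasure (col_length x0 y0) (level t) \<and>
    emeasure (row_length x0 y0) (Rzw N x0 y0 \<theta>) \<le> emeasure (row_length x0 y0) (level t)"
  proof
    fix t assume "t \<in> J'"
    then have "0 < t" "emeasure lborel (level t) \<noteq> 0" using J by (auto simp: J'_def)
    then show "\<exists>\<theta>. \<theta> \<in> Theta N \<and>
      (\<forall>T\<in>sets borel. emeasure (area_on T) (Rzw N x0 y0 \<theta>) = emeasure (area_on T) (level t)) \<and>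
      emeasure (col_length x0 y0) (Rzw N x0 y0 \<theta>) \<le> emeasure (col_length x0 y0) (level t) \<and>
      emeasure (row_length x0 y0) (Rzw N x0 y0 \<theta>) \<le> emeasure (row_length x0 y0) (level t)"
      using level_staircase[OF \<open>0 < t\<close> mN] by blast
  qed
  then have "\<exists>\<theta>. \<forall>t\<in>J'. \<theta> t \<in> Theta N \<and>
    (\<forall>T\<in>sets borel. emeasure (area_on T) (Rzw N x0 y0 (\<theta> t)) = emeasure (area_on T) (level t)) \<and>
    emeasure (col_length x0 y0) (Rzw N x0 y0 (\<theta> t)) \<le> emeasure (col_length x0 y0) (level t) \<and>
    emeasure (row_length x0 y0) (Rzw N x0 y0 (\<theta> t)) \<le> emeasure (row_length x0 y0) (level t)"
    by (rule bchoice)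
  then obtain \<theta> where stair: "\<forall>t\<in>J'. \<theta> t \<in> Theta N \<and>
    (\<forall>T\<in>sets borel. emeasure (area_on T) (Rzw N x0 y0 (\<theta> t)) = emeasure (area_on T) (level t)) \<and>
    emeasure (col_length x0 y0) (Rzw N x0 y0 (\<theta> t)) \<le> emeasure (col_length x0 y0) (level t) \<and>
    emeasure (row_length x0 y0) (Rzw N x0 y0 (\<theta> t)) \<le> emeasure (row_length x0 y0) (level t)" ..
  have \<theta>: "\<theta> t \<in> Theta N"
    and area: "\<And>T. T \<in> sets borel \<Longrightarrow>
      emeasure (area_on T) (Rzw N x0 y0 (\<theta> t)) = emeasure (area_on T) (level t)"
    and col: "emeasure (col_length x0 y0) (Rzw N x0 y0 (\<theta> t)) \<le> emeasure (col_length x0 y0) (level t)"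
    and row: "emeasure (row_length x0 y0) (Rzw N x0 y0 (\<theta> t)) \<le> emeasure (row_length x0 y0) (level t)"
    if "t \<in> J'" for t
    using stair[rule_format, OF that] by blast+
  define p where "p \<eta> = (\<Sum>t\<in>{t \<in> J'. \<theta> t = \<eta>}. w t)" for \<eta>
  have finJ': "finite J'" using J by (simp add: J'_def)
  have collapse: "(\<Sum>\<eta>\<in>\<theta> ` J'. ennreal (p \<eta>) * emeasure (\<nu> i) (Rzw N x0 y0 \<eta>))
      = (\<Sum>t\<in>J'. ennreal (w t) * emeasure (\<nu> i) (Rzw N x0 y0 (\<theta> t)))" for i
    unfolding p_def using sum_collapse[OF finJ', of w "\<lambda>\<eta>. emeasure (\<nu> i) (Rzw N x0 y0 \<eta>)" \<theta>] J by simp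
  have le: "(\<Sum>t\<in>J'. ennreal (w t) * emeasure (\<nu> i) (Rzw N x0 y0 (\<theta> t))) \<le> (\<integral>\<^sup>+ p. Favg p \<partial>\<nu> i)"
    if i: "i \<in> I" for i
  proof -
    have "(\<Sum>t\<in>J'. ennreal (w t) * emeasure (\<nu> i) (Rzw N x0 y0 (\<theta> t)))
        \<le> (\<Sum>t\<in>J'. ennreal (w t) * emeasure (\<nu> i) (level t))"
    proof (intro sum_mono mult_left_mono)
      fix t assume "t \<in> J'"
      then show "emeasure (\<nu> i) (Rzw N x0 y0 (\<theta> t)) \<le> emeasure (\<nu> i) (level t)"
        using \<nu>[OF i] area col row by auto
    qed simp
    also have "\<dots> \<le> (\<Sum>t\<in>J. ennreal (w t) * emeasure (\<nu> i) (level t))"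
      using J by (intro sum_mono2) (auto simp: J'_def)
    finally show ?thesis using layers[OF i] by simp
  qed
  have eq: "(\<Sum>t\<in>J'. ennreal (w t) * emeasure (\<nu> i) (Rzw N x0 y0 (\<theta> t))) = (\<integral>\<^sup>+ p. Favg p \<partial>\<nu> i)"
    if i: "i \<in> I" and T: "T \<in> sets borel" "\<nu> i = area_on T" for i T
  proof -
    have null: "emeasure (\<nu> i) (level t) = 0" if "t \<in> J - J'" for t
    proof -
      have "emeasure (\<nu> i) (level t) \<le> emeasure lborel (level t)"
        using T by (auto simp: emeasure_area_on intro!: emeasure_mono)
      then show ?thesis using that by (simp add: J'_def)
    qed
    have "(\<Sum>t\<in>J'. ennreal (w t) * emeasure (\<nu> i) (Rzw N x0 y0 (\<theta> t)))
        = (\<Sum>t\<in>J'. ennreal (w t) * emeasure (\<nu> i) (level t))"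
      using area T by (intro sum.cong) auto
    also have "\<dots> = (\<Sum>t\<in>J. ennreal (w t) * emeasure (\<nu> i) (level t))"
      using J null by (intro sum.mono_neutral_left) (auto simp: J'_def)
    finally show ?thesis using layers[OF i] by simp
  qed
  show ?thesis
  proof (intro exI[of _ "\<theta> ` J'"] exI[of _ p] conjI ballI impI)
    show "\<forall>\<eta>. 0 \<le> p \<eta>" using J by (auto simp: p_def intro: sum_nonneg)
    show "(\<Sum>\<eta>\<in>\<theta> ` J'. ennreal (p \<eta>) * emeasure (\<nu> i) (Rzw N x0 y0 \<eta>)) = (\<integral>\<^sup>+ p. Favg p \<partial>\<nu> i)"
      if "i \<in> I" "\<exists>T\<in>sets borel. \<nu> i = area_on T" for i
      using that eq collapse by auto
  qed (use finJ' \<theta> le collapse in auto)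
qed

end

text \<open>Replacing \<open>f\<close> by finitely many of its layers makes the support bounded, which is what allows
  averaging over the topmost, otherwise unbounded, horizontal slab.\<close>
lemma bounded_simple_density:
  fixes \<nu> :: "'i \<Rightarrow> (real \<times> real) measure" and f :: "real \<times> real \<Rightarrow> ennreal"
  assumes I: "finite I" and sf: "\<And>i. i \<in> I \<Longrightarrow> sigma_finite_measure (\<nu> i)"
    and sets: "\<And>i. i \<in> I \<Longrightarrow> sets (\<nu> i) = sets borel"
    and f: "f \<in> borel_measurable borel" and zero: "\<And>p. p \<notin> D0 x0 y0 \<Longrightarrow> f p = 0"
    and fin: "\<And>i. i \<in> I \<Longrightarrow> (\<integral>\<^sup>+ p. f p \<partial>\<nu> i) < \<infinity>"
    and anti: "\<And>x y x' y'. x0 \<le> x' \<Longrightarrow> x' \<le> x \<Longrightarrow> y0 \<le> y' \<Longrightarrow> y' \<le> y \<Longrightarrow> f (x, y) \<le> f (x', y')"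
    and uX: "(\<integral>\<^sup>+ p. f p \<partial>col_length x0 y0) \<le> ennreal uX" "0 \<le> uX"
    and uY: "(\<integral>\<^sup>+ p. f p \<partial>row_length x0 y0) \<le> ennreal uY" "0 \<le> uY"
  obtains F Yt xm where "F \<in> borel_measurable borel" "y0 < Yt" "\<And>p. p \<notin> D0 x0 y0 \<Longrightarrow> F p = 0"
    "\<And>x y. xm < x \<Longrightarrow> F (x, y) = 0" "\<And>x y. Yt \<le> y \<Longrightarrow> F (x, y) = 0"
    "\<And>x y x' y'. x0 \<le> x' \<Longrightarrow> x' \<le> x \<Longrightarrow> y0 \<le> y' \<Longrightarrow> y' \<le> y \<Longrightarrow> F (x, y) \<le> F (x', y')"
    "\<And>i. i \<in> I \<Longrightarrow> (\<integral>\<^sup>+ p. F p \<partial>\<nu> i) = (\<integral>\<^sup>+ p. f p \<partial>\<nu> i)"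
proof -
  note f [measurable]
  have space: "space (\<nu> i) = UNIV" if "i \<in> I" for i
    using sets_eq_imp_space_eq[OF sets[OF that]] by simp
  have f\<nu>: "f \<in> borel_measurable (\<nu> i)" if "i \<in> I" for i
    using f measurable_cong_sets[OF sets[OF that] refl] by blast
  define L where "L t = {p. ennreal t < f p}" for t
  have L_borel [measurable]: "L t \<in> sets borel" for t unfolding L_def by measurable
  have "\<exists>J w. finite J \<and> J \<subseteq> {0<..} \<and> (\<forall>t. 0 \<le> w t) \<and>
    (\<forall>i\<in>I. (\<Sum>t\<in>J. ennreal (w t) * emeasure (\<nu> i) {p \<in> space (\<nu> i). ennreal t < f p})
       = (\<integral>\<^sup>+ p. f p \<partial>\<nu> i))"
    by (rule finite_layers[OF I sf f\<nu> fin])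
  then obtain J w where J: "finite J" "J \<subseteq> {0<..}" "\<forall>t. 0 \<le> w t" and
    "\<forall>i\<in>I. (\<Sum>t\<in>J. ennreal (w t) * emeasure (\<nu> i) {p \<in> space (\<nu> i). ennreal t < f p})
       = (\<integral>\<^sup>+ p. f p \<partial>\<nu> i)"
    by (elim exE conjE)
  then have layers: "(\<Sum>t\<in>J. ennreal (w t) * emeasure (\<nu> i) (L t)) = (\<integral>\<^sup>+ p. f p \<partial>\<nu> i)" if "i \<in> I" for i
    using that space by (simp add: L_def)
  \<comment> \<open>Each layer is closed towards the corner, so \<open>F\<close> is again
    decreasing, and the weights were chosen to give it the same integrals.\<close>
  define F where "F p = (\<Sum>t\<in>J. ennreal (w t) * indicator (L t) p)" for p
  have D: "x0 \<le> x" "y0 \<le> y" if "(x, y) \<in> L t" for x y t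
  proof -
    have "f (x, y) \<noteq> 0" using that by (auto simp: L_def)
    then have "(x, y) \<in> D0 x0 y0" using zero by blast
    then show "x0 \<le> x" "y0 \<le> y" by (auto simp: D0_def)
  qed
  have L_down: "(x', y') \<in> L t" if "(x, y) \<in> L t" "x0 \<le> x'" "x' \<le> x" "y0 \<le> y'" "y' \<le> y" for x y x' y' t
    using that anti[of x' x y' y] by (auto simp: L_def)
  have bound: "v \<le> u / t"
    if "0 < t" "0 \<le> v" "0 \<le> u" "ennreal t * e \<le> ennreal u" "ennreal v \<le> e" for t u v e
  proof -
    have "ennreal (t * v) = ennreal t * ennreal v" using that by (simp add: ennreal_mult)
    also have "\<dots> \<le> ennreal t * e" using that by (intro mult_left_mono) auto
    also have "\<dots> \<le> ennreal u" by fact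
    finally show ?thesis using that by (simp add: field_simps)
  qed
  \<comment> \<open>A layer containing \<open>(x, y)\<close> contains the segment from
    \<open>(x0, y0)\<close> to \<open>(x0, y)\<close>. Markov's inequality on the left edge bounds
    its length by \<open>uX / t\<close>.\<close>
  have L_y: "y - y0 \<le> uX / t" if "0 < t" "(x, y) \<in> L t" for x y t
  proof (rule bound)
    show "ennreal t * emeasure (col_length x0 y0) (L t) \<le> ennreal uX"
      using emeasure_layer_le[of f "col_length x0 y0" t] uX(1) by (simp add: L_def)
    have "{y0..y} \<subseteq> {y. y0 \<le> y \<and> (x0, y) \<in> L t}"
      using L_down[OF that(2), of x0] D[OF that(2)] by auto
    moreover have "{y. y0 \<le> y \<and> (x0, y) \<in> L t} \<in> sets borel"
      using Pair_vimage_borel[OF L_borel, of x0 t] by (simp add: vimage_def Collect_conj_eq)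
    ultimately have "emeasure lborel {y0..y} \<le> emeasure (col_length x0 y0) (L t)"
      unfolding emeasure_col_length[OF L_borel] by (intro emeasure_mono) auto
    then show "ennreal (y - y0) \<le> emeasure (col_length x0 y0) (L t)" using D[OF that(2)] by simp
  qed (use that D[OF that(2)] uX in auto)
  have L_x: "x - x0 \<le> uY / t" if "0 < t" "(x, y) \<in> L t" for x y t
  proof (rule bound)
    show "ennreal t * emeasure (row_length x0 y0) (L t) \<le> ennreal uY"
      using emeasure_layer_le[of f "row_length x0 y0" t] uY(1) by (simp add: L_def)
    have "{x0..x} \<subseteq> {x. x0 \<le> x \<and> (x, y0) \<in> L t}"
      using L_down[OF that(2), of _ y0] D[OF that(2)] by auto
    moreover have "{x. x0 \<le> x \<and> (x, y0) \<in> L t} \<in> sets borel"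
      using measurable_sets[OF Pair_borel(2) L_borel, of y0 t] by (simp add: vimage_def Collect_conj_eq)
    ultimately have "emeasure lborel {x0..x} \<le> emeasure (row_length x0 y0) (L t)"
      unfolding emeasure_row_length[OF L_borel] by (intro emeasure_mono) auto
    then show "ennreal (x - x0) \<le> emeasure (row_length x0 y0) (L t)" using D[OF that(2)] by simp
  qed (use that D[OF that(2)] uY in auto)
  \<comment> \<open>The summand 1 makes the strip nonempty and lets \<open>F\<close> vanish already
    at height \<open>Yt\<close>, as half-open slabs require.\<close>
  define Yt where "Yt = y0 + 1 + (\<Sum>t\<in>J. uX / t)"
  define xm where "xm = x0 + (\<Sum>t\<in>J. uY / t)"
  have Jpos: "0 < t" if "t \<in> J" for t using J that by auto
  have sum_ge: "u / t \<le> (\<Sum>t\<in>J. u / t)" if "t \<in> J" "0 \<le> u" for t and u :: real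
    using that J Jpos by (intro member_le_sum) (auto intro!: divide_nonneg_pos)
  show thesis
  proof (rule that[of F Yt xm])
    show "F \<in> borel_measurable borel" unfolding F_def by measurable
    have "0 \<le> (\<Sum>t\<in>J. uX / t)" using Jpos uX by (intro sum_nonneg divide_nonneg_pos) auto
    then show "y0 < Yt" by (simp add: Yt_def)
    show "F p = 0" if "p \<notin> D0 x0 y0" for p
      using zero[OF that] by (simp add: F_def L_def)
    show "F (x, y) = 0" if "xm < x" for x y
    proof -
      have "(x, y) \<notin> L t" if "t \<in> J" for t
        using L_x[OF Jpos[OF that], of x y] sum_ge[OF that uY(2)] \<open>xm < x\<close> by (auto simp: xm_def)
      then show ?thesis by (simp add: F_def)
    qed
    show "F (x, y) = 0" if "Yt \<le> y" for x y
    proof -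
      have "(x, y) \<notin> L t" if "t \<in> J" for t
        using L_y[OF Jpos[OF that], of x y] sum_ge[OF that uX(2)] \<open>Yt \<le> y\<close> by (auto simp: Yt_def)
      then show ?thesis by (simp add: F_def)
    qed
    show "F (x, y) \<le> F (x', y')" if "x0 \<le> x'" "x' \<le> x" "y0 \<le> y'" "y' \<le> y" for x y x' y'
      unfolding F_def using L_down[OF _ that]
      by (intro sum_mono mult_left_mono) (auto simp: indicator_def)
    show "(\<integral>\<^sup>+ p. F p \<partial>\<nu> i) = (\<integral>\<^sup>+ p. f p \<partial>\<nu> i)" if "i \<in> I" for i
    proof -
      have [measurable]: "L t \<in> sets (\<nu> i)" for t using sets[OF that] by simp
      have "(\<integral>\<^sup>+ p. F p \<partial>\<nu> i) = (\<Sum>t\<in>J. ennreal (w t) * emeasure (\<nu> i) (L t))"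
        unfolding F_def by (subst nn_integral_sum) (auto simp: nn_integral_cmult)
      then show ?thesis using layers[OF that] by simp
    qed
  qed
qed

text \<open>The direction from the density problem to (III). Here \<open>c\<close> is the actual
  mass of \<open>f\<close>, whatever the mass condition, so one lemma covers a prescribed mass and
  an interval of masses.\<close>

lemma ou_dominated_by_III:
  assumes c: "0 < c" and uX: "0 \<le> uX" and uY: "0 \<le> uY"
    and ab: "\<forall>k\<in>{1..n}. 0 \<le> a k \<and> a k \<le> b k"
    and g: "g \<in> borel_measurable (restrict_space borel {x0..})"
    and feas: "ou_feasible x0 y0 n x1 x2 y1 y2 a b uX uY massOK f"
    and mass: "(\<integral>\<^sup>+ p\<in>D0 x0 y0. f p \<partial>lborel) = ennreal c"
  shows "\<exists>Q. III_feasible x0 y0 n x1 x2 y1 y2 a b uX uY c Q \<and>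
    enn2ereal (\<integral>\<^sup>+ p\<in>Sg x0 y0 g. f p \<partial>lborel) \<le> II_obj x0 y0 n (Sg x0 y0 g) c Q"
proof -
  define N where "N = 12 * n + 3"
  have N1: "1 \<le> N" by (simp add: N_def)

  \<comment> \<open>The constraint integrals and the objective as integrals against measures\<close>
  define S where "S = Sg x0 y0 g"
  define Bx where "Bx k = Box x0 y0 (x1 k) (x2 k) (y1 k) (y2 k)" for k
  have [measurable]: "S \<in> sets borel" unfolding S_def using g by (rule Sg_borel)
  have [measurable]: "Bx k \<in> sets borel" for k by (simp add: Bx_def)
  \<comment> \<open>Index 0 is the mass, \<open>1..n\<close> the boxes, \<open>n + 1\<close> and
    \<open>n + 2\<close> the two edges, \<open>n + 3\<close> the objective.\<close>
  define \<nu> where "\<nu> i = (if i = 0 then area_on (D0 x0 y0) else if i \<le> n then area_on (Bx i)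
      else if i = n + 1 then col_length x0 y0 else if i = n + 2 then row_length x0 y0
      else area_on S)" for i
  have \<nu>0: "\<nu> 0 = area_on (D0 x0 y0)" by (simp add: \<nu>_def)
  have \<nu>k: "\<nu> k = area_on (Bx k)" if "k \<in> {1..n}" for k using that by (simp add: \<nu>_def)
  have \<nu>col: "\<nu> (n + 1) = col_length x0 y0" by (simp add: \<nu>_def)
  have \<nu>row: "\<nu> (n + 2) = row_length x0 y0" by (simp add: \<nu>_def)
  have \<nu>S: "\<nu> (n + 3) = area_on S" by (simp add: \<nu>_def)
  have \<nu>_cases: "(\<exists>T\<in>sets borel. \<nu> i = area_on T) \<or> \<nu> i = col_length x0 y0 \<or> \<nu> i = row_length x0 y0" for i
  proof -
    have area: "\<exists>T'\<in>sets borel. area_on T = area_on T'" if "T \<in> sets borel" for T using that by blast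
    show ?thesis unfolding \<nu>_def using area[of "D0 x0 y0"] area[of "Bx i"] area[of S] by simp
  qed
  have sets: "sets (\<nu> i) = sets borel" for i by (simp add: \<nu>_def)
  have sf: "sigma_finite_measure (\<nu> i)" for i
    using \<nu>_cases[of i] sigma_finite_area_on sigma_finite_col_length sigma_finite_row_length by auto
  have idx: "i = 0 \<or> i \<in> {1..n} \<or> i = n + 1 \<or> i = n + 2 \<or> i = n + 3" if "i \<in> {..n+3}" for i
    using that by auto

  \<comment> \<open>Integrals of the given density, extended by zero to the plane\<close>
  define f0 where "f0 p = f p * indicator (D0 x0 y0) p" for p
  have "f \<in> borel_measurable (restrict_space lborel (D0 x0 y0))" using feas by (simp add: ou_feasible_def)
  then have f0 [measurable]: "f0 \<in> borel_measurable borel"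
    unfolding f0_def using borel_measurable_restrict_space_iff_ennreal[of "D0 x0 y0" lborel f] by simp
  define V where "V i = (\<integral>\<^sup>+ p. f0 p \<partial>\<nu> i)" for i
  have area_f0: "(\<integral>\<^sup>+ p. f0 p \<partial>area_on T) = (\<integral>\<^sup>+ p\<in>T. f p \<partial>lborel)"
    if T [measurable]: "T \<in> sets borel" and sub: "T \<subseteq> D0 x0 y0" for T
  proof -
    have "(\<integral>\<^sup>+ p. f0 p \<partial>area_on T) = (\<integral>\<^sup>+ p\<in>T. f0 p \<partial>lborel)" by (rule nn_integral_area_on) measurable
    also have "\<dots> = (\<integral>\<^sup>+ p\<in>T. f p \<partial>lborel)"
      using sub by (intro nn_integral_cong) (auto simp: f0_def indicator_def)
    finally show ?thesis .
  qed
  have sub: "S \<subseteq> D0 x0 y0" "Bx k \<subseteq> D0 x0 y0" for k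
    by (auto simp: S_def Sg_def Bx_def Box_def)
  have V0: "V 0 = ennreal c" unfolding V_def \<nu>0 using area_f0[of "D0 x0 y0"] mass by simp
  have Vk: "V k = (\<integral>\<^sup>+ p\<in>Bx k. f p \<partial>lborel)" if "k \<in> {1..n}" for k
    unfolding V_def \<nu>k[OF that] by (rule area_f0) (use sub in auto)
  have VS: "V (n + 3) = (\<integral>\<^sup>+ p\<in>S. f p \<partial>lborel)"
    unfolding V_def \<nu>S by (rule area_f0) (use sub in auto)
  have Vcol: "V (n + 1) \<le> ennreal uX"
  proof -
    have "V (n + 1) = (\<integral>\<^sup>+ y\<in>{y0..}. f (x0, y) \<partial>lborel)"
      unfolding V_def \<nu>col nn_integral_col_length[OF f0]
      by (intro nn_integral_cong) (auto simp: f0_def D0_def indicator_def)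
    then show ?thesis using feas by (simp add: ou_feasible_def)
  qed
  have Vrow: "V (n + 2) \<le> ennreal uY"
  proof -
    have "V (n + 2) = (\<integral>\<^sup>+ x\<in>{x0..}. f (x, y0) \<partial>lborel)"
      unfolding V_def \<nu>row nn_integral_row_length[OF f0]
      by (intro nn_integral_cong) (auto simp: f0_def D0_def indicator_def)
    then show ?thesis using feas by (simp add: ou_feasible_def)
  qed
  have VT_le: "(\<integral>\<^sup>+ p\<in>T. f p \<partial>lborel) \<le> ennreal c" if "T \<subseteq> D0 x0 y0" for T
    unfolding mass[symmetric] using that by (intro nn_integral_mono) (auto simp: indicator_def)
  have Vfin: "V i < \<infinity>" if "i \<in> {..n+3}" for i
  proof -
    have "\<exists>u. V i \<le> ennreal u"
      using idx[OF that]
    proof (elim disjE)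
      assume "i \<in> {1..n}"
      then show ?thesis using Vk VT_le[OF sub(2)] by metis
    qed (use V0 VS VT_le[OF sub(1)] Vcol Vrow in \<open>auto intro: exI[of _ c] exI[of _ uX] exI[of _ uY]\<close>)
    then show ?thesis using ennreal_less_top le_less_trans by (metis infinity_ennreal_def)
  qed
  have f0_anti: "f0 (x, y) \<le> f0 (x', y')" if "x0 \<le> x'" "x' \<le> x" "y0 \<le> y'" "y' \<le> y" for x y x' y'
    using feas that by (auto simp: ou_feasible_def f0_def D0_def indicator_def)

  \<comment> \<open>Passage to a density of bounded support\<close>
  obtain F Yt xm where F [measurable]: "F \<in> borel_measurable borel" and Yt: "y0 < Yt"
    and F0: "\<And>p. p \<notin> D0 x0 y0 \<Longrightarrow> F p = 0"
    and Fx: "\<And>x y. xm < x \<Longrightarrow> F (x, y) = 0" and Fy: "\<And>x y. Yt \<le> y \<Longrightarrow> F (x, y) = 0"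
    and F_anti: "\<And>x y x' y'. x0 \<le> x' \<Longrightarrow> x' \<le> x \<Longrightarrow> y0 \<le> y' \<Longrightarrow> y' \<le> y \<Longrightarrow> F (x, y) \<le> F (x', y')"
    and FV: "\<And>i. i \<in> {..n+3} \<Longrightarrow> (\<integral>\<^sup>+ p. F p \<partial>\<nu> i) = V i"
  proof (rule bounded_simple_density[of "{..n+3}" \<nu> f0 x0 y0 uX uY])
    show "(\<integral>\<^sup>+ p. f0 p \<partial>col_length x0 y0) \<le> ennreal uX" using Vcol by (simp only: V_def \<nu>col)
    show "(\<integral>\<^sup>+ p. f0 p \<partial>row_length x0 y0) \<le> ennreal uY" using Vrow by (simp only: V_def \<nu>row)
    show "f0 p = 0" if "p \<notin> D0 x0 y0" for p using that by (simp add: f0_def)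
    show "(\<integral>\<^sup>+ p. f0 p \<partial>\<nu> i) < \<infinity>" if "i \<in> {..n+3}" for i
      using Vfin[OF that] unfolding V_def .
    fix F Yt xm
    assume F: "F \<in> borel_measurable borel" "y0 < Yt" "\<And>p. p \<notin> D0 x0 y0 \<Longrightarrow> F p = 0"
      "\<And>x y. xm < x \<Longrightarrow> F (x, y) = 0" "\<And>x y. Yt \<le> y \<Longrightarrow> F (x, y) = 0"
      "\<And>x y x' y'. x0 \<le> x' \<Longrightarrow> x' \<le> x \<Longrightarrow> y0 \<le> y' \<Longrightarrow> y' \<le> y \<Longrightarrow> F (x, y) \<le> F (x', y')"
      and F_int: "\<And>i. i \<in> {..n+3} \<Longrightarrow> (\<integral>\<^sup>+ p. F p \<partial>\<nu> i) = (\<integral>\<^sup>+ p. f0 p \<partial>\<nu> i)"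
    show thesis
    proof (rule that[OF F])
      show "(\<integral>\<^sup>+ p. F p \<partial>\<nu> i) = V i" if "i \<in> {..n+3}" for i
        using F_int[OF that] by (simp only: V_def)
    qed
  qed (use sf sets f0 f0_anti uX uY in simp_all)

  \<comment> \<open>The grid of horizontal box edges\<close>
  define E where "E = y1 ` {1..n} \<union> y2 ` {1..n}"
  have finE: "finite E" by (simp add: E_def)
  have "card E \<le> card (y1 ` {1..n}) + card (y2 ` {1..n})" unfolding E_def by (rule card_Un_le)
  also have "\<dots> \<le> n + n"
    using card_image_le[of "{1..n}" y1] card_image_le[of "{1..n}" y2] by (intro add_mono) auto
  finally have cardE: "card E \<le> 2 * n" by simp
  obtain Y m where sl: "slabs Y m" and Y0: "Y 0 = y0" and Ym: "Y m = Yt" and m: "m \<le> card E + 1"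
    and grid: "\<forall>e\<in>E. \<forall>j<m. e \<le> ereal (Y j) \<or> ereal (Y (Suc j)) \<le> e"
    using grid_exists[OF finE Yt] by blast
  interpret slabs Y m by (rule sl)
  interpret slab_averaging Y m F x0 y0 xm
  proof
    show "F (x, y) = 0" if "x < x0" for x y using F0[of "(x, y)"] that by (simp add: D0_def)
    show "F (x, y) = 0" if "y \<notin> {Y 0..<Y m}" for x y
      using F0[of "(x, y)"] Fy[of y x] that Y0 Ym by (auto simp: D0_def not_le)
  qed (use F Y0 Fx F_anti in auto)
  \<comment> \<open>The \<open>2 * n\<close> horizontal edges give at most \<open>2 * n + 1\<close>
    slabs, hence at most that many steps, within the \<open>12 * n + 3\<close> available.\<close>
  have mN: "m \<le> N" using m cardE by (simp add: N_def)

  \<comment> \<open>The effect of averaging on each integral\<close>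
  define W where "W i = (\<integral>\<^sup>+ p. Favg p \<partial>\<nu> i)" for i
  have W_area: "W i = (\<integral>\<^sup>+ p\<in>T. Favg p \<partial>lborel)" and V_area: "V i = (\<integral>\<^sup>+ p\<in>T. F p \<partial>lborel)"
    if "\<nu> i = area_on T" "T \<in> sets borel" "i \<in> {..n+3}" for i T
    using FV[OF that(3)] nn_integral_area_on[OF that(2) Favg_measurable] nn_integral_area_on[OF that(2) F]
    by (simp_all add: W_def that(1))
  have W0: "W 0 = V 0"
  proof -
    have "(\<integral>\<^sup>+ p\<in>D0 x0 y0. Favg p \<partial>lborel) = (\<integral>\<^sup>+ p\<in>D0 x0 y0. F p \<partial>lborel)"
    proof (rule area_Favg_eq)
      show "slab j \<subseteq> Pair x -` D0 x0 y0 \<or> Pair x -` D0 x0 y0 \<inter> slab j \<subseteq> {Y j}"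
        if "x0 \<le> x" "j < m" for x j
        using Y_mono[of 0 j] that Y0 by (auto simp: slab_def D0_def)
    qed measurable
    then show ?thesis using W_area[OF \<nu>0] V_area[OF \<nu>0] by simp
  qed
  have Wk: "W k = V k" if k: "k \<in> {1..n}" for k
  proof -
    have "(\<integral>\<^sup>+ p\<in>Bx k. Favg p \<partial>lborel) = (\<integral>\<^sup>+ p\<in>Bx k. F p \<partial>lborel)"
    proof (rule area_Favg_eq)
      fix x j assume x: "x0 \<le> x" and j: "j < m"
      show "slab j \<subseteq> Pair x -` Bx k \<or> Pair x -` Bx k \<inter> slab j \<subseteq> {Y j}"
      proof (cases "x1 k \<le> ereal x \<and> ereal x \<le> x2 k")
        case False
        then show ?thesis by (auto simp: Bx_def Box_def)
      next
        case True
        have y0j: "y0 \<le> Y j" using Y_mono[of 0 j] j Y0 by simp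
        have "y1 k \<in> E" "y2 k \<in> E" using k by (auto simp: E_def)
        \<comment> \<open>Slab \<open>j\<close> lies below the box, above it, or between its
          horizontal edges; in the second case the box can meet the slab only in
          \<open>Y j\<close>.\<close>
        then consider "ereal (Y (Suc j)) \<le> y1 k" | "y2 k \<le> ereal (Y j)"
          | "y1 k \<le> ereal (Y j)" "ereal (Y (Suc j)) \<le> y2 k"
          using grid j by blast
        then show ?thesis
        proof cases
          case 1
          have "y \<notin> slab j" if "y \<in> Pair x -` Bx k" for y
          proof -
            have "y1 k \<le> ereal y" using that by (simp add: Bx_def Box_def)
            then have "ereal (Y (Suc j)) \<le> ereal y" using 1 by (rule order_trans[rotated])
            then show ?thesis by (simp add: slab_def)
          qed
          then show ?thesis by blast
        next
          case 2
          have "y = Y j" if "y \<in> Pair x -` Bx k \<inter> slab j" for y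
          proof -
            have "ereal y \<le> y2 k" using that by (simp add: Bx_def Box_def)
            then have "ereal y \<le> ereal (Y j)" using 2 by (rule order_trans)
            then show ?thesis using that by (simp add: slab_def)
          qed
          then show ?thesis by blast
        next
          case 3
          have "y \<in> Pair x -` Bx k" if "y \<in> slab j" for y
          proof -
            have "ereal (Y j) \<le> ereal y" "ereal y \<le> ereal (Y (Suc j))" using that by (auto simp: slab_def)
            then have "y1 k \<le> ereal y" "ereal y \<le> y2 k" using 3 by (blast intro: order_trans)+
            moreover have "y0 \<le> y" using y0j that by (simp add: slab_def)
            ultimately show ?thesis using True x by (simp add: Bx_def Box_def D0_def)
          qed
          then show ?thesis by blast
        qed
      qed
    qed measurable
    then show ?thesis using W_area[OF \<nu>k[OF k]] V_area[OF \<nu>k[OF k]] k by simp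
  qed
  have Wcol: "W (n + 1) = V (n + 1)" using col_Favg FV[of "n + 1"] unfolding W_def \<nu>col by simp
  have Wrow: "W (n + 2) \<le> V (n + 2)" using row_Favg FV[of "n + 2"] unfolding W_def \<nu>row by simp
  have WS: "V (n + 3) \<le> W (n + 3)"
  proof -
    have "(\<integral>\<^sup>+ p\<in>S. F p \<partial>lborel) \<le> (\<integral>\<^sup>+ p\<in>S. Favg p \<partial>lborel)"
    proof (rule area_Favg_upper)
      fix x y y' assume xy: "(x, y) \<in> S" and le: "y \<le> y'"
      have "g x \<le> ereal y" using xy by (simp add: S_def Sg_def)
      also have "ereal y \<le> ereal y'" using le by simp
      finally show "(x, y') \<in> S" using xy le by (auto simp: S_def Sg_def D0_def)
    qed measurable
    then show ?thesis using W_area[OF \<nu>S] V_area[OF \<nu>S] by simp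
  qed
  \<comment> \<open>The objective may grow under averaging but stays below the mass, so it remains
    finite and can serve as a row of the layer decomposition.\<close>
  have WS_le: "W (n + 3) \<le> W 0"
  proof -
    have "(\<integral>\<^sup>+ p\<in>S. Favg p \<partial>lborel) \<le> (\<integral>\<^sup>+ p\<in>D0 x0 y0. Favg p \<partial>lborel)"
      using sub(1) by (intro nn_integral_mono mult_left_mono) (auto simp: indicator_def)
    then show ?thesis using W_area[OF \<nu>S] W_area[OF \<nu>0] by simp
  qed
  have Wfin: "(\<integral>\<^sup>+ p. Favg p \<partial>\<nu> i) < \<infinity>" if "i \<in> {..n+3}" for i
  proof -
    have "W i < \<infinity>"
      using idx[OF that] W0 Wk Wcol Vfin Wrow WS_le
        le_less_trans[OF Wrow Vfin[of "n + 2"]] le_less_trans[OF WS_le] by auto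
    then show ?thesis by (simp add: W_def)
  qed

  \<comment> \<open>A finite conic combination of staircases\<close>
  have "\<exists>A p. finite A \<and> A \<subseteq> Theta N \<and> (\<forall>\<eta>. 0 \<le> p \<eta>) \<and> (\<forall>i\<in>{..n+3}.
    (\<Sum>\<eta>\<in>A. ennreal (p \<eta>) * emeasure (\<nu> i) (Rzw N x0 y0 \<eta>)) \<le> (\<integral>\<^sup>+ p. Favg p \<partial>\<nu> i) \<and>
    ((\<exists>T\<in>sets borel. \<nu> i = area_on T) \<longrightarrow>
      (\<Sum>\<eta>\<in>A. ennreal (p \<eta>) * emeasure (\<nu> i) (Rzw N x0 y0 \<eta>)) = (\<integral>\<^sup>+ p. Favg p \<partial>\<nu> i)))"
    by (rule Favg_staircase_combination[OF finite_atMost \<nu>_cases Wfin mN])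
  then obtain A p where A: "finite A" "A \<subseteq> Theta N" and p: "\<forall>\<eta>. 0 \<le> p \<eta>" and comb: "\<forall>i\<in>{..n+3}.
    (\<Sum>\<eta>\<in>A. ennreal (p \<eta>) * emeasure (\<nu> i) (Rzw N x0 y0 \<eta>)) \<le> (\<integral>\<^sup>+ p. Favg p \<partial>\<nu> i) \<and>
    ((\<exists>T\<in>sets borel. \<nu> i = area_on T) \<longrightarrow>
      (\<Sum>\<eta>\<in>A. ennreal (p \<eta>) * emeasure (\<nu> i) (Rzw N x0 y0 \<eta>)) = (\<integral>\<^sup>+ p. Favg p \<partial>\<nu> i))"
    by (elim exE conjE)
  define \<psi> where "\<psi> i \<eta> = measure (\<nu> i) (Rzw N x0 y0 \<eta>)" for i \<eta>
  have \<psi>_nonneg: "0 \<le> \<psi> i \<eta>" for i \<eta> by (simp add: \<psi>_def)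
  have D0_Rzw: "D0 x0 y0 \<inter> Rzw N x0 y0 \<eta> = Rzw N x0 y0 \<eta>" for \<eta> by (auto simp: Rzw_def)
  have em: "emeasure (\<nu> i) (Rzw N x0 y0 \<eta>) = ennreal (\<psi> i \<eta>)" if "\<eta> \<in> Theta N" for i \<eta>
  proof -
    have "emeasure (\<nu> i) (Rzw N x0 y0 \<eta>) < \<infinity>"
      using \<nu>_cases[of i]
    proof (elim disjE bexE)
      fix T assume T: "T \<in> sets borel" "\<nu> i = area_on T"
      have "emeasure (\<nu> i) (Rzw N x0 y0 \<eta>) \<le> emeasure lborel (Rzw N x0 y0 \<eta>)"
        using T Rzw_borel[OF that N1] by (auto simp: emeasure_area_on intro!: emeasure_mono)
      also have "\<dots> < \<infinity>" by (rule emeasure_Rzw_finite[OF that N1])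
      finally show ?thesis .
    qed (simp_all add: emeasure_col_length_Rzw[OF that N1] emeasure_row_length_Rzw[OF that N1])
    then show ?thesis unfolding \<psi>_def by (intro emeasure_eq_ennreal_measure) auto
  qed
  have \<psi>0: "\<psi> 0 \<eta> = measure lborel (Rzw N x0 y0 \<eta>)" if "\<eta> \<in> Theta N" for \<eta>
    unfolding \<psi>_def \<nu>0 measure_def using Rzw_borel[OF that N1] by (simp add: emeasure_area_on D0_Rzw)
  have \<psi>0_pos: "0 < \<psi> 0 \<eta>" if "\<eta> \<in> Theta N" for \<eta>
    unfolding \<psi>0[OF that] by (rule measure_Rzw_pos[OF that N1])
  have \<psi>_ratio: "ratio N x0 y0 T \<eta> = \<psi> i \<eta> / \<psi> 0 \<eta>"
    if "\<eta> \<in> Theta N" "\<nu> i = area_on T" "T \<in> sets borel" for \<eta> i T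
    unfolding \<psi>0[OF that(1)] unfolding \<psi>_def ratio_def that(2) measure_def
    using Rzw_borel[OF that(1) N1] that(3) by (simp add: emeasure_area_on)
  have \<psi>col: "\<psi> (n + 1) \<eta> = sum (snd \<eta>) {1..N}" if "\<eta> \<in> Theta N" for \<eta>
    unfolding \<psi>_def \<nu>col measure_def emeasure_col_length_Rzw[OF that N1]
    using Theta_sums_pos(2)[OF that N1, of N] N1 by simp
  have \<psi>row: "\<psi> (n + 2) \<eta> = sum (fst \<eta>) {1..N}" if "\<eta> \<in> Theta N" for \<eta>
    unfolding \<psi>_def \<nu>row measure_def emeasure_row_length_Rzw[OF that N1]
    using Theta_sums_pos(1)[OF that N1, of N] N1 by simp
  have sums: "(\<Sum>\<eta>\<in>A. ennreal (p \<eta>) * emeasure (\<nu> i) (Rzw N x0 y0 \<eta>)) = ennreal (\<Sum>\<eta>\<in>A. p \<eta> * \<psi> i \<eta>)" for i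
  proof -
    have "(\<Sum>\<eta>\<in>A. ennreal (p \<eta>) * emeasure (\<nu> i) (Rzw N x0 y0 \<eta>)) = (\<Sum>\<eta>\<in>A. ennreal (p \<eta> * \<psi> i \<eta>))"
      using A p by (intro sum.cong) (auto simp: em ennreal_mult \<psi>_nonneg)
    also have "\<dots> = ennreal (\<Sum>\<eta>\<in>A. p \<eta> * \<psi> i \<eta>)" using p \<psi>_nonneg by (intro sum_ennreal) auto
    finally show ?thesis .
  qed
  have comb_le: "ennreal (\<Sum>\<eta>\<in>A. p \<eta> * \<psi> i \<eta>) \<le> W i" if "i \<in> {..n+3}" for i
    using comb[rule_format, OF that] unfolding sums W_def by simp
  have comb_eq: "ennreal (\<Sum>\<eta>\<in>A. p \<eta> * \<psi> i \<eta>) = W i"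
    if "i \<in> {..n+3}" "\<nu> i = area_on T" "T \<in> sets borel" for i T
    using comb[rule_format, OF that(1)] that(2,3) unfolding sums W_def by blast

  \<comment> \<open>Reduction to \<open>n + 3\<close> atoms, with area as the strictly positive
    row\<close>
  have "\<exists>A' q. A' \<subseteq> A \<and> card A' \<le> card {..n+2} \<and> (\<forall>\<eta>\<in>A'. 0 \<le> q \<eta>) \<and>
    (\<forall>i\<in>{..n+2}. (\<Sum>\<eta>\<in>A'. q \<eta> * \<psi> i \<eta>) = (\<Sum>\<eta>\<in>A. p \<eta> * \<psi> i \<eta>)) \<and>
    (\<Sum>\<eta>\<in>A. p \<eta> * \<psi> (n + 3) \<eta>) \<le> (\<Sum>\<eta>\<in>A'. q \<eta> * \<psi> (n + 3) \<eta>)"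
    by (rule conic_support_reduction[where e = 0]) (use A p \<psi>0_pos in auto)
  then obtain A' q where A': "A' \<subseteq> A" "card A' \<le> n + 3" and q: "\<forall>\<eta>\<in>A'. 0 \<le> q \<eta>"
    and q_eq: "\<forall>i\<in>{..n+2}. (\<Sum>\<eta>\<in>A'. q \<eta> * \<psi> i \<eta>) = (\<Sum>\<eta>\<in>A. p \<eta> * \<psi> i \<eta>)"
    and q_obj: "(\<Sum>\<eta>\<in>A. p \<eta> * \<psi> (n + 3) \<eta>) \<le> (\<Sum>\<eta>\<in>A'. q \<eta> * \<psi> (n + 3) \<eta>)"
    by auto
  define tot where "tot i = (\<Sum>\<eta>\<in>A'. q \<eta> * \<psi> i \<eta>)" for i
  have tot_nonneg: "0 \<le> tot i" for i unfolding tot_def using q \<psi>_nonneg by (intro sum_nonneg) auto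
  have tot_eq: "tot i = (\<Sum>\<eta>\<in>A. p \<eta> * \<psi> i \<eta>)" if "i \<in> {..n+2}" for i using q_eq that by (simp add: tot_def)
  have A'_Theta: "A' \<subseteq> Theta N" "finite A'" using A A' finite_subset by auto
  have tot0: "tot 0 = c"
    using comb_eq[OF _ \<nu>0 D0_borel] tot_eq[of 0] W0 V0 c tot_nonneg[of 0] by simp
  have totk: "ennreal (tot k) = (\<integral>\<^sup>+ p\<in>Bx k. f p \<partial>lborel)" if k: "k \<in> {1..n}" for k
    using comb_eq[OF _ \<nu>k[OF k]] tot_eq[of k] Wk[OF k] Vk[OF k] k by simp
  have totcol: "tot (n + 1) \<le> uX"
  proof -
    have "ennreal (tot (n + 1)) \<le> ennreal uX"
      using order_trans[OF comb_le[of "n + 1"]] Wcol Vcol tot_eq[of "n + 1"] by simp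
    then show ?thesis using uX by simp
  qed
  have totrow: "tot (n + 2) \<le> uY"
  proof -
    have "ennreal (tot (n + 2)) \<le> ennreal uY"
      using order_trans[OF comb_le[of "n + 2"] order_trans[OF Wrow Vrow]] tot_eq[of "n + 2"] by simp
    then show ?thesis using uY by simp
  qed
  have totS: "(\<integral>\<^sup>+ p\<in>S. f p \<partial>lborel) \<le> ennreal (tot (n + 3))"
  proof -
    have "(\<integral>\<^sup>+ p\<in>S. f p \<partial>lborel) \<le> W (n + 3)" using WS VS by simp
    also have "\<dots> = ennreal (\<Sum>\<eta>\<in>A. p \<eta> * \<psi> (n + 3) \<eta>)" using comb_eq[OF _ \<nu>S] by simp
    also have "\<dots> \<le> ennreal (tot (n + 3))" unfolding tot_def using q_obj by (rule ennreal_leI)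
    finally show ?thesis .
  qed

  \<comment> \<open>Normalization to a probability distribution\<close>
  define r where "r \<eta> = q \<eta> * \<psi> 0 \<eta> / c" for \<eta>
  have r_nonneg: "\<forall>\<eta>\<in>A'. 0 \<le> r \<eta>" using q \<psi>_nonneg c by (simp add: r_def)
  \<comment> \<open>\<open>q\<close> weights indicators of regions, whereas \<open>Q\<close> weights
    uniform distributions; the factor is the area \<open>\<psi> 0\<close>. With it, total
    probability 1 is the mass row.\<close>
  have "sum r A' = tot 0 / c" by (simp add: r_def tot_def sum_divide_distrib)
  then have r_sum: "sum r A' = 1" using tot0 c by simp
  obtain Q where Q: "prob_space Q" "sets Q = sets (ThetaM N)" "emeasure Q A' = 1" "emeasure Q (Theta N) = 1"
    and QI: "\<forall>h. (\<integral>\<^sup>+ \<theta>. h \<theta> \<partial>Q) = (\<Sum>\<theta>\<in>A'. ennreal (r \<theta>) * h \<theta>)"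
    using discrete_mixing_measure[OF A'_Theta(2,1) r_nonneg r_sum] by (elim exE conjE)
  have int: "(\<integral>\<^sup>+ \<theta>. ennreal (h \<theta>) \<partial>Q) = ennreal (tot i / c)"
    if h: "\<And>\<eta>. \<eta> \<in> Theta N \<Longrightarrow> h \<eta> = \<psi> i \<eta> / \<psi> 0 \<eta>" for h i
  proof -
    have "(\<integral>\<^sup>+ \<theta>. ennreal (h \<theta>) \<partial>Q) = (\<Sum>\<eta>\<in>A'. ennreal (q \<eta> * \<psi> i \<eta> / c))"
      unfolding QI[rule_format]
    proof (rule sum.cong[OF refl])
      fix \<eta> assume \<eta>: "\<eta> \<in> A'"
      then have th: "\<eta> \<in> Theta N" using A'_Theta by blast
      have "ennreal (r \<eta>) * ennreal (h \<eta>) = ennreal (r \<eta> * h \<eta>)"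
        using r_nonneg[rule_format, OF \<eta>] \<psi>_nonneg by (intro ennreal_mult[symmetric]) (auto simp: h[OF th])
      also have "r \<eta> * h \<eta> = q \<eta> * \<psi> i \<eta> / c"
        using \<psi>0_pos[OF th] by (simp add: r_def h[OF th])
      finally show "ennreal (r \<eta>) * ennreal (h \<eta>) = ennreal (q \<eta> * \<psi> i \<eta> / c)" .
    qed
    also have "\<dots> = ennreal (tot i / c)"
      unfolding tot_def sum_divide_distrib using q \<psi>_nonneg c by (intro sum_ennreal) auto
    finally show ?thesis .
  qed
  have intcol: "(\<integral>\<^sup>+ \<theta>. ennreal (sum (snd \<theta>) {1..N} / measure lborel (Rzw N x0 y0 \<theta>)) \<partial>Q) = ennreal (tot (n + 1) / c)"
    by (rule int) (simp only: \<psi>col \<psi>0)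
  have introw: "(\<integral>\<^sup>+ \<theta>. ennreal (sum (fst \<theta>) {1..N} / measure lborel (Rzw N x0 y0 \<theta>)) \<partial>Q) = ennreal (tot (n + 2) / c)"
    by (rule int) (simp only: \<psi>row \<psi>0)
  have intk: "(\<integral>\<^sup>+ \<theta>. ennreal (ratio N x0 y0 (Bx k) \<theta>) \<partial>Q) = ennreal (tot k / c)" if "k \<in> {1..n}" for k
    by (rule int) (rule \<psi>_ratio[OF _ \<nu>k[OF that]], auto)
  have intS: "(\<integral>\<^sup>+ \<theta>. ennreal (ratio N x0 y0 S \<theta>) \<partial>Q) = ennreal (tot (n + 3) / c)"
    by (rule int) (rule \<psi>_ratio[OF _ \<nu>S], auto)
  have box: "ennreal (a k) \<le> ennreal (tot k / c) \<and> ennreal (tot k / c) \<le> ennreal (b k)" if k: "k \<in> {1..n}" for k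
  proof -
    have abk: "0 \<le> a k" "0 \<le> b k" using ab k by fastforce+
    have "ennreal (a k) * ennreal c \<le> ennreal (tot k)" "ennreal (tot k) \<le> ennreal (b k) * ennreal c"
      using feas k unfolding totk[OF k] by (auto simp: ou_feasible_def Bx_def mass)
    then have "a k * c \<le> tot k" "tot k \<le> b k * c"
      using abk c tot_nonneg by (auto simp: ennreal_mult[symmetric])
    then show ?thesis using c by (auto intro!: ennreal_leI simp: field_simps)
  qed
  have "III_feasible x0 y0 n x1 x2 y1 y2 a b uX uY c Q"
    unfolding III_feasible_def II_feasible_def Let_def N_def[symmetric] Bx_def[symmetric] intcol introw
  proof (intro conjI ballI exI[of _ A'])
    show "ennreal (tot (n + 1) / c) \<le> ennreal (uX / c)" "ennreal (tot (n + 2) / c) \<le> ennreal (uY / c)"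
      using totcol totrow c by (auto intro!: ennreal_leI divide_right_mono)
  qed (use Q A' A'_Theta intk box in auto)
  moreover have "enn2ereal (\<integral>\<^sup>+ p\<in>Sg x0 y0 g. f p \<partial>lborel) \<le> II_obj x0 y0 n (Sg x0 y0 g) c Q"
  proof -
    have "enn2ereal (\<integral>\<^sup>+ p\<in>S. f p \<partial>lborel) \<le> enn2ereal (ennreal (tot (n + 3)))"
      using totS by (simp add: less_eq_ennreal.rep_eq)
    also have "\<dots> = ereal c * enn2ereal (ennreal (tot (n + 3) / c))"
      using c tot_nonneg[of "n + 3"] by (simp add: enn2ereal_ennreal)
    finally show ?thesis using intS by (simp add: II_obj_def S_def N_def)
  qed
  ultimately show ?thesis by blast
qed

theorem mainTheorem10:
  fixes x0 y0 c uX uY l u :: real and n :: nat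
    and a b :: "nat \<Rightarrow> real" and x1 x2 y1 y2 :: "nat \<Rightarrow> ereal"
    and g :: "real \<Rightarrow> ereal"
  assumes "c > 0" and "uX \<ge> 0" and "uY \<ge> 0"
    and "\<forall>k\<in>{1..n}. 0 \<le> a k \<and> a k \<le> b k \<and> b k \<le> 1"
    and "\<forall>k\<in>{1..n}. ereal x0 \<le> x1 k \<and> x1 k \<le> x2 k \<and> ereal y0 \<le> y1 k \<and> y1 k \<le> y2 k"
    and "g \<in> borel_measurable (restrict_space borel {x0..})"
    and "\<forall>x\<ge>x0. ereal y0 \<le> g x"
    and "0 < l" and "l \<le> u"
  shows
    "(ou_value x0 y0 n x1 x2 y1 y2 a b uX uY (\<lambda>M. M = ennreal c) g
        = II_value x0 y0 n x1 x2 y1 y2 a b uX uY g c \<and>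
      II_value x0 y0 n x1 x2 y1 y2 a b uX uY g c
        = III_value x0 y0 n x1 x2 y1 y2 a b uX uY g c \<and>
      (\<forall>Q. II_feasible x0 y0 n x1 x2 y1 y2 a b uX uY c Q \<and>
           II_obj x0 y0 n (Sg x0 y0 g) c Q = II_value x0 y0 n x1 x2 y1 y2 a b uX uY g c \<longrightarrow>
         ou_feasible x0 y0 n x1 x2 y1 y2 a b uX uY (\<lambda>M. M = ennreal c) (mix_density x0 y0 n c Q) \<and>
         enn2ereal (\<integral>\<^sup>+ p\<in>Sg x0 y0 g. mix_density x0 y0 n c Q p \<partial>lborel)
           = ou_value x0 y0 n x1 x2 y1 y2 a b uX uY (\<lambda>M. M = ennreal c) g)) \<and>
     (ou_value x0 y0 n x1 x2 y1 y2 a b uX uY (\<lambda>M. ennreal l \<le> M \<and> M \<le> ennreal u) g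
        = III_var_value x0 y0 n x1 x2 y1 y2 a b uX uY g l u \<and>
      (\<forall>c' Q. l \<le> c' \<and> c' \<le> u \<and> III_feasible x0 y0 n x1 x2 y1 y2 a b uX uY c' Q \<and>
           II_obj x0 y0 n (Sg x0 y0 g) c' Q = III_var_value x0 y0 n x1 x2 y1 y2 a b uX uY g l u \<longrightarrow>
         ou_feasible x0 y0 n x1 x2 y1 y2 a b uX uY (\<lambda>M. ennreal l \<le> M \<and> M \<le> ennreal u)
           (mix_density x0 y0 n c' Q) \<and>
         enn2ereal (\<integral>\<^sup>+ p\<in>Sg x0 y0 g. mix_density x0 y0 n c' Q p \<partial>lborel)
           = ou_value x0 y0 n x1 x2 y1 y2 a b uX uY (\<lambda>M. ennreal l \<le> M \<and> M \<le> ennreal u) g))"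
proof (intro conjI allI impI)
  have ab: "\<forall>k\<in>{1..n}. 0 \<le> a k \<and> a k \<le> b k" using assms(4) by blast
  note g = assms(6)
  let ?S = "Sg x0 y0 g"
  let ?II = "II_value x0 y0 n x1 x2 y1 y2 a b uX uY g c"
  let ?III = "III_value x0 y0 n x1 x2 y1 y2 a b uX uY g c"
  let ?ou = "ou_value x0 y0 n x1 x2 y1 y2 a b uX uY (\<lambda>M. M = ennreal c) g"
  \<comment> \<open>The three values are compared in a cycle: density problem, (III), (II), and back
    by mixing.\<close>
  have "?ou \<le> ?III"
    unfolding ou_value_def
  proof (rule Sup_least, clarify)
    fix f assume f: "ou_feasible x0 y0 n x1 x2 y1 y2 a b uX uY (\<lambda>M. M = ennreal c) f"
    then have "(\<integral>\<^sup>+ p\<in>D0 x0 y0. f p \<partial>lborel) = ennreal c" by (simp add: ou_feasible_def)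
    from ou_dominated_by_III[OF assms(1-3) ab g f this]
    show "enn2ereal (\<integral>\<^sup>+ p\<in>?S. f p \<partial>lborel) \<le> ?III"
      unfolding III_value_def by (blast intro: Sup_upper2)
  qed
  moreover have "?III \<le> ?II"
    unfolding III_value_def II_value_def by (rule Sup_subset_mono) (auto simp: III_feasible_def)
  moreover have "?II \<le> ?ou"
    unfolding II_value_def
  proof (rule Sup_least, clarify)
    fix Q assume Q: "II_feasible x0 y0 n x1 x2 y1 y2 a b uX uY c Q"
    show "II_obj x0 y0 n ?S c Q \<le> ?ou"
      unfolding ou_value_def ou_feasible_mix_density(2)[where massOK = "\<lambda>M. M = ennreal c", OF assms(1) Q refl g, symmetric]
      using ou_feasible_mix_density(1)[where massOK = "\<lambda>M. M = ennreal c", OF assms(1) Q refl]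
      by (blast intro: Sup_upper)
  qed
  ultimately show ou_II: "?ou = ?II" and "?II = ?III" by order+
  fix Q
  assume "II_feasible x0 y0 n x1 x2 y1 y2 a b uX uY c Q \<and> II_obj x0 y0 n ?S c Q = ?II"
  then have Q: "II_feasible x0 y0 n x1 x2 y1 y2 a b uX uY c Q" and opt: "II_obj x0 y0 n ?S c Q = ?II"
    by blast+
  show "ou_feasible x0 y0 n x1 x2 y1 y2 a b uX uY (\<lambda>M. M = ennreal c) (mix_density x0 y0 n c Q)"
    by (rule ou_feasible_mix_density(1)[OF assms(1) Q]) simp
  show "enn2ereal (\<integral>\<^sup>+ p\<in>?S. mix_density x0 y0 n c Q p \<partial>lborel) = ?ou"
    using ou_feasible_mix_density(2)[where massOK = "\<lambda>M. M = ennreal c", OF assms(1) Q refl g] opt ou_II by simp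
next
  have ab: "\<forall>k\<in>{1..n}. 0 \<le> a k \<and> a k \<le> b k" using assms(4) by blast
  note g = assms(6)
  let ?S = "Sg x0 y0 g"
  let ?OK = "\<lambda>M. ennreal l \<le> M \<and> M \<le> ennreal u"
  let ?var = "III_var_value x0 y0 n x1 x2 y1 y2 a b uX uY g l u"
  let ?ou_var = "ou_value x0 y0 n x1 x2 y1 y2 a b uX uY ?OK g"
  have mixture: "ou_feasible x0 y0 n x1 x2 y1 y2 a b uX uY ?OK (mix_density x0 y0 n c' Q)"
    "enn2ereal (\<integral>\<^sup>+ p\<in>?S. mix_density x0 y0 n c' Q p \<partial>lborel) = II_obj x0 y0 n ?S c' Q"
    if "l \<le> c'" "c' \<le> u" "III_feasible x0 y0 n x1 x2 y1 y2 a b uX uY c' Q" for c' Q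
  proof -
    have c': "0 < c'" using that assms(8) by simp
    have Q: "II_feasible x0 y0 n x1 x2 y1 y2 a b uX uY c' Q" using that by (simp add: III_feasible_def)
    have OK: "?OK (ennreal c')" using that by (simp add: ennreal_leI)
    show "ou_feasible x0 y0 n x1 x2 y1 y2 a b uX uY ?OK (mix_density x0 y0 n c' Q)"
      by (rule ou_feasible_mix_density(1)[where massOK = ?OK, OF c' Q OK])
    show "enn2ereal (\<integral>\<^sup>+ p\<in>?S. mix_density x0 y0 n c' Q p \<partial>lborel) = II_obj x0 y0 n ?S c' Q"
      by (rule ou_feasible_mix_density(2)[where massOK = ?OK, OF c' Q OK g])
  qed
  have "?ou_var \<le> ?var"
    unfolding ou_value_def
  proof (rule Sup_least, clarify)
    fix f assume f: "ou_feasible x0 y0 n x1 x2 y1 y2 a b uX uY ?OK f"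
    then have M: "?OK (\<integral>\<^sup>+ p\<in>D0 x0 y0. f p \<partial>lborel)" by (simp add: ou_feasible_def)
    \<comment> \<open>The mass is finite because \<open>u\<close> bounds it; its real value becomes
      the decision variable.\<close>
    then obtain c' where c': "0 \<le> c'" "(\<integral>\<^sup>+ p\<in>D0 x0 y0. f p \<partial>lborel) = ennreal c'"
      by (cases "\<integral>\<^sup>+ p\<in>D0 x0 y0. f p \<partial>lborel" rule: ennreal_cases) (auto simp: top_unique)
    then have lu: "l \<le> c'" "c' \<le> u" using M assms(8,9) by auto
    then have "0 < c'" using assms(8) by simp
    from ou_dominated_by_III[OF this assms(2,3) ab g f c'(2)]
    show "enn2ereal (\<integral>\<^sup>+ p\<in>?S. f p \<partial>lborel) \<le> ?var"
      unfolding III_var_value_def using lu by (blast intro: Sup_upper2)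
  qed
  moreover have "?var \<le> ?ou_var"
    unfolding III_var_value_def
  proof (rule Sup_least, clarify)
    fix c' Q assume *: "l \<le> c'" "c' \<le> u" "III_feasible x0 y0 n x1 x2 y1 y2 a b uX uY c' Q"
    show "II_obj x0 y0 n ?S c' Q \<le> ?ou_var"
      unfolding ou_value_def mixture(2)[OF *, symmetric]
      using mixture(1)[OF *] by (blast intro: Sup_upper)
  qed
  ultimately show ou_var: "?ou_var = ?var" by order
  fix c' Q
  assume "l \<le> c' \<and> c' \<le> u \<and> III_feasible x0 y0 n x1 x2 y1 y2 a b uX uY c' Q \<and>
    II_obj x0 y0 n ?S c' Q = ?var"
  then have *: "l \<le> c'" "c' \<le> u" "III_feasible x0 y0 n x1 x2 y1 y2 a b uX uY c' Q"
    and opt: "II_obj x0 y0 n ?S c' Q = ?var" by blast+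
  show "ou_feasible x0 y0 n x1 x2 y1 y2 a b uX uY ?OK (mix_density x0 y0 n c' Q)" by (rule mixture(1)[OF *])
  show "enn2ereal (\<integral>\<^sup>+ p\<in>?S. mix_density x0 y0 n c' Q p \<partial>lborel) = ?ou_var"
    using mixture(2)[OF *] opt ou_var by simp
qed

end
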